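(* For the $k$-variable polynomial semiring $\mathbb{B}[\pmb x]$ over $\mathbb{B}$ we have that: (i) For every prime congruence $P$ of $\mathbb{B}[\pmb x]$ there is a (possibly empty) subset $H$ of the variables $\pmb x$ and a prime $P[U]$ of the polynomial semiring $\mathbb{B}[\pmb x']$ with variables $\pmb x'=\pmb x\setminus H$, such that $P$ is generated by the pairs $\{(x_i,0)\mid x_i\in H\}$ and the image of $P[U]$ under the embedding $\mathbb{B}[\pmb x']\hookrightarrow\mathbb{B}[\pmb x]$. (ii) The minimal prime congruences of $\mathbb{B}[\pmb x]$ have $\{0\}$ as their kernel and are all of the form $P[U]$, where $U$ is an admissible matrix (with $k$ columns) with $\mathrm{Ker}(U)\cap\mathbb{Z}^k=\{\pmb 0\}$. (iii) $\dim(\mathbb{B}[\pmb x])=k$. (iv) The pair $(f,g)$ lies in the radical $\mathrm{Rad}(\Delta)$ of the trivial congruence of $\mathbb{B}[\pmb x]$ if and only if $newt(f)=newt(g)$. (v) The $\mathbb{B}$-algebra $\mathbb{B}[\pmb x]/\mathrm{Rad}(\Delta)$ is isomorphic to the $\mathbb{B}$-algebra whose elements are the lattice polytopes lying in the non-negative quadrant $\mathbb{R}_{\ge 0}^k$, with addition defined as the convex hull of the union and multiplication as the Minkowski sum. (vi) The congruence $\mathrm{Rad}(\Delta)$ is QC.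
   Context: A semiring is a commutative semiring with additive identity $0$ and multiplicative identity $1$, with $1\neq 0$ and $a\cdot 0=0$ for all $a$; a $\mathbb{B}$-algebra is a semiring with idempotent addition. $\mathbb{B}=\{0,1\}$ is the two-element semifield with $1+1=1$. For $\pmb x=(x_1,\dots,x_k)$, $\mathbb{B}[\pmb x]$ (resp. $\mathbb{B}(\pmb x)$) is the semiring of polynomials (resp. Laurent polynomials), i.e. formal finite sums of monomials $\pmb x^{\pmb n}=x_1^{n_1}\cdots x_k^{n_k}$ with $\pmb n\in\mathbb{N}^k$ (resp. $\pmb n\in\mathbb{Z}^k$), where $0\in\mathbb{N}$, with coefficients in $\mathbb{B}$. A congruence of $A$ is an equivalence relation $I\subseteq A\times A$ compatible with addition and multiplication; it is proper if $I\ne A\times A$; $\Delta$ is the trivial congruence (the diagonal). The kernel of a congruence is the equivalence class of $0$. A congruence $P$ is prime if it is proper and for all pairs $\alpha,\beta\in A\times A$ such that the twisted product $\alpha\beta=(\alpha_1\beta_1+\alpha_2\beta_2,\alpha_1\beta_2+\alpha_2\beta_1)$ is in $P$, we have $\alpha\in P$ or $\beta\in P$; minimal primes are minimal with respect to inclusion. $\dim(A)$ is the length (number of strict inclusions) of the longest chain of prime congruences of $A$. $\mathrm{Rad}(I)$ is the intersection of all prime congruences containing $I$. $I$ is QC if it is proper and $A/I$ is cancellative, i.e. $ab=ac$ in $A/I$ implies $a=0$ or $b=c$. A real matrix $U$ with $k$ columns is admissible if every row is non-redundant, i.e. for each $i$ there is $\pmb n\in\mathbb{Z}^k$ such that the first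 non-zero coordinate of $U\pmb n$ is the $i$-th one; the matrix with zero rows is allowed. For an admissible $U$ with $k$ columns, $P(U)$ is the (prime) congruence of $\mathbb{B}(\pmb x)$ generated by the pairs $(\pmb x^{\pmb n_1}+\pmb x^{\pmb n_2},\pmb x^{\pmb n_2})$ such that $U(\pmb n_2-\pmb n_1)=\pmb 0$ or the first non-zero coordinate of $U(\pmb n_2-\pmb n_1)$ is positive, and $P[U]=P(U)\cap(\mathbb{B}[\pmb x]\times\mathbb{B}[\pmb x])$ is its restriction to $\mathbb{B}[\pmb x]$; the same notation is used for any finite set of variables, with the number of columns equal to the number of variables. $\mathrm{Ker}(U)$ is the kernel of the linear map given by $U$. A lattice polytope in $\mathbb{R}^k$ is a polytope all of whose vertices lie in $\mathbb{Z}^k$; the empty set is included. For $f=\sum_i\pmb x^{\pmb n_i}$, $newt(f)$ is the convex hull of the points $\pmb n_i$; $newt(0)=\emptyset$. *)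

theory Defs
  imports
    "HOL-Algebra.QuotRing"
    "HOL-Analysis.Analysis"
    "HOL-Analysis.Finite_Function_Topology"
    "HOL-Library.Extended_Nat"
    "HOL-Library.Poly_Mapping"
    "Jordan_Normal_Form.Matrix_Kernel"
begin

section \<open>Semirings and their congruences\<close>

text \<open>Semirings with a carrier use the record type of HOL-Algebra. Being commutative and having
  \<open>\<one> \<noteq> \<zero>\<close> are part of the notion of a semiring here. The action of the two-element semifield
  on an idempotent semiring is unique, so it is not recorded, and every semiring homomorphism
  respects it.\<close>

definition balgebra :: "('a, 'm) ring_scheme \<Rightarrow> bool" where
  "balgebra A \<longleftrightarrow> semiring A \<and> comm_monoid A \<and> \<one>\<^bsub>A\<^esub> \<noteq> \<zero>\<^bsub>A\<^esub> \<and>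
     (\<forall>a\<in>carrier A. a \<oplus>\<^bsub>A\<^esub> a = a)"

text \<open>Homomorphisms in the sense of \<open>ring_hom\<close> preserve \<open>\<one>\<close>, but for semirings the
  preservation of \<open>\<zero>\<close> has to be required as well.\<close>

definition balgebra_iso :: "('a, 'm) ring_scheme \<Rightarrow> ('b, 'n) ring_scheme \<Rightarrow> bool" where
  "balgebra_iso A B \<longleftrightarrow> balgebra A \<and> balgebra B \<and>
     (\<exists>h \<in> ring_iso A B. h \<zero>\<^bsub>A\<^esub> = \<zero>\<^bsub>B\<^esub>)"

definition congruence :: "('a, 'm) ring_scheme \<Rightarrow> ('a \<times> 'a) set \<Rightarrow> bool" where
  "congruence A I \<longleftrightarrow> equiv (carrier A) I \<and>
     (\<forall>a b c d. (a, b) \<in> I \<and> (c, d) \<in> I \<longrightarrow>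
        (a \<oplus>\<^bsub>A\<^esub> c, b \<oplus>\<^bsub>A\<^esub> d) \<in> I \<and> (a \<otimes>\<^bsub>A\<^esub> c, b \<otimes>\<^bsub>A\<^esub> d) \<in> I)"

definition proper_congruence :: "('a, 'm) ring_scheme \<Rightarrow> ('a \<times> 'a) set \<Rightarrow> bool" where
  "proper_congruence A I \<longleftrightarrow> congruence A I \<and> I \<noteq> carrier A \<times> carrier A"

definition trivial_congruence :: "('a, 'm) ring_scheme \<Rightarrow> ('a \<times> 'a) set" where
  "trivial_congruence A = Id_on (carrier A)"

definition congruence_kernel :: "('a, 'm) ring_scheme \<Rightarrow> ('a \<times> 'a) set \<Rightarrow> 'a set" where
  "congruence_kernel A I = I `` {\<zero>\<^bsub>A\<^esub>}"

definition generated_congruence ::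
    "('a, 'm) ring_scheme \<Rightarrow> ('a \<times> 'a) set \<Rightarrow> ('a \<times> 'a) set" where
  "generated_congruence A S = \<Inter>{I. congruence A I \<and> S \<subseteq> I}"

definition twisted_product ::
    "('a, 'm) ring_scheme \<Rightarrow> 'a \<times> 'a \<Rightarrow> 'a \<times> 'a \<Rightarrow> 'a \<times> 'a" where
  "twisted_product A \<alpha> \<beta> =
     ((fst \<alpha> \<otimes>\<^bsub>A\<^esub> fst \<beta>) \<oplus>\<^bsub>A\<^esub> (snd \<alpha> \<otimes>\<^bsub>A\<^esub> snd \<beta>),
      (fst \<alpha> \<otimes>\<^bsub>A\<^esub> snd \<beta>) \<oplus>\<^bsub>A\<^esub> (snd \<alpha> \<otimes>\<^bsub>A\<^esub> fst \<beta>))"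

definition prime_congruence :: "('a, 'm) ring_scheme \<Rightarrow> ('a \<times> 'a) set \<Rightarrow> bool" where
  "prime_congruence A P \<longleftrightarrow> proper_congruence A P \<and>
     (\<forall>\<alpha> \<in> carrier A \<times> carrier A. \<forall>\<beta> \<in> carrier A \<times> carrier A.
        twisted_product A \<alpha> \<beta> \<in> P \<longrightarrow> \<alpha> \<in> P \<or> \<beta> \<in> P)"

definition minimal_prime_congruence ::
    "('a, 'm) ring_scheme \<Rightarrow> ('a \<times> 'a) set \<Rightarrow> bool" where
  "minimal_prime_congruence A P \<longleftrightarrow> prime_congruence A P \<and>
     (\<forall>Q. prime_congruence A Q \<and> Q \<subseteq> P \<longrightarrow> Q = P)"

text \<open>The value is \<open>\<infinity>\<close> if there are arbitrarily long chains; if it is finite (and there is a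
  prime at all) it is attained.\<close>

definition congruence_dim :: "('a, 'm) ring_scheme \<Rightarrow> enat" where
  "congruence_dim A = Sup {enat n | n.
     \<exists>c :: nat \<Rightarrow> ('a \<times> 'a) set.
       (\<forall>i\<le>n. prime_congruence A (c i)) \<and> (\<forall>i<n. c i \<subset> c (Suc i))}"

text \<open>The intersection with \<open>carrier A \<times> carrier A\<close> only matters for the empty family of primes.\<close>

definition congruence_Rad ::
    "('a, 'm) ring_scheme \<Rightarrow> ('a \<times> 'a) set \<Rightarrow> ('a \<times> 'a) set" where
  "congruence_Rad A I =
     (carrier A \<times> carrier A) \<inter> \<Inter>{P. prime_congruence A P \<and> I \<subseteq> P}"

definition quotient_semiring ::
    "('a, 'm) ring_scheme \<Rightarrow> ('a \<times> 'a) set \<Rightarrow> 'a set ring" where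
  "quotient_semiring A I =
     \<lparr>carrier = carrier A // I,
      monoid.mult = (\<lambda>X Y. \<Union>x\<in>X. \<Union>y\<in>Y. I `` {x \<otimes>\<^bsub>A\<^esub> y}),
      one = I `` {\<one>\<^bsub>A\<^esub>},
      zero = I `` {\<zero>\<^bsub>A\<^esub>},
      add = (\<lambda>X Y. \<Union>x\<in>X. \<Union>y\<in>Y. I `` {x \<oplus>\<^bsub>A\<^esub> y})\<rparr>"

definition cancellative :: "('a, 'm) ring_scheme \<Rightarrow> bool" where
  "cancellative A \<longleftrightarrow>
     (\<forall>a\<in>carrier A. \<forall>b\<in>carrier A. \<forall>c\<in>carrier A.
        a \<otimes>\<^bsub>A\<^esub> b = a \<otimes>\<^bsub>A\<^esub> c \<longrightarrow> a = \<zero>\<^bsub>A\<^esub> \<or> b = c)"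

definition QC_congruence :: "('a, 'm) ring_scheme \<Rightarrow> ('a \<times> 'a) set \<Rightarrow> bool" where
  "QC_congruence A I \<longleftrightarrow> proper_congruence A I \<and> cancellative (quotient_semiring A I)"


section \<open>Polynomials and Laurent polynomials over the two-element semifield\<close>

datatype two = Zero2 | One2

instantiation two :: comm_semiring_1
begin

definition zero_two :: two where "0 = Zero2"
definition one_two :: two where "1 = One2"
definition plus_two :: "two \<Rightarrow> two \<Rightarrow> two" where
  "a + b = (if a = Zero2 \<and> b = Zero2 then Zero2 else One2)"
definition times_two :: "two \<Rightarrow> two \<Rightarrow> two" where
  "a * b = (if a = One2 \<and> b = One2 then One2 else Zero2)"

instance
proof
  fix a b c :: two
  show "a + b + c = a + (b + c)" "a + b = b + a" "0 + a = a"
    by (cases a; cases b; cases c; simp add: plus_two_def zero_two_def)+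
  show "a * b * c = a * (b * c)" "a * b = b * a" "1 * a = a" "0 * a = 0" "a * 0 = 0"
    by (cases a; cases b; cases c; simp add: times_two_def zero_two_def one_two_def)+
  show "(a + b) * c = a * c + b * c"
    by (cases a; cases b; cases c; simp add: times_two_def plus_two_def)
  show "(0::two) \<noteq> 1"
    by (simp add: zero_two_def one_two_def)
qed

end

text \<open>Variables are natural numbers and \<open>V\<close> is the finite set of variables in use; the tuple
  \<open>x\<close> of \<open>k\<close> variables is \<open>V = {..<k}\<close>. An exponent vector in \<open>\<int>\<^sup>V\<close> is a finitely supported
  function \<open>nat \<Rightarrow>\<^sub>0 int\<close> supported in \<open>V\<close>, and a Laurent polynomial is a finitely supported
  function from exponent vectors to coefficients, with the convolution product of
  \<^theory>\<open>HOL-Library.Poly_Mapping\<close>. In this way polynomials are Laurent polynomials, and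
  polynomials in fewer variables are polynomials in more variables: both embeddings are
  inclusions of carriers.\<close>

type_synonym laurent = "(nat \<Rightarrow>\<^sub>0 int) \<Rightarrow>\<^sub>0 two"

definition exponents :: "nat set \<Rightarrow> (nat \<Rightarrow>\<^sub>0 int) set" where
  "exponents V = {n. Poly_Mapping.keys n \<subseteq> V}"

definition laurent_semiring :: "nat set \<Rightarrow> laurent ring" where
  "laurent_semiring V =
     \<lparr>carrier = {f. Poly_Mapping.keys f \<subseteq> exponents V},
      monoid.mult = (*), one = 1, zero = 0, add = (+)\<rparr>"

definition poly_semiring :: "nat set \<Rightarrow> laurent ring" where
  "poly_semiring V =
     \<lparr>carrier = {f. Poly_Mapping.keys f \<subseteq>
        {n \<in> exponents V. \<forall>i. 0 \<le> Poly_Mapping.lookup n i}},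
      monoid.mult = (*), one = 1, zero = 0, add = (+)\<rparr>"

definition monomial :: "(nat \<Rightarrow>\<^sub>0 int) \<Rightarrow> laurent" where
  "monomial n = Poly_Mapping.single n 1"

definition variable :: "nat \<Rightarrow> laurent" where
  "variable i = monomial (Poly_Mapping.single i 1)"


section \<open>Prime congruences given by matrices\<close>

definition first_nonzero_at :: "real Matrix.vec \<Rightarrow> nat \<Rightarrow> bool" where
  "first_nonzero_at v i \<longleftrightarrow>
     i < dim_vec v \<and> vec_index v i \<noteq> 0 \<and> (\<forall>j<i. vec_index v j = 0)"

definition admissible :: "real mat \<Rightarrow> bool" where
  "admissible U \<longleftrightarrow>
     (\<forall>i < dim_row U. \<exists>n :: int Matrix.vec. n \<in> carrier_vec (dim_col U) \<and>
        first_nonzero_at (U *\<^sub>v map_vec real_of_int n) i)"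

text \<open>The columns of a matrix correspond to the variables in \<open>V\<close> in increasing order.\<close>

definition exponent_vec :: "nat set \<Rightarrow> (nat \<Rightarrow>\<^sub>0 int) \<Rightarrow> real Matrix.vec" where
  "exponent_vec V n =
     Matrix.vec (card V) (\<lambda>j. real_of_int (Poly_Mapping.lookup n (sorted_list_of_set V ! j)))"

definition lex_nonneg :: "real Matrix.vec \<Rightarrow> bool" where
  "lex_nonneg v \<longleftrightarrow>
     v = 0\<^sub>v (dim_vec v) \<or> (\<exists>i. first_nonzero_at v i \<and> vec_index v i > 0)"

text \<open>\<open>laurent_prime V U\<close> is \<open>P(U)\<close>, and \<open>poly_prime V U\<close> is \<open>P[U]\<close>.\<close>

definition laurent_prime :: "nat set \<Rightarrow> real mat \<Rightarrow> (laurent \<times> laurent) set" where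
  "laurent_prime V U = generated_congruence (laurent_semiring V)
     {(monomial n1 + monomial n2, monomial n2) | n1 n2.
        n1 \<in> exponents V \<and> n2 \<in> exponents V \<and>
        lex_nonneg (U *\<^sub>v exponent_vec V (n2 - n1))}"

definition poly_prime :: "nat set \<Rightarrow> real mat \<Rightarrow> (laurent \<times> laurent) set" where
  "poly_prime V U =
     laurent_prime V U \<inter> (carrier (poly_semiring V) \<times> carrier (poly_semiring V))"


section \<open>Newton polytopes\<close>

text \<open>\<open>\<real>\<^sup>V\<close> is the space of finitely supported functions \<open>nat \<Rightarrow>\<^sub>0 real\<close> that are supported in
  \<open>V\<close>, inside the real vector space of all of them.\<close>

definition real_exponent :: "(nat \<Rightarrow>\<^sub>0 int) \<Rightarrow> (nat \<Rightarrow>\<^sub>0 real)" where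
  "real_exponent n = Poly_Mapping.map real_of_int n"

definition newt :: "laurent \<Rightarrow> (nat \<Rightarrow>\<^sub>0 real) set" where
  "newt f = convex hull (real_exponent ` Poly_Mapping.keys f)"

definition lattice_polytope :: "nat set \<Rightarrow> (nat \<Rightarrow>\<^sub>0 real) set \<Rightarrow> bool" where
  "lattice_polytope V S \<longleftrightarrow> polytope S \<and> S \<subseteq> {p. Poly_Mapping.keys p \<subseteq> V} \<and>
     (\<forall>v. v extreme_point_of S \<longrightarrow> v \<in> real_exponent ` exponents V)"

text \<open>The identity of the Minkowski sum is the polytope \<open>{0}\<close>, and the identity of the addition
  is the empty polytope.\<close>

definition polytope_semiring :: "nat set \<Rightarrow> (nat \<Rightarrow>\<^sub>0 real) set ring" where
  "polytope_semiring V =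
     \<lparr>carrier = {S. lattice_polytope V S \<and> (\<forall>p\<in>S. \<forall>i\<in>V. 0 \<le> Poly_Mapping.lookup p i)},
      monoid.mult = (\<lambda>S T. {s + t | s t. s \<in> S \<and> t \<in> T}),
      one = {0},
      zero = {},
      add = (\<lambda>S T. convex hull (S \<union> T))\<rparr>"

end

theory Submission
  imports Defs
begin

text \<open>Over the two-element semifield a polynomial is the finite set of its exponents, and modulo a
  prime congruence it equals one of its monomials, because the twisted product of \<open>(f + g, f)\<close>
  and \<open>(f + g, g)\<close> lies on the diagonal. So a prime is given by the set \<open>H\<close> of variables that
  vanish and a total preorder on the exponents in the remaining variables, encoded by the cone \<open>C\<close>
  of the differences that are \<open>\<ge> 0\<close>. Such a cone is lexicographic: Hoelder's theorem, applied to
  the kernel of the functionals found so far, yields the next row of the matrix, and there are at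
  most as many irredundant rows as variables. By Zorn's lemma the preorder can be refined to a
  total order on all exponents in which the variables in \<open>H\<close> are infinitesimally small, so every
  prime contains one given by a total order. Hence the radical is the intersection of these, and
  they separate a lattice point from a Newton polytope not containing it. Along a chain of primes
  the rank of the monomials modulo the identified ones drops strictly, which bounds the
  dimension.\<close>

section \<open>Polynomials over the two-element semifield as finite sets of exponents\<close>

text \<open>The exponents form a group without scalars, while matrices and polytopes are real. Two
  devices bridge this. Orders are built inside the group, by Zorn's lemma on submonoids, where
  absence of torsion replaces division. Functionals come from regarding the embedded exponents and
  the reals as vector spaces over the rationals: an additive function on a subgroup extends because
  the reals are divisible, and clearing denominators turns rational dependence into integer
  relations. The matrix form of an order has a second use besides (i) and (ii): its functionals
  extend to real points, so the points strictly below a given exponent form a convex set. This shows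
  that equal Newton polytopes force congruence modulo every prime; a bare cone of lattice
  differences says nothing about real convex combinations. For the dimension, the primes of a chain
  may have different kernels, so killing a variable and coarsening the order must both be counted;
  independence modulo the identified monomials measures the two together.\<close>

lemma two_eq_0_or_1: "(a::two) = 0 \<or> a = 1"
  by (cases a) (auto simp: zero_two_def one_two_def)

lemma two_add_eq_0_iff: "(a::two) + b = 0 \<longleftrightarrow> a = 0 \<and> b = 0"
  by (auto simp: plus_two_def zero_two_def)

lemma two_eq_iff: "(a::two) = b \<longleftrightarrow> (a = 0 \<longleftrightarrow> b = 0)"
  using two_eq_0_or_1[of a] two_eq_0_or_1[of b] by auto

lemma two_poly_eq_iff: "f = g \<longleftrightarrow> Poly_Mapping.keys f = Poly_Mapping.keys g"
  for f g :: "'a \<Rightarrow>\<^sub>0 two"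
proof
  assume "Poly_Mapping.keys f = Poly_Mapping.keys g"
  then show "f = g"
    by (intro poly_mapping_eqI) (metis two_eq_iff in_keys_iff)
qed simp

lemma keys_add_two: "Poly_Mapping.keys (f + g) = Poly_Mapping.keys f \<union> Poly_Mapping.keys g"
  for f g :: "'a \<Rightarrow>\<^sub>0 two"
  by (auto simp: in_keys_iff lookup_add two_add_eq_0_iff)

lemma two_poly_add_idem: "f + f = f" for f :: "'a \<Rightarrow>\<^sub>0 two"
  by (simp add: two_poly_eq_iff keys_add_two)

lemma keys_monomial [simp]: "Poly_Mapping.keys (monomial n) = {n}"
  by (simp add: monomial_def)

lemma monomial_mult: "monomial m * monomial n = monomial (m + n)"
  by (simp add: monomial_def mult_single)

text \<open>Sums never cancel here: the monomial of \<open>m\<close> can be added to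
  \<open>f\<close> for free, and that of \<open>n\<close> to \<open>g\<close>, so
  \<open>m + n\<close> appears as a summand of the expanded product and survives.\<close>

lemma keys_mult_two: "Poly_Mapping.keys (f * g) = Poly_Mapping.keys f + Poly_Mapping.keys g"
  for f g :: laurent
proof
  show "Poly_Mapping.keys (f * g) \<subseteq> Poly_Mapping.keys f + Poly_Mapping.keys g"
    using keys_mult[of f g] unfolding set_plus_def by blast
  have "m + n \<in> Poly_Mapping.keys (f * g)"
    if "m \<in> Poly_Mapping.keys f" "n \<in> Poly_Mapping.keys g" for m n
  proof -
    have "f = monomial m + f" "g = monomial n + g"
      using that by (auto simp: two_poly_eq_iff keys_add_two)
    then have "f * g = (monomial m + f) * (monomial n + g)" by simp
    also have "\<dots> = monomial (m + n) + (monomial m * g + f * (monomial n + g))"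
      by (simp add: distrib_left distrib_right monomial_mult ac_simps)
    finally have "f * g = monomial (m + n) + (monomial m * g + f * (monomial n + g))" .
    then show ?thesis
      by (metis keys_add_two keys_monomial UnI1 singletonI)
  qed
  then show "Poly_Mapping.keys f + Poly_Mapping.keys g \<subseteq> Poly_Mapping.keys (f * g)"
    by (auto elim: set_plus_elim)
qed

lemma keys_sum_monomial:
  "finite M \<Longrightarrow> Poly_Mapping.keys (\<Sum>n\<in>M. monomial n) = M"
  by (induction M rule: finite_induct) (auto simp: keys_add_two)

lemma sum_monomial_keys: "(\<Sum>n\<in>Poly_Mapping.keys f. monomial n) = f"
  by (simp add: two_poly_eq_iff keys_sum_monomial)

lemma laurent_induct [case_names zero add]:
  assumes "P 0" and "\<And>n f. P f \<Longrightarrow> P (monomial n + f)"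
  shows "P (f :: laurent)"
proof -
  have "P (\<Sum>n\<in>M. monomial n)" if "finite M" for M
    using that by (induction M rule: finite_induct) (auto simp: assms)
  from this[of "Poly_Mapping.keys f"] show ?thesis
    by (simp add: sum_monomial_keys)
qed


section \<open>Monoid algebras\<close>

definition monoid_algebra :: "(nat \<Rightarrow>\<^sub>0 int) set \<Rightarrow> laurent ring" where
  "monoid_algebra S = \<lparr>carrier = {f. Poly_Mapping.keys f \<subseteq> S},
     monoid.mult = (*), one = 1, zero = 0, add = (+)\<rparr>"

lemma monoid_algebra_simps [simp]:
  "carrier (monoid_algebra S) = {f. Poly_Mapping.keys f \<subseteq> S}"
  "monoid.mult (monoid_algebra S) = (*)"
  "one (monoid_algebra S) = 1"
  "zero (monoid_algebra S) = 0"
  "add (monoid_algebra S) = (+)"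
  by (simp_all add: monoid_algebra_def)

definition nonneg_exponents :: "nat set \<Rightarrow> (nat \<Rightarrow>\<^sub>0 int) set" where
  "nonneg_exponents V = {n \<in> exponents V. \<forall>i. 0 \<le> Poly_Mapping.lookup n i}"

lemma laurent_semiring_eq: "laurent_semiring V = monoid_algebra (exponents V)"
  by (simp add: laurent_semiring_def monoid_algebra_def)

lemma poly_semiring_eq: "poly_semiring V = monoid_algebra (nonneg_exponents V)"
  by (simp add: poly_semiring_def monoid_algebra_def nonneg_exponents_def)

definition add_closed :: "'a::comm_monoid_add set \<Rightarrow> bool" where
  "add_closed S \<longleftrightarrow> 0 \<in> S \<and> (\<forall>a\<in>S. \<forall>b\<in>S. a + b \<in> S)"

lemma add_closedD: "add_closed S \<Longrightarrow> 0 \<in> S" "add_closed S \<Longrightarrow> a \<in> S \<Longrightarrow> b \<in> S \<Longrightarrow> a + b \<in> S"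
  by (auto simp: add_closed_def)

lemma mem_exponents: "n \<in> exponents V \<longleftrightarrow> (\<forall>i. i \<notin> V \<longrightarrow> Poly_Mapping.lookup n i = 0)"
  by (auto simp: exponents_def in_keys_iff)

lemma exponents_closed:
  "0 \<in> exponents V" "a \<in> exponents V \<Longrightarrow> b \<in> exponents V \<Longrightarrow> a + b \<in> exponents V"
  "a \<in> exponents V \<Longrightarrow> - a \<in> exponents V"
  "a \<in> exponents V \<Longrightarrow> b \<in> exponents V \<Longrightarrow> a - b \<in> exponents V"
  "a \<in> exponents V \<Longrightarrow> frag_cmul c a \<in> exponents V"
  "finite I \<Longrightarrow> (\<And>i. i \<in> I \<Longrightarrow> F i \<in> exponents V) \<Longrightarrow> sum F I \<in> exponents V"
  by (simp_all add: mem_exponents lookup_add lookup_minus lookup_sum)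

lemma add_closed_exponents: "add_closed (exponents V)"
  by (simp add: add_closed_def exponents_closed)

lemma mem_nonneg_exponents:
  "n \<in> nonneg_exponents V \<longleftrightarrow> n \<in> exponents V \<and> (\<forall>i. 0 \<le> Poly_Mapping.lookup n i)"
  by (simp add: nonneg_exponents_def)

lemma add_closed_nonneg_exponents: "add_closed (nonneg_exponents V)"
  by (simp add: add_closed_def mem_nonneg_exponents exponents_closed lookup_add)

text \<open>A face of a monoid in the sense of convex geometry: the complement of a prime ideal.\<close>

definition monoid_face :: "'a::comm_monoid_add set \<Rightarrow> 'a set \<Rightarrow> bool" where
  "monoid_face S T \<longleftrightarrow> T \<subseteq> S \<and> add_closed T \<and> (\<forall>a\<in>S. \<forall>b\<in>S. a + b \<in> T \<longrightarrow> a \<in> T \<and> b \<in> T)"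

lemma monoid_face_refl: "add_closed S \<Longrightarrow> monoid_face S S"
  by (simp add: monoid_face_def)

text \<open>A sum of non-negative coordinates vanishes only if each summand does, so a product of
  monomials avoids a variable only if both factors avoid it.\<close>

lemma nonneg_exponents_face:
  assumes "W \<subseteq> V"
  shows "monoid_face (nonneg_exponents V) (nonneg_exponents W)"
proof -
  have "nonneg_exponents W \<subseteq> nonneg_exponents V"
    using assms by (auto simp: nonneg_exponents_def exponents_def)
  moreover have "a \<in> nonneg_exponents W \<and> b \<in> nonneg_exponents W"
    if "a \<in> nonneg_exponents V" "b \<in> nonneg_exponents V" "a + b \<in> nonneg_exponents W" for a b
    using that unfolding mem_nonneg_exponents mem_exponents lookup_add
    by (metis add_nonneg_eq_0_iff)
  ultimately show ?thesis
    by (auto simp: monoid_face_def add_closed_nonneg_exponents)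
qed

text \<open>For finite sets and a total cone this compares maxima, with the empty set (the zero
  polynomial) as least element. Phrased without maxima it is transitive and compatible with unions
  and sums for every submonoid \<open>C\<close>.\<close>

definition dominated :: "'a::ab_group_add set \<Rightarrow> 'a set \<Rightarrow> 'a set \<Rightarrow> bool" where
  "dominated C M N \<longleftrightarrow> (\<forall>m\<in>M. \<exists>n\<in>N. n - m \<in> C)"

text \<open>Two polynomials are related if their parts on the face have the same leading exponent.\<close>

definition cone_congruence ::
    "(nat \<Rightarrow>\<^sub>0 int) set \<Rightarrow> (nat \<Rightarrow>\<^sub>0 int) set \<Rightarrow> (nat \<Rightarrow>\<^sub>0 int) set \<Rightarrow> (laurent \<times> laurent) set" where
  "cone_congruence S T C = {(f, g). Poly_Mapping.keys f \<subseteq> S \<and> Poly_Mapping.keys g \<subseteq> S \<and>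
     dominated C (Poly_Mapping.keys f \<inter> T) (Poly_Mapping.keys g \<inter> T) \<and>
     dominated C (Poly_Mapping.keys g \<inter> T) (Poly_Mapping.keys f \<inter> T)}"

lemma dominated_refl: "0 \<in> C \<Longrightarrow> M \<subseteq> N \<Longrightarrow> dominated C M N"
  by (force simp: dominated_def)

lemma dominated_trans:
  assumes "add_closed C" "dominated C L M" "dominated C M N" shows "dominated C L N"
  unfolding dominated_def
proof
  fix l assume "l \<in> L"
  then obtain m n where "m \<in> M" "m - l \<in> C" "n \<in> N" "n - m \<in> C"
    using assms unfolding dominated_def by meson
  moreover have "n - l = (n - m) + (m - l)" by simp
  ultimately show "\<exists>n\<in>N. n - l \<in> C"
    using assms(1) add_closedD(2) by metis
qed

lemma dominated_Un:
  "dominated C M M' \<Longrightarrow> dominated C N N' \<Longrightarrow> dominated C (M \<union> N) (M' \<union> N')"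
  by (auto simp: dominated_def)

lemma dominated_plus:
  assumes "add_closed C" "dominated C M M'" "dominated C N N'"
  shows "dominated C (M + N) (M' + N')"
  unfolding dominated_def
proof
  fix x assume "x \<in> M + N"
  then obtain m n where mn: "x = m + n" "m \<in> M" "n \<in> N" by (rule set_plus_elim)
  obtain m' n' where *: "m' \<in> M'" "n' \<in> N'" "m' - m \<in> C" "n' - n \<in> C"
    using assms mn unfolding dominated_def by meson
  have "m' + n' - x = (m' - m) + (n' - n)" using mn by simp
  then have "m' + n' - x \<in> C" using * add_closedD(2)[OF assms(1)] by metis
  then show "\<exists>y\<in>M' + N'. y - x \<in> C" using * by blast
qed

text \<open>On \<open>S\<close>, a sum lies in the face exactly when both summands do. Hence
  discarding the terms off the face is multiplicative, and those terms behave like 0.\<close>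

lemma keys_mult_face:
  fixes f g :: laurent
  assumes "monoid_face S T" "Poly_Mapping.keys f \<subseteq> S" "Poly_Mapping.keys g \<subseteq> S"
  shows "Poly_Mapping.keys (f * g) \<inter> T = (Poly_Mapping.keys f \<inter> T) + (Poly_Mapping.keys g \<inter> T)"
proof -
  have "m + n \<in> T \<longleftrightarrow> m \<in> T \<and> n \<in> T"
    if "m \<in> Poly_Mapping.keys f" "n \<in> Poly_Mapping.keys g" for m n
    using assms that unfolding monoid_face_def add_closed_def by (meson subsetD)
  then show ?thesis unfolding keys_mult_two by (auto elim!: set_plus_elim)
qed

lemma keys_add_face: "Poly_Mapping.keys (f + g) \<inter> T =
    (Poly_Mapping.keys f \<inter> T) \<union> (Poly_Mapping.keys g \<inter> T)" for f g :: laurent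
  by (auto simp: keys_add_two)

lemma keys_mult_closed:
  "add_closed S \<Longrightarrow> Poly_Mapping.keys f \<subseteq> S \<Longrightarrow> Poly_Mapping.keys g \<subseteq> S \<Longrightarrow>
    Poly_Mapping.keys (f * g) \<subseteq> S" for f g :: laurent
  by (auto simp: keys_mult_two add_closed_def elim!: set_plus_elim)

lemma cone_congruence_congruence:
  assumes "monoid_face S T" "add_closed S" "add_closed C"
  shows "congruence (monoid_algebra S) (cone_congruence S T C)"
  unfolding congruence_def
proof (intro conjI allI impI)
  have C0: "0 \<in> C" using assms(3) add_closedD by blast
  show "equiv (carrier (monoid_algebra S)) (cone_congruence S T C)"
  proof (rule equivI)
    show "cone_congruence S T C \<subseteq> carrier (monoid_algebra S) \<times> carrier (monoid_algebra S)"
      by (auto simp: cone_congruence_def)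
    show "refl_on (carrier (monoid_algebra S)) (cone_congruence S T C)"
      using C0 by (auto simp: refl_on_def cone_congruence_def intro: dominated_refl)
    show "sym (cone_congruence S T C)"
      by (auto simp: sym_def cone_congruence_def)
    show "trans (cone_congruence S T C)"
      by (rule transI) (auto simp: cone_congruence_def intro: dominated_trans[OF assms(3)])
  qed
  fix a b c d :: laurent
  assume "(a, b) \<in> cone_congruence S T C \<and> (c, d) \<in> cone_congruence S T C"
  then show "(a \<oplus>\<^bsub>monoid_algebra S\<^esub> c, b \<oplus>\<^bsub>monoid_algebra S\<^esub> d) \<in> cone_congruence S T C"
    and "(a \<otimes>\<^bsub>monoid_algebra S\<^esub> c, b \<otimes>\<^bsub>monoid_algebra S\<^esub> d) \<in> cone_congruence S T C"
    using assms
    by (auto simp: cone_congruence_def keys_add_face keys_mult_face keys_mult_closed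
        intro: dominated_Un dominated_plus)
       (auto simp: keys_add_two)
qed

text \<open>Totality turns failed domination into a strict inequality: the maximum \<open>p\<close>
  of \<open>M\<close> lies above the element \<open>m0\<close> that no element of \<open>N\<close>
  reaches, so no element of \<open>N\<close> reaches \<open>p\<close> either.\<close>

lemma not_dominated_max:
  assumes C: "add_closed C" and tot: "\<forall>a\<in>T. \<forall>b\<in>T. a - b \<in> C \<or> b - a \<in> C"
    and M: "finite M" "M \<subseteq> T" and N: "N \<subseteq> T" and nd: "\<not> dominated C M N"
  obtains p where "p \<in> M" "\<forall>m\<in>M. p - m \<in> C" "\<forall>n\<in>N. p - n \<in> C \<and> n - p \<notin> C"
proof -
  have "\<exists>p\<in>L. \<forall>m\<in>L. p - m \<in> C" if "finite L" "L \<noteq> {}" "L \<subseteq> T" for L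
    using that
  proof (induction L rule: finite_ne_induct)
    case (singleton x)
    then show ?case using C add_closedD(1) by auto
  next
    case (insert x F)
    then obtain p where p: "p \<in> F" "\<forall>m\<in>F. p - m \<in> C" by auto
    show ?case
    proof (cases "p - x \<in> C")
      case True
      then show ?thesis using p by auto
    next
      case False
      then have xp: "x - p \<in> C" using tot insert p by blast
      have "x - m \<in> C" if "m \<in> F" for m
        using add_closedD(2)[OF C xp, of "p - m"] p that by simp
      then show ?thesis using C add_closedD(1) by auto
    qed
  qed
  moreover obtain m0 where m0: "m0 \<in> M" "\<forall>n\<in>N. n - m0 \<notin> C"
    using nd by (auto simp: dominated_def)
  ultimately obtain p where p: "p \<in> M" "\<forall>m\<in>M. p - m \<in> C"
    using M by blast
  have "p - n \<in> C \<and> n - p \<notin> C" if n: "n \<in> N" for n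
  proof -
    have "n - p \<notin> C"
      using add_closedD(2)[OF C, of "n - p" "p - m0"] p m0 n by auto
    then show ?thesis using tot p n M N by blast
  qed
  with p that show thesis by blast
qed

text \<open>If both pairs lie outside the congruence, each has a component whose leading exponent is
  strictly larger than that of the other, say \<open>p\<close> and \<open>q\<close>. Then
  \<open>p + q\<close> occurs in one component of the twisted product and strictly exceeds every
  exponent of the other component on the face.\<close>

lemma cone_congruence_prime:
  assumes face: "monoid_face S T" and S: "add_closed S" and C: "add_closed C"
    and tot: "\<forall>a\<in>T. \<forall>b\<in>T. a - b \<in> C \<or> b - a \<in> C"
  shows "prime_congruence (monoid_algebra S) (cone_congruence S T C)"
  unfolding prime_congruence_def proper_congruence_def
proof (intro conjI ballI impI)
  show "congruence (monoid_algebra S) (cone_congruence S T C)"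
    using assms by (simp add: cone_congruence_congruence)
  have "0 \<in> T" "0 \<in> S" using face S by (auto simp: monoid_face_def add_closed_def)
  then have "(1, 0) \<notin> cone_congruence S T C"
    "(1, 0) \<in> carrier (monoid_algebra S) \<times> carrier (monoid_algebra S)"
    by (auto simp: cone_congruence_def dominated_def)
  then show "cone_congruence S T C \<noteq> carrier (monoid_algebra S) \<times> carrier (monoid_algebra S)"
    by metis
  fix \<alpha> \<beta> :: "laurent \<times> laurent"
  assume *: "\<alpha> \<in> carrier (monoid_algebra S) \<times> carrier (monoid_algebra S)"
    "\<beta> \<in> carrier (monoid_algebra S) \<times> carrier (monoid_algebra S)"
    and tw: "twisted_product (monoid_algebra S) \<alpha> \<beta> \<in> cone_congruence S T C"
  obtain f1 f2 g1 g2 where eq: "\<alpha> = (f1, f2)" "\<beta> = (g1, g2)" by (cases \<alpha>; cases \<beta>)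
  define K where "K f = Poly_Mapping.keys f \<inter> T" for f :: laurent
  have fin: "finite (K f)" and sub: "K f \<subseteq> T" for f by (auto simp: K_def)
  have carr: "Poly_Mapping.keys f1 \<subseteq> S" "Poly_Mapping.keys f2 \<subseteq> S"
    "Poly_Mapping.keys g1 \<subseteq> S" "Poly_Mapping.keys g2 \<subseteq> S"
    using * eq by auto
  have main: "\<not> dominated C (K (f * g)) (K (f * g' + f' * g))"
    if nd: "\<not> dominated C (K f) (K f')" "\<not> dominated C (K g) (K g')"
      and s: "Poly_Mapping.keys f \<subseteq> S" "Poly_Mapping.keys f' \<subseteq> S"
        "Poly_Mapping.keys g \<subseteq> S" "Poly_Mapping.keys g' \<subseteq> S" for f f' g g'
  proof
    assume dom: "dominated C (K (f * g)) (K (f * g' + f' * g))"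
    obtain p where p: "p \<in> K f" "\<forall>m\<in>K f. p - m \<in> C" "\<forall>n\<in>K f'. p - n \<in> C \<and> n - p \<notin> C"
      using not_dominated_max[OF C tot fin sub sub nd(1)] by metis
    obtain q where q: "q \<in> K g" "\<forall>m\<in>K g. q - m \<in> C" "\<forall>n\<in>K g'. q - n \<in> C \<and> n - q \<notin> C"
      using not_dominated_max[OF C tot fin sub sub nd(2)] by metis
    have "p + q \<in> K (f * g)"
      using p q keys_mult_face[OF face s(1,3)] by (auto simp: K_def)
    then obtain r where r: "r \<in> K (f * g' + f' * g)" "r - (p + q) \<in> C"
      using dom by (auto simp: dominated_def)
    then have "r \<in> K f + K g' \<or> r \<in> K f' + K g"
      using keys_mult_face[OF face s(1,4)] keys_mult_face[OF face s(2,3)]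
      by (auto simp: K_def keys_add_two)
    then consider m n where "r = m + n" "m \<in> K f" "n \<in> K g'"
      | m n where "r = m + n" "m \<in> K f'" "n \<in> K g"
      by (metis set_plus_elim)
    then show False
    proof cases
      case 1
      have "(r - (p + q)) + (p - m) = n - q" using 1 by (simp add: algebra_simps)
      then show False using 1 p q r add_closedD(2)[OF C] by metis
    next
      case 2
      have "(r - (p + q)) + (q - n) = m - p" using 2 by (simp add: algebra_simps)
      then show False using 2 p q r add_closedD(2)[OF C] by metis
    qed
  qed
  have d: "dominated C (K (f1 * g1 + f2 * g2)) (K (f1 * g2 + f2 * g1))"
      "dominated C (K (f1 * g2 + f2 * g1)) (K (f1 * g1 + f2 * g2))"
    using tw by (auto simp: eq twisted_product_def cone_congruence_def K_def)
  have mono: "dominated C (K f) X" "dominated C (K g) X" if "dominated C (K (f + g)) X" for f g X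
    using that by (auto simp: dominated_def K_def keys_add_two)
  \<comment> \<open>Exchanging the components of \<alpha> or of \<beta> only exchanges those of the
    twisted product, so \<open>main\<close> excludes all four ways in which both pairs could
    fail.\<close>
  have "(dominated C (K f1) (K f2) \<and> dominated C (K f2) (K f1)) \<or>
      (dominated C (K g1) (K g2) \<and> dominated C (K g2) (K g1))"
    using mono[OF d(1)] mono[OF d(2)] main[of f1 f2 g1 g2] main[of f1 f2 g2 g1]
      main[of f2 f1 g1 g2] main[of f2 f1 g2 g1] carr by (auto simp: add.commute)
  then show "\<alpha> \<in> cone_congruence S T C \<or> \<beta> \<in> cone_congruence S T C"
    using carr by (auto simp: eq cone_congruence_def K_def)
qed

section \<open>Prime congruences of the polynomial semiring\<close>

locale monoid_algebra_congruence =
  fixes S :: "(nat \<Rightarrow>\<^sub>0 int) set" and I :: "(laurent \<times> laurent) set"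
  assumes S: "add_closed S" and cong: "congruence (monoid_algebra S) I"
begin

lemma carr: "(f, g) \<in> I \<Longrightarrow> Poly_Mapping.keys f \<subseteq> S \<and> Poly_Mapping.keys g \<subseteq> S"
  using cong by (auto simp: congruence_def equiv_def)

lemma crefl: "Poly_Mapping.keys f \<subseteq> S \<Longrightarrow> (f, f) \<in> I"
  using cong by (auto simp: congruence_def equiv_def refl_on_def)

lemma csym: "(f, g) \<in> I \<Longrightarrow> (g, f) \<in> I"
  using cong by (auto simp: congruence_def equiv_def sym_def)

lemma ctrans [trans]: "(f, g) \<in> I \<Longrightarrow> (g, h) \<in> I \<Longrightarrow> (f, h) \<in> I"
  using cong unfolding congruence_def equiv_def by (meson transD)

lemma cadd: "(f, g) \<in> I \<Longrightarrow> (f', g') \<in> I \<Longrightarrow> (f + f', g + g') \<in> I"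
  using cong by (auto simp: congruence_def)

lemma cmult: "(f, g) \<in> I \<Longrightarrow> (f', g') \<in> I \<Longrightarrow> (f * f', g * g') \<in> I"
  using cong by (auto simp: congruence_def)

text \<open>That \<open>f + g\<close> is congruent to \<open>g\<close> means
  \<open>f \<le> g\<close> in the natural order of the idempotent quotient, so it can be checked for
  one monomial of \<open>f\<close> at a time against a monomial of \<open>g\<close>.\<close>

lemma absorb:
  assumes "dominated C (Poly_Mapping.keys f) (Poly_Mapping.keys g)"
    and "Poly_Mapping.keys f \<subseteq> S" "Poly_Mapping.keys g \<subseteq> S"
    and mon: "\<And>m n. m \<in> Poly_Mapping.keys f \<Longrightarrow> n \<in> Poly_Mapping.keys g \<Longrightarrow> n - m \<in> C \<Longrightarrow>
      (monomial m + monomial n, monomial n) \<in> I"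
  shows "(f + g, g) \<in> I"
  using assms
proof (induction f rule: laurent_induct)
  case zero
  then show ?case by (simp add: crefl)
next
  case (add m f)
  have "(f + g, g) \<in> I"
    using add by (auto simp: keys_add_two dominated_def)
  then have 1: "(monomial m + (f + g), monomial m + g) \<in> I"
    using add.prems by (intro cadd crefl) (auto simp: keys_add_two)
  obtain n where n: "n \<in> Poly_Mapping.keys g" "n - m \<in> C"
    using add.prems(1) by (auto simp: dominated_def keys_add_two)
  then have "(monomial m + monomial n, monomial n) \<in> I"
    using add.prems(4) by (auto simp: keys_add_two)
  then have "(monomial m + monomial n + g, monomial n + g) \<in> I"
    using add.prems by (intro cadd crefl) auto
  moreover have "monomial n + g = g"
    using n by (auto simp: two_poly_eq_iff keys_add_two)
  ultimately have "(monomial m + g, g) \<in> I"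
    by (simp add: add.assoc)
  then show ?case using ctrans[OF 1] by (simp add: add.assoc)
qed

end

text \<open>Applied below to the exponents of the monomials that are non-zero modulo a prime: it
  reduces the question which monomials vanish to the variables.\<close>

lemma nonneg_exponents_generated:
  assumes T: "add_closed T" and gen: "\<And>i. i \<in> W \<Longrightarrow> Poly_Mapping.single i 1 \<in> T"
    and n: "n \<in> nonneg_exponents W"
  shows "n \<in> T"
proof -
  have pow: "Poly_Mapping.single i (int c) \<in> T" if "i \<in> W" for i c
    by (induction c) (use T gen that in \<open>auto simp: single_add add_closed_def\<close>)
  have single: "Poly_Mapping.single i (Poly_Mapping.lookup n i) \<in> T" if "i \<in> Poly_Mapping.keys n" for i
  proof -
    have "i \<in> W" using n that by (auto simp: nonneg_exponents_def exponents_def)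
    moreover have "Poly_Mapping.lookup n i = int (nat (Poly_Mapping.lookup n i))"
      using n by (simp add: mem_nonneg_exponents)
    ultimately show ?thesis using pow by metis
  qed
  have "(\<Sum>i\<in>J. Poly_Mapping.single i (Poly_Mapping.lookup n i)) \<in> T"
    if "finite J" "J \<subseteq> Poly_Mapping.keys n" for J
    using that by (induction J rule: finite_induct) (use T single in \<open>auto simp: add_closed_def\<close>)
  from this[of "Poly_Mapping.keys n"]
  have "(\<Sum>i\<in>Poly_Mapping.keys n. Poly_Mapping.single i (Poly_Mapping.lookup n i)) \<in> T"
    by simp
  moreover have "(\<Sum>i\<in>Poly_Mapping.keys n. Poly_Mapping.single i (Poly_Mapping.lookup n i)) = n"
    by (rule poly_mapping_eqI) (auto simp: lookup_sum lookup_single when_def in_keys_iff)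
  ultimately show ?thesis by simp
qed

lemma exponents_difference:
  assumes "v \<in> exponents W"
  obtains n m where "n \<in> nonneg_exponents W" "m \<in> nonneg_exponents W" "v = n - m"
proof
  let ?p = "Poly_Mapping.map (max 0) v"
  have l: "Poly_Mapping.lookup ?p i = max 0 (Poly_Mapping.lookup v i)" for i
    by (simp add: Poly_Mapping.map.rep_eq when_def)
  show "?p \<in> nonneg_exponents W" "?p - v \<in> nonneg_exponents W"
    using assms by (auto simp: mem_nonneg_exponents mem_exponents l lookup_minus)
  show "v = ?p - (?p - v)" by simp
qed

text \<open>The non-negative elements of a translation-invariant total preorder. Elements lying in
  the cone together with their negatives are equivalent to 0; excluding non-zero ones is the
  separate condition \<open>pointed\<close>.\<close>

definition total_cone :: "nat set \<Rightarrow> (nat \<Rightarrow>\<^sub>0 int) set \<Rightarrow> bool" where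
  "total_cone W C \<longleftrightarrow> add_closed C \<and> C \<subseteq> exponents W \<and> (\<forall>v\<in>exponents W. v \<in> C \<or> - v \<in> C)"

lemma total_coneD:
  assumes "total_cone W C"
  shows "add_closed C" "C \<subseteq> exponents W" "v \<in> exponents W \<Longrightarrow> v \<notin> C \<Longrightarrow> - v \<in> C"
    "\<forall>a\<in>exponents W. \<forall>b\<in>exponents W. a - b \<in> C \<or> b - a \<in> C"
proof -
  show "\<forall>a\<in>exponents W. \<forall>b\<in>exponents W. a - b \<in> C \<or> b - a \<in> C"
    using assms exponents_closed(4) unfolding total_cone_def by (metis minus_diff_eq)
qed (use assms in \<open>auto simp: total_cone_def\<close>)

lemma nonneg_exponents_mono: "W \<subseteq> V \<Longrightarrow> nonneg_exponents W \<subseteq> nonneg_exponents V"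
  using nonneg_exponents_face by (auto simp: monoid_face_def)

lemma restrict_congruent:
  assumes I: "congruence (monoid_algebra (nonneg_exponents V)) I"
    and H: "\<And>i. i \<in> H \<Longrightarrow> (variable i, 0) \<in> I"
    and f: "Poly_Mapping.keys f \<subseteq> nonneg_exponents V"
  shows "\<exists>f'. Poly_Mapping.keys f' = Poly_Mapping.keys f \<inter> nonneg_exponents (V - H) \<and> (f, f') \<in> I"
  using f
proof (induction f rule: laurent_induct)
  interpret monoid_algebra_congruence "nonneg_exponents V" I
    by unfold_locales (use I in \<open>auto simp: add_closed_nonneg_exponents\<close>)
  case zero
  show ?case by (rule exI[of _ 0]) (auto simp: crefl)
next
  interpret monoid_algebra_congruence "nonneg_exponents V" I
    by unfold_locales (use I in \<open>auto simp: add_closed_nonneg_exponents\<close>)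
  case (add n f)
  then have n: "n \<in> nonneg_exponents V" by (auto simp: keys_add_two)
  obtain f' where f': "Poly_Mapping.keys f' = Poly_Mapping.keys f \<inter> nonneg_exponents (V - H)" "(f, f') \<in> I"
    using add by (auto simp: keys_add_two)
  show ?case
  proof (cases "n \<in> nonneg_exponents (V - H)")
    case True
    then show ?thesis
      using f' n by (intro exI[of _ "monomial n + f'"]) (auto simp: keys_add_two intro!: cadd crefl)
  next
    case False
    then obtain i where i: "i \<in> H" "0 < Poly_Mapping.lookup n i"
      using n unfolding mem_nonneg_exponents mem_exponents by (metis DiffI order_le_less)
    let ?n' = "n - Poly_Mapping.single i 1"
    have "?n' \<in> nonneg_exponents V"
      using n i by (auto simp: mem_nonneg_exponents mem_exponents lookup_minus lookup_single when_def)
    then have "(variable i * monomial ?n', 0 * monomial ?n') \<in> I"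
      using H i by (intro cmult crefl) auto
    then have "(monomial n, 0) \<in> I"
      by (simp add: variable_def monomial_mult)
    then have "(monomial n + f, 0 + f') \<in> I"
      using f' by (intro cadd)
    then show ?thesis
      using f' False by (intro exI[of _ f']) (auto simp: keys_add_two)
  qed
qed

text \<open>A congruence containing the generators allows all monomials involving \<open>H\<close>
  to be discarded, and the remaining parts are then related by the second set of generators. This
  converts the intrinsic description of a prime into the one asked for in (i).\<close>

lemma generated_cone_congruence:
  assumes H: "H \<subseteq> V" and C: "add_closed C"
  shows "generated_congruence (poly_semiring V)
      ({(variable i, 0) | i. i \<in> H} \<union>
        cone_congruence (nonneg_exponents (V - H)) (nonneg_exponents (V - H)) C) =
    cone_congruence (nonneg_exponents V) (nonneg_exponents (V - H)) C"
    (is "generated_congruence _ (?X \<union> ?Y) = ?P")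
proof
  have "congruence (monoid_algebra (nonneg_exponents V)) ?P"
    by (intro cone_congruence_congruence nonneg_exponents_face add_closed_nonneg_exponents C) auto
  moreover have "?X \<subseteq> ?P"
  proof -
    have "Poly_Mapping.single i 1 \<in> nonneg_exponents V \<and>
        Poly_Mapping.single i 1 \<notin> nonneg_exponents (V - H)" if "i \<in> H" for i
      using that H by (auto simp: mem_nonneg_exponents mem_exponents lookup_single when_def)
    then show ?thesis by (auto simp: cone_congruence_def variable_def dominated_def)
  qed
  moreover have "?Y \<subseteq> ?P"
    using nonneg_exponents_mono[of "V - H" V] by (auto simp: cone_congruence_def)
  ultimately show "generated_congruence (poly_semiring V) (?X \<union> ?Y) \<subseteq> ?P"
    by (auto simp: generated_congruence_def poly_semiring_eq)
  have "?P \<subseteq> I" if I: "congruence (monoid_algebra (nonneg_exponents V)) I" and "?X \<union> ?Y \<subseteq> I" for I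
  proof
    interpret monoid_algebra_congruence "nonneg_exponents V" I
      by unfold_locales (use I in \<open>auto simp: add_closed_nonneg_exponents\<close>)
    fix x assume x: "x \<in> ?P"
    obtain f g where fg: "x = (f, g)" by (cases x)
    have X: "\<And>i. i \<in> H \<Longrightarrow> (variable i, 0) \<in> I" using that by auto
    have s: "Poly_Mapping.keys f \<subseteq> nonneg_exponents V" "Poly_Mapping.keys g \<subseteq> nonneg_exponents V"
      using x by (auto simp: fg cone_congruence_def)
    obtain f' g' where f': "Poly_Mapping.keys f' = Poly_Mapping.keys f \<inter> nonneg_exponents (V - H)" "(f, f') \<in> I"
      and g': "Poly_Mapping.keys g' = Poly_Mapping.keys g \<inter> nonneg_exponents (V - H)" "(g, g') \<in> I"
      using restrict_congruent[OF I X s(1)] restrict_congruent[OF I X s(2)] by blast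
    have "(f', g') \<in> ?Y"
      using x f' g' by (auto simp: fg cone_congruence_def Int_absorb2)
    then have "(f', g') \<in> I" using that by auto
    then show "x \<in> I" unfolding fg using f'(2) g'(2) csym ctrans by metis
  qed
  then show "?P \<subseteq> generated_congruence (poly_semiring V) (?X \<union> ?Y)"
    by (auto simp: generated_congruence_def poly_semiring_eq)
qed

section \<open>Totality, cancellation and leading monomials modulo a prime\<close>

locale monoid_algebra_prime = monoid_algebra_congruence +
  assumes prime: "prime_congruence (monoid_algebra S) I"
begin

lemma one_not_zero: "(1, 0) \<notin> I"
proof
  assume 1: "(1, 0) \<in> I"
  have "(f, 0) \<in> I" if "Poly_Mapping.keys f \<subseteq> S" for f
    using cmult[OF 1 crefl[OF that]] by simp
  then have "(f, g) \<in> I" if "Poly_Mapping.keys f \<subseteq> S" "Poly_Mapping.keys g \<subseteq> S" for f g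
    using that csym ctrans by meson
  then have "carrier (monoid_algebra S) \<times> carrier (monoid_algebra S) \<subseteq> I"
    by auto
  moreover have "I \<subseteq> carrier (monoid_algebra S) \<times> carrier (monoid_algebra S)"
    using cong by (simp add: congruence_def equiv_def)
  ultimately have "I = carrier (monoid_algebra S) \<times> carrier (monoid_algebra S)"
    by (rule equalityI[rotated])
  then show False using prime by (simp add: prime_congruence_def proper_congruence_def)
qed

lemma primeD:
  assumes "twisted_product (monoid_algebra S) (f, f') (g, g') \<in> I"
    "Poly_Mapping.keys f \<subseteq> S" "Poly_Mapping.keys f' \<subseteq> S"
    "Poly_Mapping.keys g \<subseteq> S" "Poly_Mapping.keys g' \<subseteq> S"
  shows "(f, f') \<in> I \<or> (g, g') \<in> I"
proof -
  have "(f, f') \<in> carrier (monoid_algebra S) \<times> carrier (monoid_algebra S)"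
    "(g, g') \<in> carrier (monoid_algebra S) \<times> carrier (monoid_algebra S)"
    using assms by simp_all
  then show ?thesis using prime assms(1) unfolding prime_congruence_def by blast
qed

text \<open>The twisted product of \<open>(f + g, f)\<close> and \<open>(f + g, g)\<close> lies on the diagonal.\<close>

lemma total:
  assumes f: "Poly_Mapping.keys f \<subseteq> S" and g: "Poly_Mapping.keys g \<subseteq> S"
  shows "(f + g, f) \<in> I \<or> (f + g, g) \<in> I"
proof -
  have s: "(f + g) * (f + g) + f * g = (f + g) * g + f * (f + g)"
  proof -
    have "(f + g) * (f + g) + f * g = f * f + (f * g + f * g) + g * g + f * g"
      by (simp add: algebra_simps)
    also have "\<dots> = f * f + ((f * g + f * g) + f * g) + g * g"
      by (simp add: ac_simps)
    also have "\<dots> = f * f + (f * g + f * g) + g * g"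
      by (simp only: two_poly_add_idem)
    also have "\<dots> = (f + g) * g + f * (f + g)" by (simp add: algebra_simps)
    finally show ?thesis .
  qed
  have k: "Poly_Mapping.keys (f + g) \<subseteq> S" using f g by (simp add: keys_add_two)
  then have "Poly_Mapping.keys ((f + g) * g + f * (f + g)) \<subseteq> S"
    using f g S by (simp add: keys_add_two[of "(f + g) * g"] keys_mult_closed)
  then have "twisted_product (monoid_algebra S) (f + g, f) (f + g, g) \<in> I"
    by (simp add: twisted_product_def s crefl)
  then show ?thesis
    by (rule primeD) (use f g k in auto)
qed

text \<open>The twisted product of \<open>(f, 0)\<close> and \<open>(g, h)\<close> is
  \<open>(f * g, f * h)\<close>, so cancellation is an instance of primality.\<close>

lemma cancel:
  assumes "(f * g, f * h) \<in> I" "Poly_Mapping.keys f \<subseteq> S" "Poly_Mapping.keys g \<subseteq> S"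
    "Poly_Mapping.keys h \<subseteq> S"
  shows "(f, 0) \<in> I \<or> (g, h) \<in> I"
proof -
  have "twisted_product (monoid_algebra S) (f, 0) (g, h) \<in> I"
    using assms by (simp add: twisted_product_def)
  then show ?thesis by (rule primeD) (use assms in auto)
qed

lemma max_monomial:
  assumes "Poly_Mapping.keys f \<subseteq> S" "f \<noteq> 0"
  shows "\<exists>n\<in>Poly_Mapping.keys f. (f, monomial n) \<in> I"
  using assms
proof (induction f rule: laurent_induct)
  case (add m f)
  then have m: "m \<in> S" "Poly_Mapping.keys f \<subseteq> S" by (auto simp: keys_add_two)
  show ?case
  proof (cases "f = 0")
    case True
    then show ?thesis using m crefl[of "monomial m"] by (auto simp: keys_add_two)
  next
    case False
    then obtain n where n: "n \<in> Poly_Mapping.keys f" "(f, monomial n) \<in> I"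
      using add m by auto
    have "(monomial m + f, monomial m) \<in> I \<or> (monomial m + f, f) \<in> I"
      using m by (intro total) auto
    then show ?thesis using n ctrans unfolding keys_add_two keys_monomial by blast
  qed
qed simp

end

text \<open>The relation \<open>le m n\<close> says that the monomial of \<open>n\<close> absorbs
  that of \<open>m\<close>. It is invariant under translation, and cancellation makes the converse
  hold too, so it depends only on \<open>n - m\<close> and passes to the group of differences.
  \<open>P\<close> is recovered because each polynomial is congruent to its part without
  \<open>H\<close>, and such parts are compared monomial by monomial.\<close>

lemma prime_poly_semiring:
  assumes P: "prime_congruence (poly_semiring V) P"
  obtains H C where "H \<subseteq> V" "total_cone (V - H) C"
    "P = cone_congruence (nonneg_exponents V) (nonneg_exponents (V - H)) C"
proof -
  interpret monoid_algebra_prime "nonneg_exponents V" P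
    by unfold_locales (use P in \<open>auto simp: add_closed_nonneg_exponents prime_congruence_def
      proper_congruence_def poly_semiring_eq\<close>)
  define H where "H = {i \<in> V. (variable i, 0) \<in> P}"
  define N where "N = nonneg_exponents (V - H)"
  have NV: "n \<in> nonneg_exponents V" if "n \<in> N" for n
    using that nonneg_exponents_mono[of "V - H" V] by (auto simp: N_def)
  have N: "add_closed N" by (simp add: N_def add_closed_nonneg_exponents)
  \<comment> \<open>By \<open>cancel\<close> a product of monomials that are non-zero modulo
    \<open>P\<close> is non-zero again, so the variables outside \<open>H\<close> suffice.\<close>
  have nz: "(monomial n, 0) \<notin> P" if "n \<in> N" for n
  proof -
    let ?T = "{n \<in> nonneg_exponents V. (monomial n, 0) \<notin> P}"
    have "add_closed ?T"
    proof -
      have "(monomial 0, 0) \<notin> P"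
        using one_not_zero by (simp add: monomial_def)
      moreover have "(monomial (a + b), 0) \<notin> P" if "a \<in> ?T" "b \<in> ?T" for a b
        using cancel[of "monomial a" "monomial b" 0] that by (auto simp: monomial_mult)
      ultimately show ?thesis
        using add_closed_nonneg_exponents[of V] by (auto simp: add_closed_def)
    qed
    moreover have "Poly_Mapping.single i 1 \<in> ?T" if "i \<in> V - H" for i
      using that by (auto simp: H_def variable_def mem_nonneg_exponents mem_exponents lookup_single when_def)
    ultimately show ?thesis
      using nonneg_exponents_generated that unfolding N_def by blast
  qed
  define le where "le m n \<longleftrightarrow> (monomial m + monomial n, monomial n) \<in> P" for m n
  have le_refl: "le n n" if "n \<in> N" for n
    using that NV by (auto simp: le_def two_poly_add_idem intro: crefl)
  have le_add: "le (m + l) (n + l)" if "le m n" "l \<in> N" for m n l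
    using cmult[OF that(1)[unfolded le_def] crefl[of "monomial l"]] that NV
    by (simp add: le_def distrib_right monomial_mult)
  have le_cancel: "le m n" if "le (m + l) (n + l)" "m \<in> N" "n \<in> N" "l \<in> N" for m n l
  proof -
    have "(monomial l * (monomial m + monomial n), monomial l * monomial n) \<in> P"
      using that(1) by (simp add: le_def distrib_left monomial_mult add.commute)
    then show ?thesis
      using cancel[of "monomial l" "monomial m + monomial n" "monomial n"] nz that NV
      by (auto simp: le_def keys_add_two)
  qed
  have le_trans: "le l n" if "le l m" "le m n" "l \<in> N" "m \<in> N" "n \<in> N" for l m n
  proof -
    have n: "(monomial n, monomial n) \<in> P" and l: "(monomial l, monomial l) \<in> P"
      using that NV by (auto intro: crefl)
    have 1: "(monomial l + (monomial m + monomial n), monomial l + monomial n) \<in> P"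
      using cadd[OF l that(2)[unfolded le_def]] .
    have 2: "(monomial l + monomial m + monomial n, monomial m + monomial n) \<in> P"
      using cadd[OF that(1)[unfolded le_def] n] .
    show ?thesis
      using 1 2 that(2) unfolding le_def add.assoc by (metis csym ctrans)
  qed
  define C where "C = {n - m | n m. n \<in> N \<and> m \<in> N \<and> le m n}"
  \<comment> \<open>The choice of representatives does not matter: adding \<open>m\<close> to
    \<open>le m' n'\<close> gives a comparison of \<open>m + m'\<close> with \<open>n + m'\<close>,
    and \<open>m'\<close> cancels.\<close>
  have C_iff: "n - m \<in> C \<longleftrightarrow> le m n" if nm: "n \<in> N" "m \<in> N" for n m
  proof
    assume "n - m \<in> C"
    then obtain n' m' where *: "n - m = n' - m'" "n' \<in> N" "m' \<in> N" "le m' n'"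
      by (auto simp: C_def)
    have "n' + m = n + m'" using *(1) by (simp add: algebra_simps)
    then have "le (m + m') (n + m')"
      using le_add[OF *(4) nm(2)] by (simp add: add.commute)
    then show "le m n" using le_cancel nm * by blast
  qed (use nm in \<open>auto simp: C_def\<close>)
  have N0: "0 \<in> N" using N add_closedD by blast
  have N_add: "a + b \<in> N" if "a \<in> N" "b \<in> N" for a b using that N add_closedD by blast
  have "total_cone (V - H) C"
    unfolding total_cone_def add_closed_def
  proof (intro conjI ballI)
    show "0 \<in> C" using C_iff[OF N0 N0] le_refl[OF N0] by simp
    show "C \<subseteq> exponents (V - H)"
      by (auto simp: C_def N_def mem_nonneg_exponents intro: exponents_closed)
  next
    fix u v assume "u \<in> C" "v \<in> C"
    then obtain n m n' m' where *: "u = n - m" "v = n' - m'" "n \<in> N" "m \<in> N" "le m n"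
      "n' \<in> N" "m' \<in> N" "le m' n'" by (auto simp: C_def)
    have "le (m + m') (n + m')" "le (n + m') (n + n')"
      using le_add[of m n m'] le_add[of m' n' n] * by (auto simp: add.commute)
    then have "le (m + m') (n + n')"
      using * by (intro le_trans[of "m + m'" "n + m'" "n + n'"] N_add)
    then show "u + v \<in> C"
      using C_iff[of "n + n'" "m + m'"] * N_add by (simp add: add_diff_add)
  next
    fix v assume "v \<in> exponents (V - H)"
    then obtain n m where v: "n \<in> N" "m \<in> N" "v = n - m"
      using exponents_difference unfolding N_def by metis
    have "le m n \<or> le n m"
      using total[of "monomial m" "monomial n"] v NV by (auto simp: le_def add.commute)
    then show "v \<in> C \<or> - v \<in> C"
      using C_iff v by auto
  qed
  moreover have "P = cone_congruence (nonneg_exponents V) N C"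
  proof
    have dom: "dominated C (Poly_Mapping.keys f \<inter> N) (Poly_Mapping.keys g \<inter> N)" if fg: "(f, g) \<in> P" for f g
      unfolding dominated_def
    proof
      fix m assume m: "m \<in> Poly_Mapping.keys f \<inter> N"
      have kg: "Poly_Mapping.keys g \<subseteq> nonneg_exponents V" using fg carr by blast
      obtain g' where g': "Poly_Mapping.keys g' = Poly_Mapping.keys g \<inter> N" "(g, g') \<in> P"
        using restrict_congruent[OF cong _ kg, of H] unfolding N_def H_def by auto
      have mm: "(monomial m, monomial m) \<in> P" using m NV by (auto intro: crefl)
      \<comment> \<open>The monomial of \<open>m\<close> is absorbed by \<open>f\<close>, hence
        modulo \<open>P\<close> by \<open>g\<close> and by \<open>g'\<close>. As this monomial does
        not vanish, \<open>g'\<close> is not 0 and is congruent to one of its own monomials, whose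
        exponent dominates \<open>m\<close>.\<close>
      have "monomial m + f = f" using m by (auto simp: two_poly_eq_iff keys_add_two)
      then have "(monomial m + g, g) \<in> P"
        using cadd[OF mm fg] fg csym ctrans by metis
      then have mg: "(monomial m + g', g') \<in> P"
        using cadd[OF mm g'(2)] g'(2) csym ctrans by metis
      have "g' \<noteq> 0" using mg nz m by auto
      then obtain n where n: "n \<in> Poly_Mapping.keys g'" "(g', monomial n) \<in> P"
        using max_monomial[of g'] carr[OF g'(2)] by auto
      have "(monomial m + monomial n, monomial n) \<in> P"
        using cadd[OF mm n(2)] n(2) mg csym ctrans by metis
      then have "le m n" by (simp add: le_def)
      then show "\<exists>n\<in>Poly_Mapping.keys g \<inter> N. n - m \<in> C"
        using n g' m C_iff by blast
    qed
    show "P \<subseteq> cone_congruence (nonneg_exponents V) N C"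
    proof
      fix x assume x: "x \<in> P"
      obtain f g where fg: "x = (f, g)" by (cases x)
      show "x \<in> cone_congruence (nonneg_exponents V) N C"
        using x dom[of f g] dom[of g f] csym[of f g] carr[of f g] by (simp add: fg cone_congruence_def)
    qed
    show "cone_congruence (nonneg_exponents V) N C \<subseteq> P"
    proof
      fix x assume x: "x \<in> cone_congruence (nonneg_exponents V) N C"
      obtain f g where fg: "x = (f, g)" by (cases x)
      have s: "Poly_Mapping.keys f \<subseteq> nonneg_exponents V" "Poly_Mapping.keys g \<subseteq> nonneg_exponents V"
        using x by (auto simp: fg cone_congruence_def)
      obtain f' where f': "Poly_Mapping.keys f' = Poly_Mapping.keys f \<inter> N" "(f, f') \<in> P"
        using restrict_congruent[OF cong _ s(1), of H] unfolding N_def H_def by auto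
      obtain g' where g': "Poly_Mapping.keys g' = Poly_Mapping.keys g \<inter> N" "(g, g') \<in> P"
        using restrict_congruent[OF cong _ s(2), of H] unfolding N_def H_def by auto
      have d: "dominated C (Poly_Mapping.keys f') (Poly_Mapping.keys g')"
        "dominated C (Poly_Mapping.keys g') (Poly_Mapping.keys f')"
        using x by (auto simp: fg cone_congruence_def f' g')
      have "(f' + g', g') \<in> P"
        using d(1) by (rule absorb) (use f' g' s C_iff le_def in auto)
      moreover have "(g' + f', f') \<in> P"
        using d(2) by (rule absorb) (use f' g' s C_iff le_def in auto)
      ultimately have "(f', g') \<in> P" by (metis add.commute csym ctrans)
      then show "x \<in> P" unfolding fg using f'(2) g'(2) csym ctrans by metis
    qed
  qed
  moreover have "H \<subseteq> V" by (auto simp: H_def)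
  ultimately show thesis
    using that unfolding N_def by blast
qed

section \<open>Refining preorders to total orders\<close>

definition pointed :: "'a::ab_group_add set \<Rightarrow> bool" where
  "pointed C \<longleftrightarrow> (\<forall>v\<in>C. - v \<in> C \<longrightarrow> v = 0)"

lemma frag_cmul_Suc: "frag_cmul (int (Suc c)) v = v + frag_cmul (int c) v"
  by (simp add: frag_cmul_distrib)

lemma frag_cmul_closed:
  assumes "add_closed T" "v \<in> T" shows "frag_cmul (int c) v \<in> T"
proof (induction c)
  case (Suc c)
  then show ?case using assms unfolding frag_cmul_Suc by (auto simp: add_closed_def)
qed (use assms in \<open>simp add: add_closed_def\<close>)

text \<open>The smallest candidate consists of \<open>t + c v\<close> with \<open>t\<close> in
  \<open>M\<close> and \<open>c\<close> a natural number. If it contains \<open>x\<close> and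
  \<open>- x\<close>, adding their representations expresses a negative multiple of \<open>v\<close>
  as an element of \<open>M\<close>, unless no copy of \<open>v\<close> is involved; then
  \<open>x\<close> itself lies in the pointed \<open>M\<close> and is 0.\<close>

lemma adjoin_not_pointed:
  assumes M: "add_closed M" "pointed M" "M \<subseteq> exponents V" and v: "v \<in> exponents V"
    and np: "\<And>E. add_closed E \<Longrightarrow> E \<subseteq> exponents V \<Longrightarrow> M \<subseteq> E \<Longrightarrow> v \<in> E \<Longrightarrow> \<not> pointed E"
  shows "\<exists>c>0. frag_cmul (- int c) v \<in> M"
proof -
  define E where "E = {t + frag_cmul (int c) v | t c. t \<in> M}"
  have M0: "0 \<in> M" using M(1) add_closedD by blast
  have "add_closed E"
    unfolding add_closed_def
  proof (intro conjI ballI)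
    show "0 \<in> E" unfolding E_def using M0 by (intro CollectI exI[of _ 0]) auto
    fix a b assume "a \<in> E" "b \<in> E"
    then obtain t c t' c' where *: "a = t + frag_cmul (int c) v" "b = t' + frag_cmul (int c') v"
      "t \<in> M" "t' \<in> M" by (auto simp: E_def)
    have "a + b = (t + t') + frag_cmul (int (c + c')) v"
      unfolding * by (simp add: frag_cmul_distrib ac_simps)
    moreover have "t + t' \<in> M" using * M(1) add_closedD(2) by blast
    ultimately show "a + b \<in> E" unfolding E_def by blast
  qed
  moreover have "E \<subseteq> exponents V"
  proof
    fix x assume "x \<in> E"
    then obtain t c where "x = t + frag_cmul (int c) v" "t \<in> M" by (auto simp: E_def)
    then show "x \<in> exponents V" using M(3) v by (auto intro: exponents_closed)
  qed
  moreover have "M \<subseteq> E"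
  proof
    fix t assume "t \<in> M"
    then show "t \<in> E" unfolding E_def by (intro CollectI exI[of _ t] exI[of _ 0]) auto
  qed
  moreover have "v \<in> E"
    unfolding E_def using M0 by (intro CollectI exI[of _ 0] exI[of _ 1]) auto
  ultimately have "\<not> pointed E" by (rule np)
  then obtain x where x: "x \<in> E" "- x \<in> E" "x \<noteq> 0"
    by (auto simp: pointed_def)
  then obtain t c t' c' where *: "x = t + frag_cmul (int c) v" "- x = t' + frag_cmul (int c') v"
    "t \<in> M" "t' \<in> M" by (auto simp: E_def)
  have sum: "t + t' + frag_cmul (int (c + c')) v = 0"
  proof -
    have "t + frag_cmul (int c) v + (t' + frag_cmul (int c') v) = 0"
      unfolding *(1,2)[symmetric] by simp
    then show ?thesis by (simp add: frag_cmul_distrib ac_simps)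
  qed
  show ?thesis
  proof (cases "c + c' = 0")
    case True
    then have "t + t' = 0" using sum by simp
    then have "- t = t'" by (rule minus_unique)
    then have "t = 0" using * M(2) by (auto simp: pointed_def)
    then show ?thesis using * True x by simp
  next
    case False
    have "frag_cmul (- int (c + c')) v = t + t'"
      using sum by (metis add.commute eq_neg_iff_add_eq_0 minus_frag_cmul)
    then have "frag_cmul (- int (c + c')) v \<in> M"
      using * M(1) add_closedD(2) by metis
    then show ?thesis using False by blast
  qed
qed

text \<open>Levi's theorem that torsion-free abelian groups are orderable, relative to a given
  partial order. If a maximal pointed cone contained neither \<open>v\<close> nor
  \<open>- v\<close>, it would contain \<open>- c v\<close> and \<open>d v\<close> for some positive
  \<open>c\<close> and \<open>d\<close>. Scaling both to the coefficient \<open>c d\<close> gives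
  opposite elements, so \<open>v = 0\<close> by pointedness and absence of torsion.\<close>

lemma extend_pointed_cone:
  assumes T: "add_closed T" "pointed T" "T \<subseteq> exponents V"
  obtains C where "total_cone V C" "pointed C" "T \<subseteq> C"
proof -
  define F where "F = {E. add_closed E \<and> pointed E \<and> E \<subseteq> exponents V \<and> T \<subseteq> E}"
  have "\<exists>M\<in>F. \<forall>X\<in>F. M \<subseteq> X \<longrightarrow> X = M"
  proof (rule subset_Zorn_nonempty)
    show "F \<noteq> {}" using T by (auto simp: F_def)
    fix Ch assume ne: "Ch \<noteq> {}" and ch: "subset.chain F Ch"
    then have sub: "\<And>E. E \<in> Ch \<Longrightarrow> E \<in> F" by (auto simp: subset.chain_def)
    have common: "\<exists>E\<in>Ch. a \<in> E \<and> b \<in> E" if "a \<in> \<Union>Ch" "b \<in> \<Union>Ch" for a b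
    proof -
      obtain E E' where E: "E \<in> Ch" "E' \<in> Ch" "a \<in> E" "b \<in> E'" using \<open>a \<in> \<Union>Ch\<close> \<open>b \<in> \<Union>Ch\<close> by blast
      then have "E \<subseteq> E' \<or> E' \<subseteq> E"
        using ch by (auto simp: subset_chain_def)
      then show ?thesis using E by blast
    qed
    have "add_closed (\<Union>Ch)"
      unfolding add_closed_def
    proof (intro conjI ballI)
      show "0 \<in> \<Union>Ch" using ne sub by (auto simp: F_def add_closed_def)
      fix a b assume "a \<in> \<Union>Ch" "b \<in> \<Union>Ch"
      from common[OF this] obtain E where E: "E \<in> Ch" "a \<in> E" "b \<in> E" by blast
      then have "a + b \<in> E" using sub[OF E(1)] by (simp add: F_def add_closed_def)
      then show "a + b \<in> \<Union>Ch" using E by blast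
    qed
    moreover have "pointed (\<Union>Ch)"
      unfolding pointed_def
    proof (intro ballI impI)
      fix a assume "a \<in> \<Union>Ch" "- a \<in> \<Union>Ch"
      from common[OF this] obtain E where E: "E \<in> Ch" "a \<in> E" "- a \<in> E" by blast
      then show "a = 0" using sub[OF E(1)] by (simp add: F_def pointed_def)
    qed
    moreover have "T \<subseteq> \<Union>Ch" using ne sub by (auto simp: F_def)
    moreover have "\<Union>Ch \<subseteq> exponents V" using sub by (auto simp: F_def)
    ultimately show "\<Union>Ch \<in> F" by (simp add: F_def)
  qed
  then obtain M where M: "M \<in> F" and max: "\<And>X. X \<in> F \<Longrightarrow> M \<subseteq> X \<Longrightarrow> X = M" by blast
  have M': "add_closed M" "pointed M" "M \<subseteq> exponents V" "T \<subseteq> M" using M by (auto simp: F_def)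
  have "v \<in> M \<or> - v \<in> M" if v: "v \<in> exponents V" for v
  proof (rule ccontr)
    assume n: "\<not> (v \<in> M \<or> - v \<in> M)"
    have np: "\<not> pointed E" if "add_closed E" "E \<subseteq> exponents V" "M \<subseteq> E" "w \<in> E" "w \<notin> M" for E w
      using max[of E] that M' by (auto simp: F_def)
    obtain c where c: "c > 0" "frag_cmul (- int c) v \<in> M"
      using adjoin_not_pointed[OF M'(1-3) v] np n by blast
    obtain d where d: "d > 0" "frag_cmul (- int d) (- v) \<in> M"
      using adjoin_not_pointed[OF M'(1-3) exponents_closed(3)[OF v]] np n by blast
    have "frag_cmul (int d) (frag_cmul (- int c) v) \<in> M" "frag_cmul (int c) (frag_cmul (- int d) (- v)) \<in> M"
      using c d M'(1) frag_cmul_closed by blast+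
    moreover have "frag_cmul (int c) (frag_cmul (- int d) (- v)) = - frag_cmul (int d) (frag_cmul (- int c) v)"
      by (rule poly_mapping_eqI) simp
    ultimately have "frag_cmul (int d) (frag_cmul (- int c) v) = 0"
      using M'(2) unfolding pointed_def by metis
    then have "v = 0" using c d by simp
    then show False using n M'(1) add_closedD(1) by blast
  qed
  then show thesis using that[of M] M' by (simp add: total_cone_def)
qed

definition order_congruence :: "nat set \<Rightarrow> (nat \<Rightarrow>\<^sub>0 int) set \<Rightarrow> (laurent \<times> laurent) set" where
  "order_congruence V C = cone_congruence (nonneg_exponents V) (nonneg_exponents V) C"

lemma nonneg_exponents_subset: "nonneg_exponents V \<subseteq> exponents V"
  by (auto simp: nonneg_exponents_def)

lemma mem_order_congruence:
  "(f, g) \<in> order_congruence V C \<longleftrightarrow>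
    Poly_Mapping.keys f \<subseteq> nonneg_exponents V \<and> Poly_Mapping.keys g \<subseteq> nonneg_exponents V \<and>
    dominated C (Poly_Mapping.keys f) (Poly_Mapping.keys g) \<and>
    dominated C (Poly_Mapping.keys g) (Poly_Mapping.keys f)"
  by (auto simp: order_congruence_def cone_congruence_def Int_absorb2)

lemma prime_cone_congruence:
  assumes "W \<subseteq> V" "total_cone W C"
  shows "prime_congruence (poly_semiring V)
    (cone_congruence (nonneg_exponents V) (nonneg_exponents W) C)"
  unfolding poly_semiring_eq
proof (rule cone_congruence_prime)
  show "\<forall>a\<in>nonneg_exponents W. \<forall>b\<in>nonneg_exponents W. a - b \<in> C \<or> b - a \<in> C"
    using total_coneD(4)[OF assms(2)] nonneg_exponents_subset by blast
qed (use assms in \<open>auto simp: add_closed_nonneg_exponents nonneg_exponents_face total_coneD\<close>)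

lemma prime_order_congruence:
  "total_cone V C \<Longrightarrow> prime_congruence (poly_semiring V) (order_congruence V C)"
  by (simp add: order_congruence_def prime_cone_congruence)

text \<open>The variables in \<open>H\<close> are made infinitesimally small, and ties are broken arbitrarily.\<close>

lemma cone_congruence_refine:
  assumes H: "H \<subseteq> V" and C: "total_cone (V - H) C"
  obtains D where "total_cone V D" "pointed D"
    "order_congruence V D \<subseteq> cone_congruence (nonneg_exponents V) (nonneg_exponents (V - H)) C"
proof -
  \<comment> \<open>Elements of \<open>A\<close> lower the exponents in \<open>H\<close>, so they
    must be positive whatever their other coordinates are. \<open>B\<close> keeps the strict
    comparisons of \<open>C\<close>; the elements equivalent to 0 are left for the extension to
    decide.\<close>
  define A where "A = {v \<in> exponents V. (\<forall>i\<in>H. Poly_Mapping.lookup v i \<le> 0) \<and>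
    (\<exists>i\<in>H. Poly_Mapping.lookup v i < 0)}"
  define B where "B = {v \<in> C. - v \<notin> C}"
  define T where "T = {0} \<union> A \<union> B"
  have B0: "Poly_Mapping.lookup v i = 0" if "v \<in> C" "i \<in> H" for v i
    using that total_coneD(2)[OF C] by (auto simp: mem_exponents)
  have BV: "v \<in> exponents V" if "v \<in> C" for v
    using that total_coneD(2)[OF C] by (auto simp: mem_exponents)
  have AA: "a + b \<in> A" if a: "a \<in> A" and ab: "b \<in> A \<or> b \<in> B" for a b
  proof -
    obtain i where i: "i \<in> H" "Poly_Mapping.lookup a i < 0" using a unfolding A_def by blast
    have b: "b \<in> exponents V" "\<forall>i\<in>H. Poly_Mapping.lookup b i \<le> 0"
      using ab B0 BV by (auto simp: A_def B_def)
    have "Poly_Mapping.lookup (a + b) i < 0" using i b by (simp add: lookup_add add_neg_nonpos)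
    moreover have "\<forall>i\<in>H. Poly_Mapping.lookup (a + b) i \<le> 0"
      using a b by (auto simp: A_def lookup_add add_nonpos_nonpos)
    ultimately show ?thesis using a b i by (auto simp: A_def exponents_closed)
  qed
  have BB: "a + b \<in> B" if "a \<in> B" "b \<in> B" for a b
  proof -
    have "- (a + b) \<notin> C"
    proof
      assume "- (a + b) \<in> C"
      moreover have "b \<in> C" using that by (simp add: B_def)
      ultimately have "- (a + b) + b \<in> C" by (rule add_closedD(2)[OF total_coneD(1)[OF C]])
      then show False using that by (simp add: B_def)
    qed
    then show ?thesis using that total_coneD(1)[OF C] add_closedD(2) by (auto simp: B_def)
  qed
  have "add_closed T"
    unfolding add_closed_def
  proof (intro conjI ballI)
    show "0 \<in> T" by (simp add: T_def)
    fix a b assume ab: "a \<in> T" "b \<in> T"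
    consider "a = 0" | "b = 0" | "a \<in> A" "b \<in> A \<or> b \<in> B" | "b \<in> A" "a \<in> A \<or> a \<in> B" | "a \<in> B" "b \<in> B"
      using ab by (auto simp: T_def)
    then show "a + b \<in> T"
    proof cases
      case 4
      then show ?thesis using AA[of b a] by (simp add: T_def add.commute)
    qed (use ab AA BB in \<open>auto simp: T_def\<close>)
  qed
  moreover have "pointed T"
    unfolding pointed_def
  proof (intro ballI impI)
    fix v assume v: "v \<in> T" "- v \<in> T"
    have "v \<notin> A" using v B0[of "- v"] by (auto simp: T_def A_def B_def)
    moreover have "- v \<notin> A" using v B0[of v] by (auto simp: T_def A_def B_def)
    ultimately show "v = 0" using v by (auto simp: T_def B_def)
  qed
  moreover have "T \<subseteq> exponents V"
    using BV by (auto simp: T_def A_def B_def exponents_closed)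
  ultimately obtain D where D: "total_cone V D" "pointed D" "T \<subseteq> D"
    by (rule extend_pointed_cone)
  have dom: "dominated C (Poly_Mapping.keys f \<inter> nonneg_exponents (V - H)) (Poly_Mapping.keys g \<inter> nonneg_exponents (V - H))"
    if d: "dominated D (Poly_Mapping.keys f) (Poly_Mapping.keys g)"
      and g: "Poly_Mapping.keys g \<subseteq> nonneg_exponents V" for f g :: laurent
    unfolding dominated_def
  proof
    fix m assume m: "m \<in> Poly_Mapping.keys f \<inter> nonneg_exponents (V - H)"
    then obtain n where n: "n \<in> Poly_Mapping.keys g" "n - m \<in> D"
      using d by (auto simp: dominated_def)
    have nV: "n \<in> nonneg_exponents V" using n g by blast
    have m0: "Poly_Mapping.lookup m i = 0" if "i \<in> H" for i
      using m that by (auto simp: mem_nonneg_exponents mem_exponents)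
    have mV: "m \<in> exponents V" using m by (auto simp: mem_nonneg_exponents mem_exponents)
    \<comment> \<open>A monomial involving \<open>H\<close> lies strictly below \<open>m\<close> in
      \<open>D\<close>, since \<open>m\<close> does not involve \<open>H\<close>; thus it cannot
      dominate \<open>m\<close>.\<close>
    have nW: "n \<in> nonneg_exponents (V - H)"
    proof (rule ccontr)
      assume "\<not> ?thesis"
      then obtain i where i: "i \<in> H" "Poly_Mapping.lookup n i > 0"
        using nV unfolding mem_nonneg_exponents mem_exponents by (metis DiffI order_le_less)
      then have "m - n \<in> A"
        using nV mV m0 by (auto simp: A_def lookup_minus mem_nonneg_exponents intro!: exponents_closed)
      then have "m - n \<in> D" using D(3) by (auto simp: T_def)
      then have "n = m" using D(2) n(2) unfolding pointed_def by (metis minus_diff_eq eq_iff_diff_eq_0)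
      then show False using i m0 by auto
    qed
    have "n - m \<in> C"
    proof (rule ccontr)
      assume nC: "n - m \<notin> C"
      have "n - m \<in> exponents (V - H)"
        using m nW by (auto simp: mem_nonneg_exponents intro: exponents_closed)
      then have "m - n \<in> B" using nC total_coneD(3)[OF C] by (fastforce simp: B_def)
      then have "m - n \<in> D" using D(3) by (auto simp: T_def)
      then have "n = m" using D(2) n(2) unfolding pointed_def by (metis minus_diff_eq eq_iff_diff_eq_0)
      then show False using nC total_coneD(1)[OF C] add_closedD(1) by auto
    qed
    then show "\<exists>n\<in>Poly_Mapping.keys g \<inter> nonneg_exponents (V - H). n - m \<in> C"
      using n nW by blast
  qed
  have "order_congruence V D \<subseteq> cone_congruence (nonneg_exponents V) (nonneg_exponents (V - H)) C"
    unfolding order_congruence_def cone_congruence_def using dom by (auto simp: Int_absorb2)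
  then show thesis using that D(1,2) by blast
qed

lemma prime_contains_order_congruence:
  assumes "prime_congruence (poly_semiring V) P"
  obtains C where "total_cone V C" "pointed C" "order_congruence V C \<subseteq> P"
  using assms prime_poly_semiring cone_congruence_refine by metis

text \<open>Keeps the family of order congruences non-empty, so that its intersection stays inside
  the carrier and is proper.\<close>

lemma pointed_cone_exists:
  obtains C where "total_cone V C" "pointed C"
proof -
  have "add_closed {0::nat \<Rightarrow>\<^sub>0 int}" "pointed {0::nat \<Rightarrow>\<^sub>0 int}" "{0} \<subseteq> exponents V"
    by (auto simp: add_closed_def pointed_def exponents_closed)
  then show thesis using extend_pointed_cone that by metis
qed

section \<open>The radical as an intersection over total orders\<close>

lemma monoid_algebra_prime_poly:
  assumes "prime_congruence (poly_semiring V) P"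
  shows "monoid_algebra_prime (nonneg_exponents V) P"
  by unfold_locales (use assms in \<open>auto simp: add_closed_nonneg_exponents prime_congruence_def
      proper_congruence_def poly_semiring_eq\<close>)

lemma mem_Rad_iff:
  "(f, g) \<in> congruence_Rad (poly_semiring V) (trivial_congruence (poly_semiring V)) \<longleftrightarrow>
    Poly_Mapping.keys f \<subseteq> nonneg_exponents V \<and> Poly_Mapping.keys g \<subseteq> nonneg_exponents V \<and>
    (\<forall>C. total_cone V C \<and> pointed C \<longrightarrow> (f, g) \<in> order_congruence V C)"
    (is "?L \<longleftrightarrow> ?R")
proof -
  have triv: "trivial_congruence (poly_semiring V) \<subseteq> P" if "prime_congruence (poly_semiring V) P" for P
    using monoid_algebra_congruence.crefl[OF monoid_algebra_prime.axioms(1)[OF monoid_algebra_prime_poly[OF that]]]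
    by (auto simp: trivial_congruence_def poly_semiring_eq)
  have "?L \<longleftrightarrow> Poly_Mapping.keys f \<subseteq> nonneg_exponents V \<and> Poly_Mapping.keys g \<subseteq> nonneg_exponents V \<and>
     (\<forall>P. prime_congruence (poly_semiring V) P \<longrightarrow> (f, g) \<in> P)"
    using triv by (auto simp: congruence_Rad_def poly_semiring_eq)
  also have "\<dots> \<longleftrightarrow> ?R"
    using prime_order_congruence prime_contains_order_congruence by (metis subsetD)
  finally show ?thesis .
qed

lemma congruence_kernel_order_congruence:
  assumes "total_cone V C"
  shows "congruence_kernel (poly_semiring V) (order_congruence V C) = {0}"
  using total_coneD(1)[OF assms]
  by (auto simp: congruence_kernel_def mem_order_congruence poly_semiring_eq dominated_def)

section \<open>Quotients\<close>

lemma congruence_Inter: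
  assumes "\<And>I. I \<in> F \<Longrightarrow> congruence A I" "F \<noteq> {}"
  shows "congruence A (\<Inter>F)"
  unfolding congruence_def
proof (intro conjI allI impI equivI)
  have eq: "equiv (carrier A) I" if "I \<in> F" for I using assms that by (auto simp: congruence_def)
  show "\<Inter>F \<subseteq> carrier A \<times> carrier A" using eq assms(2) by (auto simp: equiv_def)
  show "refl_on (carrier A) (\<Inter>F)" using eq by (auto simp: refl_on_def equiv_def)
  show "sym (\<Inter>F)" using eq by (auto simp: sym_def equiv_def)
  show "trans (\<Inter>F)" using eq unfolding equiv_def trans_def by blast
  fix a b c d assume "(a, b) \<in> \<Inter>F \<and> (c, d) \<in> \<Inter>F"
  then show "(a \<oplus>\<^bsub>A\<^esub> c, b \<oplus>\<^bsub>A\<^esub> d) \<in> \<Inter>F" "(a \<otimes>\<^bsub>A\<^esub> c, b \<otimes>\<^bsub>A\<^esub> d) \<in> \<Inter>F"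
    using assms(1) by (auto simp: congruence_def)
qed

lemma congruence_class_op:
  assumes I: "equiv S I"
    and f: "\<And>a b c d. (a, b) \<in> I \<Longrightarrow> (c, d) \<in> I \<Longrightarrow> (f a c, f b d) \<in> I"
    and "x \<in> S" "y \<in> S"
  shows "(\<Union>a\<in>I `` {x}. \<Union>b\<in>I `` {y}. I `` {f a b}) = I `` {f x y}"
proof -
  have "I `` {f a b} = I `` {f x y}" if "a \<in> I `` {x}" "b \<in> I `` {y}" for a b
    using f[of x a y b] that equiv_class_eq[OF I] by simp
  moreover have "x \<in> I `` {x}" "y \<in> I `` {y}"
    using equiv_class_self[OF I] assms(3,4) by blast+
  ultimately show ?thesis by blast
qed

lemma quotient_semiring_simps:
  assumes "congruence A I"
  shows "carrier (quotient_semiring A I) = carrier A // I"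
    "x \<in> carrier A \<Longrightarrow> y \<in> carrier A \<Longrightarrow>
      I `` {x} \<otimes>\<^bsub>quotient_semiring A I\<^esub> I `` {y} = I `` {x \<otimes>\<^bsub>A\<^esub> y}"
    "x \<in> carrier A \<Longrightarrow> y \<in> carrier A \<Longrightarrow>
      I `` {x} \<oplus>\<^bsub>quotient_semiring A I\<^esub> I `` {y} = I `` {x \<oplus>\<^bsub>A\<^esub> y}"
    "\<one>\<^bsub>quotient_semiring A I\<^esub> = I `` {\<one>\<^bsub>A\<^esub>}" "\<zero>\<^bsub>quotient_semiring A I\<^esub> = I `` {\<zero>\<^bsub>A\<^esub>}"
  using congruence_class_op[of "carrier A" I "monoid.mult A" x y]
    congruence_class_op[of "carrier A" I "add A" x y] assms
  by (simp_all add: quotient_semiring_def congruence_def)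

abbreviation Rad_trivial :: "nat set \<Rightarrow> (laurent \<times> laurent) set" where
  "Rad_trivial V \<equiv> congruence_Rad (poly_semiring V) (trivial_congruence (poly_semiring V))"

lemma Rad_trivial_eq: "Rad_trivial V = \<Inter>{order_congruence V C | C. total_cone V C \<and> pointed C}"
proof -
  obtain C where C: "total_cone V C" "pointed C" by (rule pointed_cone_exists)
  have "(f, g) \<in> Rad_trivial V \<longleftrightarrow> (\<forall>C. total_cone V C \<and> pointed C \<longrightarrow> (f, g) \<in> order_congruence V C)" for f g
    using C unfolding mem_Rad_iff mem_order_congruence by blast
  note iff = this
  show ?thesis
  proof (intro equalityI subsetI)
    fix x assume "x \<in> Rad_trivial V"
    moreover obtain f g where "x = (f, g)" by (cases x)
    ultimately show "x \<in> \<Inter>{order_congruence V C | C. total_cone V C \<and> pointed C}"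
      using iff[of f g] by blast
  next
    fix x assume "x \<in> \<Inter>{order_congruence V C | C. total_cone V C \<and> pointed C}"
    moreover obtain f g where "x = (f, g)" by (cases x)
    ultimately show "x \<in> Rad_trivial V"
      using iff[of f g] by blast
  qed
qed

lemma congruence_Rad_trivial: "congruence (poly_semiring V) (Rad_trivial V)"
  unfolding Rad_trivial_eq
proof (rule congruence_Inter)
  obtain C where "total_cone V C" "pointed C" by (rule pointed_cone_exists)
  then show "{order_congruence V C | C. total_cone V C \<and> pointed C} \<noteq> {}" by blast
  fix I assume "I \<in> {order_congruence V C | C. total_cone V C \<and> pointed C}"
  then obtain C where "I = order_congruence V C" "total_cone V C" by blast
  then show "congruence (poly_semiring V) I"
    using prime_order_congruence[of V C] by (simp add: prime_congruence_def proper_congruence_def)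
qed

text \<open>In the congruence of a total order only 0 is congruent to 0, so a non-zero
  \<open>f\<close> can be cancelled in every member of the family simultaneously. Primes with larger
  kernel would not allow this; the description of the radical by total orders avoids them.\<close>

lemma Rad_trivial_cancel:
  assumes "(f * g, f * h) \<in> Rad_trivial V" "f \<noteq> 0" "Poly_Mapping.keys f \<subseteq> nonneg_exponents V"
    "Poly_Mapping.keys g \<subseteq> nonneg_exponents V" "Poly_Mapping.keys h \<subseteq> nonneg_exponents V"
  shows "(g, h) \<in> Rad_trivial V"
proof -
  have "(g, h) \<in> order_congruence V C" if C: "total_cone V C" "pointed C" for C
  proof -
    interpret monoid_algebra_prime "nonneg_exponents V" "order_congruence V C"
      using C by (intro monoid_algebra_prime_poly prime_order_congruence)
    have "(f, 0) \<notin> order_congruence V C"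
      using assms(2) by (auto simp: mem_order_congruence dominated_def)
    moreover have "(f * g, f * h) \<in> order_congruence V C"
      using assms(1) C by (simp add: mem_Rad_iff)
    ultimately show ?thesis using cancel assms by blast
  qed
  then show ?thesis using assms by (simp add: mem_Rad_iff)
qed

lemma QC_Rad_trivial: "QC_congruence (poly_semiring V) (Rad_trivial V)"
  unfolding QC_congruence_def proper_congruence_def cancellative_def
proof (intro conjI ballI impI)
  let ?A = "poly_semiring V" and ?R = "Rad_trivial V"
  note q = quotient_semiring_simps[OF congruence_Rad_trivial[of V]]
  have eq: "equiv (carrier ?A) ?R" using congruence_Rad_trivial by (simp add: congruence_def)
  show "congruence ?A ?R" by (rule congruence_Rad_trivial)
  obtain C where "total_cone V C" "pointed C" by (rule pointed_cone_exists)
  then have "(1, 0) \<notin> ?R"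
    unfolding Rad_trivial_eq by (auto simp: mem_order_congruence dominated_def)
  moreover have "(1, 0) \<in> carrier ?A \<times> carrier ?A"
    using add_closedD(1)[OF add_closed_nonneg_exponents] by (simp add: poly_semiring_eq)
  ultimately show "?R \<noteq> carrier ?A \<times> carrier ?A" by metis
  fix X Y Z
  assume "X \<in> carrier (quotient_semiring ?A ?R)" "Y \<in> carrier (quotient_semiring ?A ?R)"
    "Z \<in> carrier (quotient_semiring ?A ?R)"
  then obtain f g h where f: "X = ?R `` {f}" "f \<in> carrier ?A" and g: "Y = ?R `` {g}" "g \<in> carrier ?A"
    and h: "Z = ?R `` {h}" "h \<in> carrier ?A"
    unfolding q(1) by (meson quotientE)
  have fgh: "f * g \<in> carrier ?A" "f * h \<in> carrier ?A"
    using f g h keys_mult_closed[OF add_closed_nonneg_exponents] by (auto simp: poly_semiring_eq)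
  assume "X \<otimes>\<^bsub>quotient_semiring ?A ?R\<^esub> Y = X \<otimes>\<^bsub>quotient_semiring ?A ?R\<^esub> Z"
  then have "?R `` {f * g} = ?R `` {f * h}"
    using q(2)[of f g] q(2)[of f h] f g h by (simp add: poly_semiring_eq)
  then have "(f * g, f * h) \<in> ?R" using eq_equiv_class[OF _ eq fgh(2)] by simp
  then have "f = 0 \<or> (g, h) \<in> ?R"
    using Rad_trivial_cancel[of f g h] f g h by (auto simp: poly_semiring_eq)
  then show "X = \<zero>\<^bsub>quotient_semiring ?A ?R\<^esub> \<or> Y = Z"
    unfolding q(5) f(1) g(1) h(1) using equiv_class_eq[OF eq] by (auto simp: poly_semiring_eq)
qed

section \<open>Congruences given by matrices\<close>

definition matrix_cone :: "nat set \<Rightarrow> real mat \<Rightarrow> (nat \<Rightarrow>\<^sub>0 int) set" where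
  "matrix_cone V U = {v \<in> exponents V. lex_nonneg (U *\<^sub>v exponent_vec V v)}"

text \<open>Closure of the cone under addition makes the right-hand side a congruence containing the
  generators; conversely every comparison of two monomials is itself a generator, and
  \<open>absorb\<close> extends it to polynomials. The hypothesis holds later because the matrix is
  constructed from a given total cone.\<close>

lemma laurent_prime_eq:
  assumes "add_closed (matrix_cone V U)"
  shows "laurent_prime V U = cone_congruence (exponents V) (exponents V) (matrix_cone V U)"
    (is "_ = ?P")
proof
  let ?X = "{(monomial n1 + monomial n2, monomial n2) | n1 n2.
        n1 \<in> exponents V \<and> n2 \<in> exponents V \<and> lex_nonneg (U *\<^sub>v exponent_vec V (n2 - n1))}"
  have "congruence (laurent_semiring V) ?P"
    unfolding laurent_semiring_eq
    by (intro cone_congruence_congruence monoid_face_refl add_closed_exponents assms)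
  moreover have "?X \<subseteq> ?P"
    using add_closedD(1)[OF assms]
    by (auto simp: cone_congruence_def keys_add_two dominated_def matrix_cone_def exponents_closed)
  ultimately show "laurent_prime V U \<subseteq> ?P"
    unfolding laurent_prime_def generated_congruence_def by blast
  have "?P \<subseteq> I" if I: "congruence (monoid_algebra (exponents V)) I" and X: "?X \<subseteq> I" for I
  proof
    interpret monoid_algebra_congruence "exponents V" I
      by unfold_locales (use I in \<open>auto simp: add_closed_exponents\<close>)
    fix x assume x: "x \<in> ?P"
    obtain f g where fg: "x = (f, g)" by (cases x)
    have s: "Poly_Mapping.keys f \<subseteq> exponents V" "Poly_Mapping.keys g \<subseteq> exponents V"
      using x by (auto simp: fg cone_congruence_def)
    then have d: "dominated (matrix_cone V U) (Poly_Mapping.keys f) (Poly_Mapping.keys g)"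
        "dominated (matrix_cone V U) (Poly_Mapping.keys g) (Poly_Mapping.keys f)"
      using x by (auto simp: fg cone_congruence_def Int_absorb2)
    have mon: "(monomial m + monomial n, monomial n) \<in> I"
      if "m \<in> exponents V" "n \<in> exponents V" "n - m \<in> matrix_cone V U" for m n
      using that X by (force simp: matrix_cone_def)
    have "(f + g, g) \<in> I"
      using d(1) s by (rule absorb) (use mon s in blast)
    moreover have "(g + f, f) \<in> I"
      using d(2) s(2,1) by (rule absorb) (use mon s in blast)
    ultimately show "x \<in> I" unfolding fg by (metis add.commute csym ctrans)
  qed
  then show "?P \<subseteq> laurent_prime V U"
    unfolding laurent_prime_def generated_congruence_def laurent_semiring_eq by blast
qed

lemma poly_prime_eq:
  assumes "add_closed (matrix_cone V U)"
  shows "poly_prime V U = order_congruence V (matrix_cone V U)"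
proof -
  have "(f, g) \<in> poly_prime V U \<longleftrightarrow> (f, g) \<in> order_congruence V (matrix_cone V U)" for f g
  proof (cases "Poly_Mapping.keys f \<subseteq> nonneg_exponents V \<and> Poly_Mapping.keys g \<subseteq> nonneg_exponents V")
    case True
    then have "Poly_Mapping.keys f \<subseteq> exponents V" "Poly_Mapping.keys g \<subseteq> exponents V"
      using nonneg_exponents_subset by blast+
    then show ?thesis
      using True unfolding poly_prime_def laurent_prime_eq[OF assms]
      by (simp add: poly_semiring_eq mem_order_congruence cone_congruence_def Int_absorb2)
  next
    case False
    then show ?thesis by (auto simp: poly_prime_def poly_semiring_eq mem_order_congruence)
  qed
  then show ?thesis by (simp add: set_eq_iff split_paired_all)
qed

section \<open>Rank of subgroups of the exponent group\<close>

lemma lookup_scaleR [simp]: "Poly_Mapping.lookup (c *\<^sub>R p) i = c *\<^sub>R Poly_Mapping.lookup p i"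
  by (simp add: scaleR_poly_mapping_def)

lemma lookup_real_exponent [simp]:
  "Poly_Mapping.lookup (real_exponent n) i = real_of_int (Poly_Mapping.lookup n i)"
  by (simp add: real_exponent_def Poly_Mapping.map.rep_eq when_def)

lemma real_exponent_simps [simp]:
  "real_exponent 0 = 0" "real_exponent (m + n) = real_exponent m + real_exponent n"
  "real_exponent (- n) = - real_exponent n" "real_exponent (m - n) = real_exponent m - real_exponent n"
  "real_exponent (frag_cmul c n) = real_of_int c *\<^sub>R real_exponent n"
  by (auto intro!: poly_mapping_eqI simp: lookup_add lookup_minus)

lemma real_exponent_sum: "real_exponent (sum f A) = (\<Sum>x\<in>A. real_exponent (f x))"
  by (induction A rule: infinite_finite_induct) auto

lemma real_exponent_inject [simp]: "real_exponent m = real_exponent n \<longleftrightarrow> m = n"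
proof
  assume "real_exponent m = real_exponent n"
  then show "m = n"
    by (intro poly_mapping_eqI) (metis lookup_real_exponent of_int_eq_iff)
qed simp

text \<open>Passes from rational relations between embedded exponents to integer relations in the
  exponent group.\<close>

lemma common_denominator:
  assumes "finite A"
  shows "\<exists>N>0. \<exists>a :: 'a \<Rightarrow> int. \<forall>x\<in>A. of_int N * f x = (of_int (a x) :: rat)"
proof -
  have "\<exists>N>0. \<forall>x\<in>A. \<exists>a :: int. of_int N * f x = (of_int a :: rat)"
    using assms
  proof (induction A rule: finite_induct)
    case empty
    show ?case by (intro exI[of _ 1]) simp
  next
    case (insert x A)
    then obtain N where N: "N > 0" "\<forall>x\<in>A. \<exists>a :: int. of_int N * f x = of_int a" by blast
    obtain p q where pq: "quotient_of (f x) = (p, q)" by (cases "quotient_of (f x)")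
    have q: "q > 0" "of_int q * f x = of_int p"
      using quotient_of_denom_pos[OF pq] quotient_of_div[OF pq] by auto
    have "\<exists>a :: int. of_int (N * q) * f y = of_int a" if y: "y \<in> insert x A" for y
    proof (cases "y = x")
      case True
      then have "of_int (N * q) * f y = of_int (N * p)" using q by simp
      then show ?thesis by blast
    next
      case False
      then obtain a where "of_int N * f y = of_int a" using N y by blast
      then have "of_int (N * q) * f y = of_int (q * a)" by (simp add: ac_simps)
      then show ?thesis by blast
    qed
    then show ?case using N q by (intro exI[of _ "N * q"]) simp
  qed
  then show ?thesis by metis
qed

text \<open>Rational scalars are the right ones: additive real-valued functions on exponents
  correspond to rational-linear maps, whereas they need not respect real relations inside the
  function space.\<close>

interpretation Q: vector_space "\<lambda>q (p :: nat \<Rightarrow>\<^sub>0 real). real_of_rat q *\<^sub>R p"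
  by unfold_locales (simp_all add: scaleR_add_right scaleR_add_left of_rat_add of_rat_mult)

interpretation QR: vector_space "\<lambda>q (r :: real). real_of_rat q * r"
  by unfold_locales (simp_all add: algebra_simps of_rat_add of_rat_mult)

interpretation QP: vector_space_pair "\<lambda>q (p :: nat \<Rightarrow>\<^sub>0 real). real_of_rat q *\<^sub>R p"
  "\<lambda>q (r :: real). real_of_rat q * r" ..

lemma real_exponent_in_span:
  assumes V: "finite V" and n: "n \<in> exponents V"
  shows "real_exponent n \<in> Q.span ((\<lambda>i. Poly_Mapping.single i 1) ` V)"
proof -
  have "real_exponent n = (\<Sum>i\<in>V. real_of_rat (of_int (Poly_Mapping.lookup n i)) *\<^sub>R Poly_Mapping.single i 1)"
    by (rule poly_mapping_eqI)
       (use n V in \<open>auto simp: lookup_sum lookup_single when_def mem_exponents if_distrib cong: if_cong\<close>)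
  also have "\<dots> \<in> Q.span ((\<lambda>i. Poly_Mapping.single i 1) ` V)"
    by (intro Q.span_sum Q.span_scale Q.span_base) auto
  finally show ?thesis .
qed

lemma independent_real_exponent:
  assumes fin: "finite B"
    and ind: "\<And>a. (\<Sum>b\<in>B. frag_cmul (a b) b) = 0 \<Longrightarrow> \<forall>b\<in>B. a b = 0"
  shows "Q.independent (real_exponent ` B)"
proof (rule Q.independent_if_scalars_zero)
  show "finite (real_exponent ` B)" using fin by simp
  fix f x
  assume 0: "(\<Sum>x\<in>real_exponent ` B. real_of_rat (f x) *\<^sub>R x) = 0" and x: "x \<in> real_exponent ` B"
  obtain N a where N: "N > 0" "\<forall>b\<in>B. of_int N * f (real_exponent b) = of_int (a b)"
    using common_denominator[OF fin, of "\<lambda>b. f (real_exponent b)"] by metis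
  have a: "real_of_int (a b) = real_of_int N * real_of_rat (f (real_exponent b))" if "b \<in> B" for b
    using N(2) that by (metis of_rat_mult of_rat_of_int_eq)
  have "real_exponent (\<Sum>b\<in>B. frag_cmul (a b) b) =
      real_of_int N *\<^sub>R (\<Sum>b\<in>B. real_of_rat (f (real_exponent b)) *\<^sub>R real_exponent b)"
    by (simp add: real_exponent_sum scaleR_sum_right a)
  also have "\<dots> = 0"
    using 0 by (simp add: sum.reindex inj_on_def)
  finally have "(\<Sum>b\<in>B. frag_cmul (a b) b) = 0"
    by (metis real_exponent_inject real_exponent_simps(1))
  then have "\<forall>b\<in>B. a b = 0" by (rule ind)
  moreover obtain b where b: "b \<in> B" "x = real_exponent b" using x by blast
  ultimately have "of_int N * f x = 0" using N(2) by (metis of_int_0)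
  then show "f x = 0" using N(1) by simp
qed

text \<open>Steinitz over the rationals: integer independence gives rational independence after
  clearing denominators, and all embedded exponents lie in the span of \<open>card V\<close> unit
  vectors.\<close>

lemma card_independent_le:
  assumes V: "finite V" and B: "finite B" "B \<subseteq> exponents V"
    and ind: "\<And>a. (\<Sum>b\<in>B. frag_cmul (a b) b) = 0 \<Longrightarrow> \<forall>b\<in>B. a b = 0"
  shows "card B \<le> card V"
proof -
  let ?T = "(\<lambda>i. Poly_Mapping.single i (1::real)) ` V"
  have "card (real_exponent ` B) \<le> card ?T"
    using Q.independent_span_bound[of ?T "real_exponent ` B"] V B(2)
      independent_real_exponent[OF B(1) ind] real_exponent_in_span[OF V] by blast
  also have "\<dots> \<le> card V" using V by (rule card_image_le)
  finally show ?thesis by (simp add: card_image inj_on_def)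
qed

definition add_subgroup :: "'a::ab_group_add set \<Rightarrow> bool" where
  "add_subgroup K \<longleftrightarrow> add_closed K \<and> (\<forall>v\<in>K. - v \<in> K)"

lemma add_subgroup_frag_cmul:
  assumes "add_subgroup K" "v \<in> K" shows "frag_cmul c v \<in> K"
proof (cases "c \<ge> 0")
  case True
  then show ?thesis using frag_cmul_closed[of K v "nat c"] assms by (simp add: add_subgroup_def)
next
  case False
  then show ?thesis using frag_cmul_closed[of K v "nat (- c)"] assms unfolding add_subgroup_def
    by (metis int_nat_eq le_cases minus_frag_cmul neg_0_le_iff_le nle_le verit_minus_simplify(4))
qed

lemma add_closed_sum:
  assumes "add_closed K" "\<And>x. x \<in> A \<Longrightarrow> f x \<in> K" shows "sum f A \<in> K"
  using assms(2) by (induction A rule: infinite_finite_induct) (use assms(1) in \<open>auto simp: add_closed_def\<close>)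

text \<open>A maximal rationally independent subset of \<open>K\<close>. It may generate only a
  smaller subgroup, but a positive multiple of each element of \<open>K\<close> lies there, and an
  additive real function is determined by its values on multiples.\<close>

lemma subgroup_basis:
  assumes V: "finite V" and K: "add_subgroup K" "K \<subseteq> exponents V"
  obtains B where "finite B" "B \<subseteq> K" "Q.independent (real_exponent ` B)"
    "\<And>v. v \<in> K \<Longrightarrow> \<exists>N>0. \<exists>a. frag_cmul N v = (\<Sum>b\<in>B. frag_cmul (a b) b)"
proof -
  obtain B' where B': "B' \<subseteq> real_exponent ` K" "Q.independent B'" "real_exponent ` K \<subseteq> Q.span B'"
    by (rule Q.maximal_independent_subset)
  obtain B where B: "B \<subseteq> K" "B' = real_exponent ` B"
    using B'(1) by (metis subset_image_iff)
  have "finite B'"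
    using Q.independent_span_bound[OF finite_imageI[OF V] B'(2)] B'(1) K(2) real_exponent_in_span[OF V] by blast
  then have fin: "finite B" unfolding B(2) by (rule finite_imageD) (simp add: inj_on_def)
  have "\<exists>N>0. \<exists>a. frag_cmul N v = (\<Sum>b\<in>B. frag_cmul (a b) b)" if "v \<in> K" for v
  proof -
    have "real_exponent v \<in> Q.span B'" using that B'(3) by blast
    then obtain u where u: "real_exponent v = (\<Sum>x\<in>B'. real_of_rat (u x) *\<^sub>R x)"
      using Q.span_finite[OF \<open>finite B'\<close>] by auto
    obtain N a where N: "N > 0" "\<forall>b\<in>B. of_int N * u (real_exponent b) = of_int (a b)"
      using common_denominator[OF fin, of "\<lambda>b. u (real_exponent b)"] by metis
    have a: "real_of_int (a b) = real_of_int N * real_of_rat (u (real_exponent b))" if "b \<in> B" for b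
      using N(2) that by (metis of_rat_mult of_rat_of_int_eq)
    have "real_exponent (frag_cmul N v) =
        real_of_int N *\<^sub>R (\<Sum>b\<in>B. real_of_rat (u (real_exponent b)) *\<^sub>R real_exponent b)"
      by (simp add: u B(2) sum.reindex inj_on_def)
    also have "\<dots> = real_exponent (\<Sum>b\<in>B. frag_cmul (a b) b)"
      by (simp add: real_exponent_sum scaleR_sum_right a)
    finally show ?thesis using N(1) by (simp only: real_exponent_inject) blast
  qed
  then show thesis using that fin B B'(2) by blast
qed

lemma additive_frag_cmul:
  assumes "add_subgroup K" and w: "\<And>u v. u \<in> K \<Longrightarrow> v \<in> K \<Longrightarrow> w (u + v) = w u + (w v :: real)"
    and v: "v \<in> K"
  shows "w (frag_cmul c v) = of_int c * w v"
proof -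
  have K: "0 \<in> K" "\<And>v. v \<in> K \<Longrightarrow> - v \<in> K" using assms(1) by (auto simp: add_subgroup_def add_closed_def)
  have w0: "w 0 = 0" using w[OF K(1) K(1)] by simp
  have nat: "w (frag_cmul (int n) v) = real n * w v" for n
    by (induction n) (simp_all add: w0 frag_cmul_distrib w v add_subgroup_frag_cmul[OF assms(1)] algebra_simps)
  have neg: "w (- u) = - w u" if "u \<in> K" for u
    using w[OF that K(2)[OF that]] w0 by simp
  show ?thesis
  proof (cases "c \<ge> 0")
    case True
    then show ?thesis using nat[of "nat c"] by simp
  next
    case False
    then have "frag_cmul c v = - frag_cmul (int (nat (- c))) v" by simp
    then show ?thesis using nat[of "nat (- c)"] neg[of "frag_cmul (int (nat (- c))) v"]
        add_subgroup_frag_cmul[OF assms(1) v] False by simp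
  qed
qed

text \<open>The values on the independent set \<open>B\<close> extend to a rational-linear map. On
  \<open>v\<close> in \<open>K\<close> both functions agree because they agree on the multiple
  \<open>N v\<close>, which is an integer combination of \<open>B\<close>, and \<open>N\<close> can
  be divided out in the reals.\<close>

lemma additive_extension:
  assumes V: "finite V" and K: "add_subgroup K" "K \<subseteq> exponents V"
    and w: "\<And>u v. u \<in> K \<Longrightarrow> v \<in> K \<Longrightarrow> w (u + v) = w u + (w v :: real)"
  obtains \<phi> where "Modules.additive \<phi>" "\<And>v. v \<in> K \<Longrightarrow> \<phi> v = w v"
proof -
  obtain B where B: "finite B" "B \<subseteq> K" "Q.independent (real_exponent ` B)"
    and gen: "\<And>v. v \<in> K \<Longrightarrow> \<exists>N>0. \<exists>a. frag_cmul N v = (\<Sum>b\<in>B. frag_cmul (a b) b)"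
    using subgroup_basis[OF V K] by blast
  obtain g where g: "Vector_Spaces.linear (\<lambda>q p. real_of_rat q *\<^sub>R p) (\<lambda>q r. real_of_rat q * r) g"
    and gB: "\<forall>x\<in>real_exponent ` B. g x = w (inv_into UNIV real_exponent x)"
    using QP.linear_independent_extend[OF B(3), of "\<lambda>x. w (inv_into UNIV real_exponent x)"] by blast
  have gw: "g (real_exponent b) = w b" if "b \<in> B" for b
    using gB that inv_f_f[of real_exponent b] by (metis injI image_eqI real_exponent_inject)
  interpret g: Vector_Spaces.linear "\<lambda>q p. real_of_rat q *\<^sub>R p" "\<lambda>q r. real_of_rat q * r" g by (rule g)
  have add: "Modules.additive (\<lambda>n. g (real_exponent n))"
    by unfold_locales (simp add: g.add)
  have K0: "0 \<in> K" using K(1) by (simp add: add_subgroup_def add_closed_def)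
  have w0: "w 0 = 0" using w[OF K0 K0] by simp
  have wsum: "w (sum f A) = (\<Sum>x\<in>A. w (f x))" if "\<And>x. x \<in> A \<Longrightarrow> f x \<in> K" for f and A :: "(nat \<Rightarrow>\<^sub>0 int) set"
    using that
    by (induction A rule: infinite_finite_induct)
       (use K(1) in \<open>auto simp: w0 w add_closed_sum add_subgroup_def\<close>)
  have "g (real_exponent v) = w v" if v: "v \<in> K" for v
  proof -
    obtain N a where N: "N > 0" "frag_cmul N v = (\<Sum>b\<in>B. frag_cmul (a b) b)" using gen[OF v] by blast
    have gN: "g (real_exponent (frag_cmul c u)) = of_int c * g (real_exponent u)" for c u
      using additive_frag_cmul[of UNIV "\<lambda>n. g (real_exponent n)"] Modules.additive.add[OF add]
      by (simp add: add_subgroup_def add_closed_def)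
    have "of_int N * w v = w (frag_cmul N v)"
      using additive_frag_cmul[OF K(1) w v] by simp
    also have "\<dots> = (\<Sum>b\<in>B. of_int (a b) * w b)"
      unfolding N(2)
      by (subst wsum) (use B(2) K(1) in \<open>auto intro!: sum.cong additive_frag_cmul[OF K(1) w] add_subgroup_frag_cmul\<close>)
    also have "\<dots> = g (real_exponent (\<Sum>b\<in>B. frag_cmul (a b) b))"
      unfolding Modules.additive.sum[OF add] by (intro sum.cong) (simp_all add: gN gw del: real_exponent_simps)
    also have "\<dots> = of_int N * g (real_exponent v)"
      unfolding N(2)[symmetric] by (rule gN)
    finally show ?thesis using N(1) by simp
  qed
  then show thesis using that[OF add] by blast
qed

section \<open>Total preorders of the exponent group are lexicographic\<close>

lemma add_subgroup_diff: "add_subgroup K \<Longrightarrow> u \<in> K \<Longrightarrow> v \<in> K \<Longrightarrow> u - v \<in> K"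
  unfolding add_subgroup_def add_closed_def by (metis add_uminus_conv_diff)

text \<open>Hoelder: an ordered group in which \<open>e > 0\<close> dominates every element maps to the reals;
  the value at \<open>v\<close> is the supremum of the fractions \<open>p / q\<close> with \<open>p e \<le> q v\<close>.\<close>

lemma hoelder_functional:
  assumes K: "add_subgroup K" and C: "add_closed C" and tot: "\<And>v. v \<in> K \<Longrightarrow> v \<in> C \<or> - v \<in> C"
    and e: "e \<in> K" "- e \<notin> C"
    and arch: "\<And>v. v \<in> K \<Longrightarrow> \<exists>N. frag_cmul N e - v \<in> C"
  obtains w where "\<And>u v. u \<in> K \<Longrightarrow> v \<in> K \<Longrightarrow> w (u + v) = w u + (w v :: real)"
    "\<And>v. v \<in> K \<Longrightarrow> v \<in> C \<Longrightarrow> w v \<ge> 0" "w e = 1"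
proof -
  have mul: "frag_cmul c v \<in> C" if "c \<ge> 0" "v \<in> C" for c v
    using frag_cmul_closed[OF C that(2), of "nat c"] that(1) by simp
  have plus: "u + v \<in> C" if "u \<in> C" "v \<in> C" for u v using C that by (simp add: add_closed_def)
  have C0: "0 \<in> C" using C by (simp add: add_closed_def)
  have eC: "e \<in> C" using e tot by blast
  have K0: "0 \<in> K" and Kneg: "\<And>v. v \<in> K \<Longrightarrow> - v \<in> K" and Kadd: "\<And>u v. u \<in> K \<Longrightarrow> v \<in> K \<Longrightarrow> u + v \<in> K"
    using K by (auto simp: add_subgroup_def add_closed_def)
  note Kmul = add_subgroup_frag_cmul[OF K]
  have e_pos: "c \<ge> 0" if "frag_cmul c e \<in> C" for c
  proof (rule ccontr)
    assume "\<not> c \<ge> 0"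
    then have "frag_cmul (- c - 1) e \<in> C" using eC by (intro mul) auto
    from plus[OF that this] have "- e \<in> C" by (simp add: frag_cmul_distrib[symmetric])
    then show False using e by simp
  qed
  define D where "D v = {r. \<exists>p q. q > 0 \<and> r = real_of_int p / of_int q \<and>
    frag_cmul q v - frag_cmul p e \<in> C}" for v
  \<comment> \<open>Scaling the lower comparison by \<open>q'\<close> and the upper one by
    \<open>q\<close> eliminates \<open>v\<close>; what remains is a multiple of \<open>e\<close> in
    \<open>C\<close>, whose coefficient is non-negative by \<open>e_pos\<close>.\<close>
  have upper: "r \<le> of_int p' / of_int q'"
    if r: "r \<in> D v" and q': "q' > 0" and p': "frag_cmul p' e - frag_cmul q' v \<in> C" for r p' q' v
  proof -
    obtain p q where pq: "q > 0" "r = of_int p / of_int q" "frag_cmul q v - frag_cmul p e \<in> C"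
      using r unfolding D_def by blast
    have "frag_cmul q' (frag_cmul q v - frag_cmul p e) + frag_cmul q (frag_cmul p' e - frag_cmul q' v) \<in> C"
      using pq p' q' by (intro plus mul) auto
    moreover have "frag_cmul q' (frag_cmul q v - frag_cmul p e) + frag_cmul q (frag_cmul p' e - frag_cmul q' v) =
        frag_cmul (q * p' - q' * p) e"
      by (rule poly_mapping_eqI) (simp add: lookup_add lookup_minus algebra_simps)
    ultimately have "q' * p \<le> q * p'" using e_pos by force
    then have "real_of_int (q' * p) \<le> real_of_int (q * p')" by (simp only: of_int_le_iff)
    then show ?thesis unfolding pq(2) using pq(1) q' by (simp add: field_simps)
  qed
  have bdd: "bdd_above (D v)" if v: "v \<in> K" for v
  proof -
    obtain N where "frag_cmul N e - v \<in> C" using arch[OF v] by blast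
    then have "\<forall>r\<in>D v. r \<le> of_int N / of_int 1"
      using upper[of _ v 1 N] by auto
    then show ?thesis by (auto simp: bdd_above_def)
  qed
  have ne: "D v \<noteq> {}" if v: "v \<in> K" for v
  proof -
    obtain N where "frag_cmul N e - - v \<in> C" using arch[OF Kneg[OF v]] by blast
    moreover have "frag_cmul N e - - v = frag_cmul 1 v - frag_cmul (- N) e"
      by (rule poly_mapping_eqI) (simp add: lookup_add lookup_minus)
    ultimately have "frag_cmul 1 v - frag_cmul (- N) e \<in> C" by metis
    then have "real_of_int (- N) / of_int 1 \<in> D v"
      unfolding D_def by (intro CollectI exI[of _ "- N"] exI[of _ 1]) simp
    then show ?thesis by blast
  qed
  define w where "w v = Sup (D v)" for v
  have w_ge: "of_int p / of_int q \<le> w v" if "v \<in> K" "q > 0" "frag_cmul q v - frag_cmul p e \<in> C" for p q v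
    unfolding w_def using that by (intro cSup_upper bdd) (auto simp: D_def)
  have w_le: "w v \<le> of_int p / of_int q" if "v \<in> K" "q > 0" "frag_cmul p e - frag_cmul q v \<in> C" for p q v
    unfolding w_def using that upper by (intro cSup_least ne) auto
  have super: "w u + w v \<le> w (u + v)" if u: "u \<in> K" and v: "v \<in> K" for u v
  proof -
    have "r + s \<le> w (u + v)" if r: "r \<in> D u" and s: "s \<in> D v" for r s
    proof -
      obtain p q where pq: "q > 0" "r = of_int p / of_int q" "frag_cmul q u - frag_cmul p e \<in> C"
        using r unfolding D_def by blast
      obtain p' q' where pq': "q' > 0" "s = of_int p' / of_int q'" "frag_cmul q' v - frag_cmul p' e \<in> C"
        using s unfolding D_def by blast
      have "frag_cmul q' (frag_cmul q u - frag_cmul p e) + frag_cmul q (frag_cmul q' v - frag_cmul p' e) \<in> C"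
        using pq pq' by (intro plus mul) auto
      moreover have "frag_cmul q' (frag_cmul q u - frag_cmul p e) + frag_cmul q (frag_cmul q' v - frag_cmul p' e) =
          frag_cmul (q * q') (u + v) - frag_cmul (p * q' + p' * q) e"
        by (rule poly_mapping_eqI) (simp add: lookup_add lookup_minus algebra_simps)
      ultimately have "of_int (p * q' + p' * q) / of_int (q * q') \<le> w (u + v)"
        using pq pq' by (intro w_ge Kadd u v) auto
      then show ?thesis unfolding pq(2) pq'(2) using pq(1) pq'(1) by (simp add: field_simps)
    qed
    then have "r \<le> w (u + v) - w v" if "r \<in> D u" for r
      using that cSup_least[OF ne[OF v], of "w (u + v) - r"] unfolding w_def by (fastforce simp: algebra_simps)
    then show ?thesis
      using cSup_least[OF ne[OF u], of "w (u + v) - w v"] unfolding w_def by (fastforce simp: algebra_simps)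
  qed
  have "w 0 \<le> 0" using w_le[OF K0, of 1 0] C0 by simp
  \<comment> \<open>Suprema of lower fractions give only superadditivity. Totality supplies the
    reverse: a rational \<open>p / q\<close> strictly between \<open>w v\<close> and
    \<open>- w (- v)\<close> is no lower fraction of \<open>v\<close>, so \<open>- p / q\<close> is
    one of \<open>- v\<close>, a contradiction. Oddness and superadditivity together yield
    additivity.\<close>
  have neg: "w (- v) = - w v" if v: "v \<in> K" for v
  proof (rule ccontr)
    assume "w (- v) \<noteq> - w v"
    moreover have "w v + w (- v) \<le> 0" using super[OF v Kneg[OF v]] \<open>w 0 \<le> 0\<close> by simp
    ultimately have "w v < - w (- v)" by simp
    then obtain r where r: "r \<in> \<rat>" "w v < r" "r < - w (- v)"
      using Rats_dense_in_real by blast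
    obtain p q where pq: "q > 0" "r = of_int p / of_int q"
      using r(1) by (auto elim!: Rats_cases')
    have vK: "frag_cmul q v - frag_cmul p e \<in> K" using v e K by (intro add_subgroup_diff Kmul)
    have "frag_cmul q v - frag_cmul p e \<notin> C"
      using w_ge[OF v pq(1)] r pq by fastforce
    then have "- (frag_cmul q v - frag_cmul p e) \<in> C" using tot[OF vK] by blast
    moreover have "- (frag_cmul q v - frag_cmul p e) = frag_cmul q (- v) - frag_cmul (- p) e"
      by (rule poly_mapping_eqI) (simp add: lookup_minus)
    ultimately have "frag_cmul q (- v) - frag_cmul (- p) e \<in> C" by metis
    then have "of_int (- p) / of_int q \<le> w (- v)" using pq by (intro w_ge Kneg v)
    then show False using r pq by simp
  qed
  show thesis
  proof (rule that)
    fix u v assume uv: "u \<in> K" "v \<in> K"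
    have "w (u + v) + w (- v) \<le> w u" using super[OF Kadd[OF uv] Kneg[OF uv(2)]] by simp
    then show "w (u + v) = w u + w v" using super[OF uv] neg[OF uv(2)] by simp
  next
    fix v assume "v \<in> K" "v \<in> C"
    then show "w v \<ge> 0" using w_ge[of v 1 0] by simp
  next
    have "1 \<le> w e" using w_ge[OF e(1), of 1 1] C0 by simp
    moreover have "w e \<le> 1" using w_le[OF e(1), of 1 1] C0 by simp
    ultimately show "w e = 1" by simp
  qed
qed

text \<open>The domain is left polymorphic because the same notion is applied to exponents and, with
  extended functionals, to real points.\<close>

definition lex_pos :: "nat \<Rightarrow> (nat \<Rightarrow> 'a \<Rightarrow> real) \<Rightarrow> 'a \<Rightarrow> bool" where
  "lex_pos r \<phi> v \<longleftrightarrow> (\<exists>i<r. \<phi> i v > 0 \<and> (\<forall>j<i. \<phi> j v = 0))"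

definition lex_ge0 :: "nat \<Rightarrow> (nat \<Rightarrow> 'a \<Rightarrow> real) \<Rightarrow> 'a \<Rightarrow> bool" where
  "lex_ge0 r \<phi> v \<longleftrightarrow> (\<forall>i<r. \<phi> i v = 0) \<or> lex_pos r \<phi> v"

lemma lex_trichotomy:
  assumes "\<And>i. i < r \<Longrightarrow> \<phi> i (- v) = - \<phi> i v"
  shows "(\<forall>i<r. \<phi> i v = 0) \<or> lex_pos r \<phi> v \<or> lex_pos r \<phi> (- v)"
proof (rule ccontr)
  assume n: "\<not> ?thesis"
  then obtain i0 where i0: "i0 < r \<and> \<phi> i0 v \<noteq> 0" by blast
  define i where "i = (LEAST i. i < r \<and> \<phi> i v \<noteq> 0)"
  have i: "i < r \<and> \<phi> i v \<noteq> 0" unfolding i_def using i0 by (rule LeastI)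
  moreover have "\<forall>j<i. \<phi> j v = 0" using not_less_Least i unfolding i_def by fastforce
  moreover from this have "\<forall>j<i. \<phi> j (- v) = 0" using assms i by simp
  moreover have "\<phi> i (- v) > 0" if "\<not> \<phi> i v > 0" using that assms[of i] i by simp
  ultimately have "lex_pos r \<phi> v \<or> lex_pos r \<phi> (- v)"
    unfolding lex_pos_def by blast
  then show False using n by blast
qed

lemma lex_pos_add:
  assumes add: "\<And>i. i < r \<Longrightarrow> \<phi> i (u + v) = \<phi> i u + \<phi> i v" and "lex_pos r \<phi> u" "lex_pos r \<phi> v"
  shows "lex_pos r \<phi> (u + v)"
proof -
  obtain i j where i: "i < r" "\<phi> i u > 0" "\<forall>l<i. \<phi> l u = 0" and j: "j < r" "\<phi> j v > 0" "\<forall>l<j. \<phi> l v = 0"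
    using assms by (auto simp: lex_pos_def)
  have "\<phi> (min i j) (u + v) > 0"
    using i j add by (cases i j rule: linorder_cases) (simp_all add: add_pos_pos)
  moreover have "\<forall>l<min i j. \<phi> l (u + v) = 0" using i j add by simp
  moreover have "min i j < r" using i by simp
  ultimately show ?thesis by (auto simp: lex_pos_def)
qed

text \<open>An initial segment of rows. The last condition says that what these rows decide strictly
  is decided the same way by \<open>C\<close>; elements annihilated by all rows are still
  open.\<close>

definition lex_coarsening :: "nat set \<Rightarrow> (nat \<Rightarrow>\<^sub>0 int) set \<Rightarrow> nat \<Rightarrow> (nat \<Rightarrow> (nat \<Rightarrow>\<^sub>0 int) \<Rightarrow> real) \<Rightarrow> bool" where
  "lex_coarsening V C r \<phi> \<longleftrightarrow> (\<forall>i<r. Modules.additive (\<phi> i)) \<and>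
     (\<forall>i<r. \<exists>n\<in>exponents V. \<phi> i n \<noteq> 0 \<and> (\<forall>j<i. \<phi> j n = 0)) \<and>
     (\<forall>v\<in>exponents V. lex_pos r \<phi> v \<longrightarrow> - v \<notin> C)"

lemma additive_frag_cmul_UNIV:
  "Modules.additive \<phi> \<Longrightarrow> \<phi> (frag_cmul c v) = of_int c * (\<phi> v :: real)"
  using additive_frag_cmul[of UNIV \<phi>] Modules.additive.add[of \<phi>]
  by (simp add: add_subgroup_def add_closed_def)

text \<open>Witnesses for the irredundancy of the rows form a triangular system.\<close>

lemma lex_coarsening_le_card:
  assumes V: "finite V" and lc: "lex_coarsening V C r \<phi>"
  shows "r \<le> card V"
proof -
  have add: "Modules.additive (\<phi> i)" if "i < r" for i using lc that by (simp add: lex_coarsening_def)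
  obtain n where n: "\<And>i. i < r \<Longrightarrow> n i \<in> exponents V" "\<And>i. i < r \<Longrightarrow> \<phi> i (n i) \<noteq> 0"
    "\<And>i j. i < r \<Longrightarrow> j < i \<Longrightarrow> \<phi> j (n i) = 0"
    using lc unfolding lex_coarsening_def by metis
  have inj: "inj_on n {..<r}"
    by (rule inj_onI) (metis n(2,3) lessThan_iff linorder_neqE_nat)
  have "card (n ` {..<r}) \<le> card V"
  proof (rule card_independent_le[OF V])
    fix a assume "(\<Sum>b\<in>n ` {..<r}. frag_cmul (a b) b) = 0"
    then have 0: "(\<Sum>i<r. frag_cmul (a (n i)) (n i)) = 0" by (simp add: sum.reindex[OF inj])
    have "i < r \<Longrightarrow> a (n i) = 0" for i
    proof (induction i rule: less_induct)
      case (less i)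
      \<comment> \<open>The functional \<phi> i kills the witnesses with larger index, and the
        coefficients with smaller index vanish by the induction hypothesis.\<close>
      have "0 = \<phi> i (\<Sum>l<r. frag_cmul (a (n l)) (n l))"
        using add[OF less(2)] 0 by (simp add: Modules.additive.zero)
      also have "\<dots> = (\<Sum>l<r. of_int (a (n l)) * \<phi> i (n l))"
        using add[OF less(2)] by (simp add: Modules.additive.sum additive_frag_cmul_UNIV)
      also have "\<dots> = (\<Sum>l<r. if l = i then of_int (a (n i)) * \<phi> i (n i) else 0)"
        using less n(3) by (intro sum.cong refl) (auto, metis linorder_neqE_nat)
      also have "\<dots> = of_int (a (n i)) * \<phi> i (n i)" using less(2) by simp
      finally show ?case using n(2)[OF less(2)] by simp
    qed
    then show "\<forall>b\<in>n ` {..<r}. a b = 0" by auto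
  qed (use n in auto)
  then show ?thesis by (simp add: card_image[OF inj])
qed

text \<open>The vector \<open>v0\<close> is strictly positive but undecided by the given rows. On
  their common kernel \<open>K\<close> there is an element \<open>e\<close> with multiples above
  everything, so Hoelder's map exists; extended from \<open>K\<close> to all exponents it is the
  next row, and \<open>e\<close> witnesses its irredundancy.\<close>

lemma lex_coarsening_extend:
  assumes V: "finite V" and C: "total_cone V C" and lc: "lex_coarsening V C r \<phi>"
    and v0: "v0 \<in> exponents V" "\<forall>i<r. \<phi> i v0 = 0" "v0 \<in> C" "- v0 \<notin> C"
  shows "\<exists>\<phi>'. lex_coarsening V C (Suc r) \<phi>'"
proof -
  have add: "Modules.additive (\<phi> i)" if "i < r" for i using lc that by (simp add: lex_coarsening_def)
  define K where "K = {v \<in> exponents V. \<forall>i<r. \<phi> i v = 0}"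
  have K: "add_subgroup K" "K \<subseteq> exponents V"
    using add by (auto simp: K_def add_subgroup_def add_closed_def exponents_closed Modules.additive.zero
        Modules.additive.add Modules.additive.minus)
  have plus: "u + v \<in> C" if "u \<in> C" "v \<in> C" for u v
    using total_coneD(1)[OF C] that by (simp add: add_closed_def)
  have mul: "frag_cmul c v \<in> C" if "c \<ge> 0" "v \<in> C" for c v
    using frag_cmul_closed[OF total_coneD(1)[OF C] that(2), of "nat c"] that(1) by simp
  have C0: "0 \<in> C" using total_coneD(1)[OF C] by (simp add: add_closed_def)
  obtain B where B: "finite B" "B \<subseteq> K" "Q.independent (real_exponent ` B)"
    and gen: "\<And>v. v \<in> K \<Longrightarrow> \<exists>N>0. \<exists>a. frag_cmul N v = (\<Sum>b\<in>B. frag_cmul (a b) b)"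
    using subgroup_basis[OF V K] by blast
  define ab where "ab b = (if b \<in> C then b else - b)" for b
  have ab: "ab b \<in> C" "ab b \<in> K" if "b \<in> B" for b
    using that B(2) K total_coneD(3)[OF C, of b] by (auto simp: ab_def add_subgroup_def)
  \<comment> \<open>The sum of the absolute values of the basis dominates each \<open>ab b\<close>,
    hence every integer combination of the basis after multiplication by the sum of the absolute
    coefficients.\<close>
  define e where "e = (\<Sum>b\<in>B. ab b)"
  have e: "e \<in> K" "e \<in> C"
    unfolding e_def using ab K(1) total_coneD(1)[OF C]
    by (auto intro!: add_closed_sum simp: add_subgroup_def)
  have e_ge: "e - ab b \<in> C" if "b \<in> B" for b
  proof -
    have "e - ab b = sum ab (B - {b})" using B(1) that by (simp add: e_def sum_diff1)
    then show ?thesis using ab total_coneD(1)[OF C] by (auto intro!: add_closed_sum)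
  qed
  have arch: "\<exists>N\<ge>0. frag_cmul N e - v \<in> C" if v: "v \<in> K" for v
  proof (cases "v \<in> C")
    case False
    then have "- v \<in> C" using v K(2) total_coneD(3)[OF C] by blast
    then show ?thesis by (intro exI[of _ 0]) simp
  next
    case True
    obtain N a where N: "N > 0" "frag_cmul N v = (\<Sum>b\<in>B. frag_cmul (a b) b)" using gen[OF v] by blast
    have summand: "frag_cmul \<bar>a b\<bar> e - frag_cmul (a b) b \<in> C" if b: "b \<in> B" for b
    proof -
      have "frag_cmul \<bar>a b\<bar> (ab b) - frag_cmul (a b) b \<in> C"
      proof -
        have "frag_cmul \<bar>a b\<bar> (ab b) - frag_cmul (a b) b =
          frag_cmul (if b \<in> C then \<bar>a b\<bar> - a b else \<bar>a b\<bar> + a b) (ab b)"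
          by (rule poly_mapping_eqI) (simp add: ab_def lookup_minus algebra_simps)
        also have "\<dots> \<in> C" by (rule mul) (use ab[OF b] in auto)
        finally show ?thesis .
      qed
      moreover have "frag_cmul \<bar>a b\<bar> (e - ab b) \<in> C" using e_ge[OF b] by (intro mul) auto
      ultimately have "(frag_cmul \<bar>a b\<bar> (ab b) - frag_cmul (a b) b) + frag_cmul \<bar>a b\<bar> (e - ab b) \<in> C"
        by (rule plus)
      moreover have "(frag_cmul \<bar>a b\<bar> (ab b) - frag_cmul (a b) b) + frag_cmul \<bar>a b\<bar> (e - ab b) =
          frag_cmul \<bar>a b\<bar> e - frag_cmul (a b) b"
        by (rule poly_mapping_eqI) (simp add: lookup_add lookup_minus algebra_simps)
      ultimately show ?thesis by simp
    qed
    let ?M = "\<Sum>b\<in>B. \<bar>a b\<bar>"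
    have "(\<Sum>b\<in>B. frag_cmul \<bar>a b\<bar> e - frag_cmul (a b) b) \<in> C"
      using summand total_coneD(1)[OF C] by (intro add_closed_sum)
    moreover have "(\<Sum>b\<in>B. frag_cmul \<bar>a b\<bar> e - frag_cmul (a b) b) = frag_cmul ?M e - frag_cmul N v"
    proof -
      have "(\<Sum>b\<in>B. frag_cmul (f b) e) = frag_cmul (\<Sum>b\<in>B. f b) e" for f
        by (induction B rule: infinite_finite_induct) (auto simp: frag_cmul_distrib)
      then show ?thesis by (simp add: sum_subtractf N(2))
    qed
    \<comment> \<open>Only \<open>N v\<close> is a combination of the basis; as \<open>v\<close> is
      non-negative, so is \<open>(N - 1) v\<close>, and a bound for \<open>N v\<close> is also one
      for \<open>v\<close>.\<close>
    moreover have "frag_cmul (N - 1) v \<in> C" using True N(1) by (intro mul) auto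
    ultimately have "(frag_cmul ?M e - frag_cmul N v) + frag_cmul (N - 1) v \<in> C" using plus by auto
    moreover have "(frag_cmul ?M e - frag_cmul N v) + frag_cmul (N - 1) v = frag_cmul ?M e - v"
      by (rule poly_mapping_eqI) (simp add: lookup_add lookup_minus algebra_simps)
    ultimately show ?thesis by (intro exI[of _ ?M]) (auto intro: sum_nonneg)
  qed
  \<comment> \<open>Otherwise all multiples of \<open>e\<close> with non-negative coefficient would
    be at most 0, and with them all of \<open>K\<close>, against the choice of
    \<open>v0\<close>.\<close>
  have e_neg: "- e \<notin> C"
  proof
    assume me: "- e \<in> C"
    have "- v0 \<in> K" using v0 K(1) by (auto simp: K_def add_subgroup_def)
    have "v0 \<in> K" using v0 by (simp add: K_def)
    then obtain N where N: "N \<ge> 0" "frag_cmul N e - v0 \<in> C" using arch by blast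
    then have "(frag_cmul N e - v0) + frag_cmul N (- e) \<in> C" using me by (intro plus mul)
    moreover have "(frag_cmul N e - v0) + frag_cmul N (- e) = - v0"
      by (rule poly_mapping_eqI) (simp add: lookup_add lookup_minus)
    ultimately show False using v0 by simp
  qed
  have tot': "v \<in> C \<or> - v \<in> C" if "v \<in> K" for v
    using that K(2) total_coneD(3)[OF C] by blast
  have arch': "\<exists>N. frag_cmul N e - v \<in> C" if "v \<in> K" for v using arch[OF that] by blast
  obtain w where w: "\<And>u v. u \<in> K \<Longrightarrow> v \<in> K \<Longrightarrow> w (u + v) = w u + (w v :: real)"
    "\<And>v. v \<in> K \<Longrightarrow> v \<in> C \<Longrightarrow> w v \<ge> 0" "w e = 1"
    using hoelder_functional[OF K(1) total_coneD(1)[OF C] tot' e(1) e_neg arch'] by blast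
  obtain \<psi> where \<psi>: "Modules.additive \<psi>" "\<And>v. v \<in> K \<Longrightarrow> \<psi> v = w v"
    using additive_extension[OF V K w(1)] by metis
  define \<phi>' where "\<phi>' = \<phi>(r := \<psi>)"
  have "lex_coarsening V C (Suc r) \<phi>'"
    unfolding lex_coarsening_def
  proof (intro conjI allI impI ballI)
    fix i assume i: "i < Suc r"
    show "Modules.additive (\<phi>' i)" using i add \<psi>(1) by (auto simp: \<phi>'_def less_Suc_eq)
    show "\<exists>n\<in>exponents V. \<phi>' i n \<noteq> 0 \<and> (\<forall>j<i. \<phi>' j n = 0)"
    proof (cases "i = r")
      case True
      then show ?thesis using e(1) \<psi>(2)[OF e(1)] w(3) by (intro bexI[of _ e]) (auto simp: \<phi>'_def K_def)
    next
      case False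
      then show ?thesis using i lc by (auto simp: \<phi>'_def lex_coarsening_def less_Suc_eq)
    qed
  next
    fix v assume v: "v \<in> exponents V" "lex_pos (Suc r) \<phi>' v"
    then obtain i where i: "i < Suc r" "\<phi>' i v > 0" "\<forall>j<i. \<phi>' j v = 0" by (auto simp: lex_pos_def)
    show "- v \<notin> C"
    proof (cases "i = r")
      case True
      then have "v \<in> K" using v i by (auto simp: K_def \<phi>'_def)
      then have mv: "- v \<in> K" using K(1) by (simp add: add_subgroup_def)
      have "w (- v) = - \<psi> v" using \<psi>(2)[OF mv] Modules.additive.minus[OF \<psi>(1)] by simp
      moreover have "\<psi> v > 0" using i True by (simp add: \<phi>'_def)
      ultimately show ?thesis using w(2)[OF mv] by auto
    next
      case False
      then have "lex_pos r \<phi> v" using i by (auto simp: lex_pos_def \<phi>'_def intro!: exI[of _ i])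
      then show ?thesis using lc v by (auto simp: lex_coarsening_def)
    qed
  qed
  then show ?thesis by blast
qed

text \<open>A coarsening of maximal length exists since the lengths are bounded and the empty one
  qualifies. By maximality no strictly positive element is left in the common kernel, so the whole
  kernel is equivalent to 0 and the rows decide everything else.\<close>

theorem total_cone_lexicographic:
  assumes V: "finite V" and C: "total_cone V C"
  obtains r \<phi> where "\<And>i. i < r \<Longrightarrow> Modules.additive (\<phi> i)"
    "\<And>i. i < r \<Longrightarrow> \<exists>n\<in>exponents V. \<phi> i n \<noteq> 0 \<and> (\<forall>j<i. \<phi> j n = 0)"
    "C = {v \<in> exponents V. lex_ge0 r \<phi> v}"
proof -
  let ?R = "{r. \<exists>\<phi>. lex_coarsening V C r \<phi>}"
  have "?R \<subseteq> {..card V}" using lex_coarsening_le_card[OF V] by auto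
  then have fin: "finite ?R" by (rule finite_subset) simp
  have "0 \<in> ?R" by (auto simp: lex_coarsening_def lex_pos_def)
  then have "Max ?R \<in> ?R" using fin by (intro Max_in) auto
  then obtain \<phi> where lc: "lex_coarsening V C (Max ?R) \<phi>" by blast
  define r where "r = Max ?R"
  have lc: "lex_coarsening V C r \<phi>" using lc by (simp add: r_def)
  have add: "Modules.additive (\<phi> i)" if "i < r" for i using lc that by (simp add: lex_coarsening_def)
  have no_ext: "- v \<in> C" if "v \<in> exponents V" "\<forall>i<r. \<phi> i v = 0" "v \<in> C" for v
  proof (rule ccontr)
    assume "- v \<notin> C"
    then have "Suc r \<in> ?R" using lex_coarsening_extend[OF V C lc that] by blast
    then have "Suc r \<le> r" unfolding r_def by (rule Max_ge[OF fin])
    then show False by simp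
  qed
  have kernel: "v \<in> C" if "v \<in> exponents V" "\<forall>i<r. \<phi> i v = 0" for v
  proof (rule ccontr)
    assume "v \<notin> C"
    then have "- v \<in> C" using total_coneD(3)[OF C that(1)] by blast
    moreover have "\<forall>i<r. \<phi> i (- v) = 0" using that(2) add by (simp add: Modules.additive.minus)
    ultimately have "- (- v) \<in> C" using no_ext[OF exponents_closed(3)[OF that(1)]] by blast
    then show False using \<open>v \<notin> C\<close> by simp
  qed
  have pos: "v \<in> C" "- v \<notin> C" if "v \<in> exponents V" "lex_pos r \<phi> v" for v
    using that lc total_coneD(3)[OF C that(1)] by (auto simp: lex_coarsening_def)
  have "C = {v \<in> exponents V. lex_ge0 r \<phi> v}"
  proof (intro equalityI subsetI CollectI conjI)
    fix v assume v: "v \<in> C"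
    then show vV: "v \<in> exponents V" using total_coneD(2)[OF C] by blast
    have "\<not> lex_pos r \<phi> (- v)" using pos(2)[of "- v"] v vV exponents_closed by auto
    then show "lex_ge0 r \<phi> v"
      using lex_trichotomy[of r \<phi> v] add by (auto simp: lex_ge0_def Modules.additive.minus)
  qed (use kernel pos in \<open>auto simp: lex_ge0_def\<close>)
  moreover have "\<exists>n\<in>exponents V. \<phi> i n \<noteq> 0 \<and> (\<forall>j<i. \<phi> j n = 0)" if "i < r" for i
    using lc that by (simp add: lex_coarsening_def)
  ultimately show thesis using that[of r \<phi>] add by blast
qed

section \<open>Matrices of prime congruences\<close>

lemma additive_eq_sum_single:
  assumes V: "finite V" and add: "Modules.additive (\<phi> :: _ \<Rightarrow> real)" and n: "n \<in> exponents V"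
  shows "\<phi> n = (\<Sum>x\<in>V. real_of_int (Poly_Mapping.lookup n x) * \<phi> (Poly_Mapping.single x 1))"
proof -
  have "n = (\<Sum>x\<in>V. frag_cmul (Poly_Mapping.lookup n x) (Poly_Mapping.single x 1))"
    by (rule poly_mapping_eqI)
       (use n V in \<open>auto simp: lookup_sum lookup_single when_def mem_exponents if_distrib cong: if_cong\<close>)
  then have "\<phi> n = \<phi> (\<Sum>x\<in>V. frag_cmul (Poly_Mapping.lookup n x) (Poly_Mapping.single x 1))" by simp
  also have "\<dots> = (\<Sum>x\<in>V. real_of_int (Poly_Mapping.lookup n x) * \<phi> (Poly_Mapping.single x 1))"
    by (simp add: Modules.additive.sum[OF add] additive_frag_cmul_UNIV[OF add])
  finally show ?thesis .
qed

lemma total_cone_matrix: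
  assumes V: "finite V" and C: "total_cone V C"
  obtains U where "admissible U" "dim_col U = card V" "matrix_cone V U = C"
proof -
  obtain r \<phi> where add: "\<And>i. i < r \<Longrightarrow> Modules.additive (\<phi> i)"
    and irr: "\<And>i. i < r \<Longrightarrow> \<exists>n\<in>exponents V. \<phi> i n \<noteq> 0 \<and> (\<forall>j<i. \<phi> j n = 0)"
    and C_eq: "C = {v \<in> exponents V. lex_ge0 r \<phi> v}"
    by (rule total_cone_lexicographic[OF V C]) blast
  define L where "L = sorted_list_of_set V"
  \<comment> \<open>An additive function is determined by its values on the unit exponents; listing
    them in the sorted order of \<open>V\<close> makes entry \<open>i\<close> of the product equal
    to the value of \<phi> i.\<close>
  define U where "U = Matrix.mat r (card V) (\<lambda>(i, j). \<phi> i (Poly_Mapping.single (L ! j) 1))"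
  have dim: "dim_vec (U *\<^sub>v x) = r" for x by (simp add: U_def)
  have entry: "vec_index (U *\<^sub>v exponent_vec V n) i = \<phi> i n" if n: "n \<in> exponents V" and i: "i < r" for n i
  proof -
    have "vec_index (U *\<^sub>v exponent_vec V n) i =
        (\<Sum>j\<in>{..<card V}. \<phi> i (Poly_Mapping.single (L ! j) 1) * real_of_int (Poly_Mapping.lookup n (L ! j)))"
      using i by (simp add: U_def exponent_vec_def scalar_prod_def L_def lessThan_atLeast0)
    also have "\<dots> = (\<Sum>x\<in>V. \<phi> i (Poly_Mapping.single x 1) * real_of_int (Poly_Mapping.lookup n x))"
      by (rule sum.reindex_bij_betw, rule bij_betw_nth) (use V in \<open>auto simp: L_def\<close>)
    also have "\<dots> = \<phi> i n"
      using additive_eq_sum_single[OF V add[OF i] n] by (simp add: mult.commute)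
    finally show ?thesis .
  qed
  have first: "first_nonzero_at (U *\<^sub>v exponent_vec V n) i \<longleftrightarrow> i < r \<and> \<phi> i n \<noteq> 0 \<and> (\<forall>j<i. \<phi> j n = 0)"
    if n: "n \<in> exponents V" for n i
    unfolding first_nonzero_at_def dim using entry[OF n] by auto
  have lex: "lex_nonneg (U *\<^sub>v exponent_vec V n) \<longleftrightarrow> lex_ge0 r \<phi> n" if n: "n \<in> exponents V" for n
  proof -
    have "U *\<^sub>v exponent_vec V n = 0\<^sub>v (dim_vec (U *\<^sub>v exponent_vec V n)) \<longleftrightarrow> (\<forall>i<r. \<phi> i n = 0)"
      using entry[OF n] unfolding Matrix.vec_eq_iff dim by simp
    moreover have "(\<exists>i. first_nonzero_at (U *\<^sub>v exponent_vec V n) i \<and> vec_index (U *\<^sub>v exponent_vec V n) i > 0) \<longleftrightarrow>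
        lex_pos r \<phi> n"
      unfolding first[OF n] lex_pos_def
      by (intro arg_cong[where f = Ex] ext) (auto simp: entry[OF n])
    ultimately show ?thesis unfolding lex_nonneg_def lex_ge0_def by simp
  qed
  have "admissible U"
    unfolding admissible_def
  proof (intro allI impI)
    fix i assume "i < dim_row U"
    then have i: "i < r" by (simp add: U_def)
    obtain n where n: "n \<in> exponents V" "\<phi> i n \<noteq> 0" "\<forall>j<i. \<phi> j n = 0" using irr[OF i] by blast
    let ?n = "Matrix.vec (card V) (\<lambda>j. Poly_Mapping.lookup n (L ! j))"
    have ev: "map_vec real_of_int ?n = exponent_vec V n"
      by (auto simp: exponent_vec_def L_def)
    have "first_nonzero_at (U *\<^sub>v map_vec real_of_int ?n) i"
      unfolding ev first[OF n(1)] using n i by blast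
    moreover have "?n \<in> carrier_vec (dim_col U)" by (simp add: U_def)
    ultimately show "\<exists>n :: int Matrix.vec. n \<in> carrier_vec (dim_col U) \<and>
        first_nonzero_at (U *\<^sub>v map_vec real_of_int n) i"
      by blast
  qed
  moreover have "dim_col U = card V" by (simp add: U_def)
  moreover have "matrix_cone V U = C"
    unfolding matrix_cone_def C_eq using lex by blast
  ultimately show thesis by (rule that)
qed

lemma prime_is_generated:
  assumes V: "finite V" and P: "prime_congruence (poly_semiring V) P"
  shows "\<exists>H U. H \<subseteq> V \<and> admissible U \<and> dim_col U = card (V - H) \<and>
    prime_congruence (poly_semiring (V - H)) (poly_prime (V - H) U) \<and>
    P = generated_congruence (poly_semiring V) ({(variable i, 0) | i. i \<in> H} \<union> poly_prime (V - H) U)"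
proof -
  obtain H C where H: "H \<subseteq> V" and C: "total_cone (V - H) C"
    and P_eq: "P = cone_congruence (nonneg_exponents V) (nonneg_exponents (V - H)) C"
    using prime_poly_semiring[OF P] by blast
  have "finite (V - H)" using V by simp
  then obtain U where U: "admissible U" "dim_col U = card (V - H)" "matrix_cone (V - H) U = C"
    using total_cone_matrix[OF _ C] by blast
  have PU: "poly_prime (V - H) U = order_congruence (V - H) C"
    using poly_prime_eq[of "V - H" U] total_coneD(1)[OF C] by (simp add: U)
  show ?thesis
    using H U prime_order_congruence[OF C] generated_cone_congruence[OF H total_coneD(1)[OF C]]
    by (intro exI[of _ H] exI[of _ U]) (simp add: PU P_eq order_congruence_def)
qed

text \<open>An integral vector in the kernel is an exponent that lies in the cone together with its
  negative, so pointedness makes it 0.\<close>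

lemma pointed_matrix_kernel:
  assumes V: "V = {..<k}" and U: "dim_col U = k" and C: "pointed (matrix_cone V U)"
  shows "mat_kernel U \<inter> {map_vec real_of_int n | n. n \<in> carrier_vec k} = {0\<^sub>v k}"
proof -
  have "map_vec real_of_int n = 0\<^sub>v k"
    if n: "n \<in> carrier_vec k" and ker: "map_vec real_of_int n \<in> mat_kernel U" for n
  proof -
    define v where "v = (\<Sum>i<k. frag_cmul (vec_index n i) (Poly_Mapping.single i 1))"
    have l: "Poly_Mapping.lookup v i = (if i < k then vec_index n i else 0)" for i
      by (auto simp: v_def lookup_sum lookup_single when_def if_distrib cong: if_cong)
    have vV: "v \<in> exponents V" by (auto simp: mem_exponents l V)
    have nth: "sorted_list_of_set {..<k} ! j = j" if "j < k" for j
      using that by (simp add: lessThan_atLeast0)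
    have ev: "exponent_vec V v = map_vec real_of_int n" "exponent_vec V (- v) = - map_vec real_of_int n"
      using n by (auto simp: exponent_vec_def V nth l)
    have 0: "U *\<^sub>v map_vec real_of_int n = 0\<^sub>v (dim_row U)"
      using ker by (simp add: mat_kernel_def)
    then have "scalar_prod (row U i) (map_vec real_of_int n) = 0" if "i < dim_row U" for i
      using that by (metis index_mult_mat_vec index_zero_vec(1))
    then have "U *\<^sub>v (- map_vec real_of_int n) = 0\<^sub>v (dim_row U)"
      using n U by (intro eq_vecI) simp_all
    with 0 have "v \<in> matrix_cone V U" "- v \<in> matrix_cone V U"
      using vV exponents_closed(3)[OF vV] by (auto simp: matrix_cone_def ev lex_nonneg_def)
    then have "v = 0" using C by (simp add: pointed_def)
    then show ?thesis using n l by (intro eq_vecI) (auto, metis lookup_zero)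
  qed
  then have "mat_kernel U \<inter> {map_vec real_of_int n | n. n \<in> carrier_vec k} \<subseteq> {0\<^sub>v k}"
    by blast
  moreover have "0\<^sub>v k \<in> mat_kernel U"
    using U by (auto simp: mat_kernel_def)
  moreover have "0\<^sub>v k \<in> {map_vec real_of_int n | n. n \<in> carrier_vec k}"
    by (intro CollectI exI[of _ "0\<^sub>v k"]) auto
  ultimately show ?thesis by blast
qed

text \<open>Minimality forces equality with the congruence of a total order contained in
  \<open>P\<close>; antisymmetry of that order becomes the condition on the kernel of the
  matrix.\<close>

lemma minimal_prime_poly_semiring:
  assumes P: "minimal_prime_congruence (poly_semiring {..<k}) P"
  shows "congruence_kernel (poly_semiring {..<k}) P = {0} \<and>
    (\<exists>U. admissible U \<and> dim_col U = k \<and>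
      mat_kernel U \<inter> {map_vec real_of_int n | n. n \<in> carrier_vec k} = {0\<^sub>v k} \<and>
      P = poly_prime {..<k} U)"
proof -
  have "prime_congruence (poly_semiring {..<k}) P" using P by (simp add: minimal_prime_congruence_def)
  then obtain C where C: "total_cone {..<k} C" "pointed C" "order_congruence {..<k} C \<subseteq> P"
    by (rule prime_contains_order_congruence)
  have P_eq: "P = order_congruence {..<k} C"
    using P prime_order_congruence[OF C(1)] C(3) unfolding minimal_prime_congruence_def by blast
  obtain U where U: "admissible U" "dim_col U = card {..<k}" "matrix_cone {..<k} U = C"
    using total_cone_matrix[OF _ C(1)] by blast
  have "poly_prime {..<k} U = order_congruence {..<k} C"
    using poly_prime_eq[of "{..<k}" U] total_coneD(1)[OF C(1)] by (simp add: U)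
  moreover have "mat_kernel U \<inter> {map_vec real_of_int n | n. n \<in> carrier_vec k} = {0\<^sub>v k}"
    using U C(2) by (intro pointed_matrix_kernel[OF refl]) auto
  ultimately show ?thesis
    using congruence_kernel_order_congruence[OF C(1)] U(1,2) by (auto simp: P_eq)
qed

section \<open>Newton polytopes\<close>

lemma newt_add: "newt (f + g) = convex hull (newt f \<union> newt g)"
  unfolding newt_def keys_add_two image_Un by (metis hull_Un_left hull_Un_right)

lemma newt_mult: "newt (f * g) = newt f + newt g"
proof -
  have "real_exponent ` (A + B) = real_exponent ` A + real_exponent ` B" for A B
    unfolding set_plus_image image_image by (force simp: image_iff split: prod.splits)
  then show ?thesis by (simp add: newt_def keys_mult_two convex_hull_set_plus)
qed

lemma lex_pos_scaleR:
  assumes "\<And>i. i < r \<Longrightarrow> \<phi> i (c *\<^sub>R u) = c * \<phi> i u" "c > 0" "lex_pos r \<phi> u"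
  shows "lex_pos r \<phi> (c *\<^sub>R u)"
  using assms unfolding lex_pos_def by (metis less_trans mult_pos_pos mult_zero_right)

text \<open>If no exponent of \<open>g\<close> reached \<open>m\<close>, all of them would lie in
  the set of real points lexicographically below \<open>m\<close>. This set is convex, so it
  contains \<open>newt g\<close> and hence \<open>m\<close> itself, which is absurd.\<close>

lemma newt_subset_dominated:
  assumes V: "finite V" and C: "total_cone V C"
    and f: "Poly_Mapping.keys f \<subseteq> exponents V" and g: "Poly_Mapping.keys g \<subseteq> exponents V"
    and sub: "newt f \<subseteq> newt g"
  shows "dominated C (Poly_Mapping.keys f) (Poly_Mapping.keys g)"
  unfolding dominated_def
proof (rule ballI, rule ccontr)
  fix m assume m: "m \<in> Poly_Mapping.keys f" and "\<not> (\<exists>n\<in>Poly_Mapping.keys g. n - m \<in> C)"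
  then have nC: "\<And>n. n \<in> Poly_Mapping.keys g \<Longrightarrow> n - m \<notin> C" by blast
  obtain r \<phi> where add: "\<And>i. i < r \<Longrightarrow> Modules.additive (\<phi> i)"
    and C_eq: "C = {v \<in> exponents V. lex_ge0 r \<phi> v}"
    by (rule total_cone_lexicographic[OF V C]) blast
  \<comment> \<open>The real-linear extension of \<phi> i from exponents to points, through its
    values on the unit exponents.\<close>
  define \<psi> where "\<psi> i p = (\<Sum>x\<in>V. Poly_Mapping.lookup p x * \<phi> i (Poly_Mapping.single x 1))" for i p
  have \<psi>_add: "\<psi> i (p + q) = \<psi> i p + \<psi> i q" for i p q
    by (simp add: \<psi>_def lookup_add distrib_right sum.distrib)
  have \<psi>_scale: "\<psi> i (c *\<^sub>R p) = c * \<psi> i p" for i c p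
    by (simp add: \<psi>_def sum_distrib_left mult.assoc)
  have \<psi>_\<phi>: "\<psi> i (real_exponent n) = \<phi> i n" if "i < r" "n \<in> exponents V" for i n
    using additive_eq_sum_single[OF V add that(2)] that(1) by (simp add: \<psi>_def)
  have pos: "lex_pos r \<psi> (real_exponent m - real_exponent n)" if n: "n \<in> Poly_Mapping.keys g" for n
  proof -
    have d: "n - m \<in> exponents V" "m - n \<in> exponents V"
      using n m f g by (auto intro!: exponents_closed)
    have "\<not> lex_ge0 r \<phi> (n - m)" using nC[OF n] d by (simp add: C_eq)
    moreover have "\<phi> i (- (n - m)) = - \<phi> i (n - m)" if "i < r" for i
      using add[OF that] by (rule Modules.additive.minus)
    ultimately have "lex_pos r \<phi> (- (n - m))"
      using lex_trichotomy[of r \<phi> "n - m"] unfolding lex_ge0_def by blast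
    then have "lex_pos r \<phi> (m - n)" by simp
    then have "lex_pos r \<psi> (real_exponent (m - n))"
      using \<psi>_\<phi>[OF _ d(2)] by (simp add: lex_pos_def del: real_exponent_simps) (metis less_trans)
    then show ?thesis by simp
  qed
  let ?S = "{p. lex_pos r \<psi> (real_exponent m - p)}"
  have "convex ?S"
  proof (rule convexI)
    fix p q and a b :: real
    assume pq: "p \<in> ?S" "q \<in> ?S" and ab: "0 \<le> a" "0 \<le> b" "a + b = 1"
    \<comment> \<open>Strict positivity survives scaling only by positive factors, so the endpoints
      of the segment are separate cases.\<close>
    consider "a = 0" "b = 1" | "a = 1" "b = 0" | "a > 0" "b > 0" using ab by force
    then show "a *\<^sub>R p + b *\<^sub>R q \<in> ?S"
    proof cases
      case 3
      have "real_exponent m - (a *\<^sub>R p + b *\<^sub>R q) =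
          a *\<^sub>R (real_exponent m - p) + b *\<^sub>R (real_exponent m - q)"
        using ab(3) by (simp add: algebra_simps flip: scaleR_add_left)
      then show ?thesis
        using 3 pq by (auto intro!: lex_pos_add lex_pos_scaleR simp: \<psi>_add \<psi>_scale)
    qed (use pq in auto)
  qed
  then have "newt g \<subseteq> ?S"
    unfolding newt_def using pos by (intro hull_minimal) auto
  moreover have "real_exponent m \<in> newt f"
    unfolding newt_def using m by (intro hull_inc) auto
  ultimately have "lex_pos r \<psi> 0" using sub by auto
  then show False by (auto simp: lex_pos_def \<psi>_def)
qed

text \<open>\<open>T\<close> collects the lattice points of the cone spanned by the differences of
  \<open>m\<close> and points of the hull. Convexity makes it closed under addition, and it misses 0
  because \<open>m\<close> is outside the hull; so adjoining 0 gives a pointed cone. In any total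
  order extending it, \<open>m\<close> is strictly above all of \<open>N\<close>.\<close>

lemma cone_separating_point:
  assumes m: "m \<in> exponents V" and N: "N \<subseteq> exponents V"
    and nh: "real_exponent m \<notin> convex hull (real_exponent ` N)"
  obtains C where "total_cone V C" "pointed C" "\<And>n. n \<in> N \<Longrightarrow> n - m \<notin> C"
proof -
  let ?h = "convex hull (real_exponent ` N)"
  define T where "T = {v \<in> exponents V. \<exists>c>0. \<exists>p\<in>?h. real_exponent v = c *\<^sub>R (real_exponent m - p)}"
  have T0: "0 \<notin> T" using nh by (auto simp: T_def)
  have T_add: "u + v \<in> T" if uv: "u \<in> T" "v \<in> T" for u v
  proof -
    obtain c p where c: "c > 0" "p \<in> ?h" "real_exponent u = c *\<^sub>R (real_exponent m - p)"
      using uv(1) by (auto simp: T_def)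
    obtain d q where d: "d > 0" "q \<in> ?h" "real_exponent v = d *\<^sub>R (real_exponent m - q)"
      using uv(2) by (auto simp: T_def)
    \<comment> \<open>The weights are chosen so that \<open>(c + d)\<close> times this point of the
      hull is \<open>c p + d q\<close>.\<close>
    let ?p = "(c / (c + d)) *\<^sub>R p + (d / (c + d)) *\<^sub>R q"
    have "?p \<in> ?h"
      using c d by (intro convexD convex_convex_hull) (auto simp: add_divide_distrib[symmetric])
    moreover have "real_exponent (u + v) = (c + d) *\<^sub>R (real_exponent m - ?p)"
    proof -
      have "(c + d) *\<^sub>R ?p = c *\<^sub>R p + d *\<^sub>R q"
        using c(1) d(1) by (simp add: scaleR_add_right)
      then show ?thesis by (simp add: c(3) d(3) algebra_simps)
    qed
    moreover have "c + d > 0" using c d by simp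
    moreover have "u + v \<in> exponents V" using uv by (auto simp: T_def exponents_closed)
    ultimately show ?thesis unfolding T_def by blast
  qed
  have "add_closed (insert 0 T)" using T_add by (auto simp: add_closed_def)
  moreover have "pointed (insert 0 T)" using T_add T0 by (force simp: pointed_def)
  moreover have "insert 0 T \<subseteq> exponents V" by (auto simp: T_def exponents_closed)
  ultimately obtain C where C: "total_cone V C" "pointed C" "insert 0 T \<subseteq> C"
    by (rule extend_pointed_cone)
  have "n - m \<notin> C" if n: "n \<in> N" for n
  proof
    assume nm: "n - m \<in> C"
    have nh': "real_exponent n \<in> ?h" using n by (intro hull_inc) auto
    then have ne: "n \<noteq> m" using nh by metis
    have "m - n \<in> exponents V" using m n N by (auto intro: exponents_closed)
    moreover have "real_exponent (m - n) = 1 *\<^sub>R (real_exponent m - real_exponent n)" by simp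
    ultimately have "m - n \<in> T"
      unfolding T_def using nh' by (intro CollectI conjI exI[of _ 1] bexI[of _ "real_exponent n"]) simp_all
    then have "m - n \<in> C" using C(3) by blast
    then show False using C(2) nm ne unfolding pointed_def by (metis minus_diff_eq eq_iff_diff_eq_0)
  qed
  then show thesis using that C by blast
qed

lemma mem_Rad_trivial_iff_newt:
  assumes V: "finite V" and f: "Poly_Mapping.keys f \<subseteq> nonneg_exponents V"
    and g: "Poly_Mapping.keys g \<subseteq> nonneg_exponents V"
  shows "(f, g) \<in> Rad_trivial V \<longleftrightarrow> newt f = newt g"
proof
  have fV: "Poly_Mapping.keys f \<subseteq> exponents V" "Poly_Mapping.keys g \<subseteq> exponents V"
    using f g nonneg_exponents_subset by blast+
  show "(f, g) \<in> Rad_trivial V" if "newt f = newt g"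
    using newt_subset_dominated[OF V _ fV] newt_subset_dominated[OF V _ fV(2,1)] that f g
    by (auto simp: mem_Rad_iff mem_order_congruence)
  assume R: "(f, g) \<in> Rad_trivial V"
  have sub: "newt a \<subseteq> newt b"
    if dom: "\<And>C. total_cone V C \<Longrightarrow> pointed C \<Longrightarrow> dominated C (Poly_Mapping.keys a) (Poly_Mapping.keys b)"
      and a: "Poly_Mapping.keys a \<subseteq> exponents V" and b: "Poly_Mapping.keys b \<subseteq> exponents V" for a b
    unfolding newt_def
  proof (rule hull_minimal, rule subsetI, rule ccontr)
    fix x assume "x \<in> real_exponent ` Poly_Mapping.keys a"
      and x: "x \<notin> convex hull (real_exponent ` Poly_Mapping.keys b)"
    then obtain m where m: "m \<in> Poly_Mapping.keys a" "x = real_exponent m" by blast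
    then obtain C where C: "total_cone V C" "pointed C" "\<And>n. n \<in> Poly_Mapping.keys b \<Longrightarrow> n - m \<notin> C"
      using cone_separating_point[OF _ b, of m] x a by blast
    then show False using dom[OF C(1,2)] m(1) by (auto simp: dominated_def)
  qed (rule convex_convex_hull)
  show "newt f = newt g"
    using R by (intro equalityI sub fV) (auto simp: mem_Rad_iff mem_order_congruence)
qed

text \<open>In a generating subset of least cardinality no point lies in the hull of the others, so
  each is extreme. The argument works in any real vector space, as the ambient space of finitely
  supported functions has infinite dimension.\<close>

lemma convex_hull_extreme_points:
  fixes F :: "'a::real_vector set"
  assumes "finite F"
  shows "convex hull F = convex hull {x. x extreme_point_of (convex hull F)}"
proof -
  obtain G where G: "G \<subseteq> F \<and> convex hull G = convex hull F"
    and min: "\<And>H. H \<subseteq> F \<and> convex hull H = convex hull F \<Longrightarrow> card G \<le> card H"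
    using ex_has_least_nat[of "\<lambda>G. G \<subseteq> F \<and> convex hull G = convex hull F" F card] by auto
  have fin: "finite G" using G assms finite_subset by blast
  have "x extreme_point_of (convex hull F)" if x: "x \<in> G" for x
  proof -
    have ins: "insert x (G - {x}) = G" using x by blast
    have "x \<notin> convex hull (G - {x})"
    proof
      assume "x \<in> convex hull (G - {x})"
      then have "convex hull G = convex hull (G - {x})" using hull_redundant[of x convex "G - {x}"] ins by simp
      then have "card G \<le> card (G - {x})" using G by (intro min) auto
      then show False using fin x by (metis card_Diff1_less not_le)
    qed
    then show ?thesis
      using extreme_point_of_convex_hull_insert[of "G - {x}" x] fin G ins by simp
  qed
  then have "convex hull G \<subseteq> convex hull {x. x extreme_point_of (convex hull F)}" by (intro hull_mono) blast
  moreover have "convex hull {x. x extreme_point_of (convex hull F)} \<subseteq> convex hull F"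
    using extreme_points_of_convex_hull by (rule hull_mono)
  ultimately show ?thesis using G by blast
qed

section \<open>Lattice polytopes as the image of the Newton map\<close>

lemma polytope_semiring_simps [simp]:
  "carrier (polytope_semiring V) = {S. lattice_polytope V S \<and> (\<forall>p\<in>S. \<forall>i\<in>V. 0 \<le> Poly_Mapping.lookup p i)}"
  "monoid.mult (polytope_semiring V) = (+)"
  "one (polytope_semiring V) = {0}" "zero (polytope_semiring V) = {}"
  "add (polytope_semiring V) = (\<lambda>S T. convex hull (S \<union> T))"
  by (auto simp: polytope_semiring_def set_plus_def fun_eq_iff)

lemma keys_real_exponent: "Poly_Mapping.keys (real_exponent n) = Poly_Mapping.keys n"
  by (auto simp: in_keys_iff)

lemma convex_keys_subset: "convex {p :: nat \<Rightarrow>\<^sub>0 real. Poly_Mapping.keys p \<subseteq> V}"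
proof (rule convexI)
  fix p q :: "nat \<Rightarrow>\<^sub>0 real" and a b :: real
  assume "p \<in> {p. Poly_Mapping.keys p \<subseteq> V}" "q \<in> {p. Poly_Mapping.keys p \<subseteq> V}"
  then show "a *\<^sub>R p + b *\<^sub>R q \<in> {p. Poly_Mapping.keys p \<subseteq> V}"
    by (auto simp: in_keys_iff lookup_add subset_iff) (metis add.right_neutral mult_zero_right)
qed

lemma convex_lookup_nonneg: "convex {p. \<forall>i\<in>V. 0 \<le> (Poly_Mapping.lookup p i :: real)}"
  by (rule convexI) (simp add: lookup_add)

text \<open>For surjectivity, a polytope is the hull of its finitely many extreme points; these are
  lattice points by definition and lie in the quadrant because the polytope does, so they are the
  exponents of a polynomial.\<close>

lemma newt_image: "newt ` {f. Poly_Mapping.keys f \<subseteq> nonneg_exponents V} = carrier (polytope_semiring V)"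
proof (intro equalityI subsetI)
  fix S assume "S \<in> newt ` {f. Poly_Mapping.keys f \<subseteq> nonneg_exponents V}"
  then obtain f where f: "Poly_Mapping.keys f \<subseteq> nonneg_exponents V" "S = newt f" by blast
  have "polytope S" unfolding f(2) newt_def polytope_def
    by (intro exI[of _ "real_exponent ` Poly_Mapping.keys f"]) simp
  moreover have "S \<subseteq> {p. Poly_Mapping.keys p \<subseteq> V}"
    unfolding f(2) newt_def using f(1)
    by (intro hull_minimal convex_keys_subset) (auto simp: keys_real_exponent nonneg_exponents_def exponents_def, blast)
  moreover have "S \<subseteq> {p. \<forall>i\<in>V. 0 \<le> Poly_Mapping.lookup p i}"
    unfolding f(2) newt_def using f(1)
    by (intro hull_minimal convex_lookup_nonneg) (auto simp: nonneg_exponents_def)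
  moreover have "v \<in> real_exponent ` exponents V" if "v extreme_point_of S" for v
    using extreme_point_of_convex_hull[of v] that f nonneg_exponents_subset unfolding newt_def by blast
  ultimately show "S \<in> carrier (polytope_semiring V)"
    by (auto simp: lattice_polytope_def)
next
  fix S assume S: "S \<in> carrier (polytope_semiring V)"
  then obtain F where F: "finite F" "S = convex hull F" by (auto simp: lattice_polytope_def polytope_def)
  define E where "E = {x. x extreme_point_of S}"
  have E: "E \<subseteq> F" "S = convex hull E"
    using extreme_points_of_convex_hull convex_hull_extreme_points[OF F(1)] by (auto simp: E_def F(2))
  have "E \<subseteq> real_exponent ` nonneg_exponents V"
  proof
    fix x assume x: "x \<in> E"
    then obtain n where n: "x = real_exponent n" "n \<in> exponents V" using S by (auto simp: E_def lattice_polytope_def)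
    have "x \<in> S" using x by (simp add: E_def extreme_point_of_def)
    then have "0 \<le> Poly_Mapping.lookup n i" if "i \<in> V" for i
      using S that by (auto simp: n(1))
    then have "n \<in> nonneg_exponents V" using n(2) by (auto simp: mem_nonneg_exponents mem_exponents) (metis order_refl)
    then show "x \<in> real_exponent ` nonneg_exponents V" using n by blast
  qed
  then obtain M where M: "M \<subseteq> nonneg_exponents V" "E = real_exponent ` M" by (metis subset_image_iff)
  have "finite M"
    using E(1) F(1) M(2) by (metis finite_subset finite_imageD inj_onI real_exponent_inject)
  then have "newt (\<Sum>n\<in>M. monomial n) = S"
    by (simp add: newt_def keys_sum_monomial E(2) M(2))
  then show "S \<in> newt ` {f. Poly_Mapping.keys f \<subseteq> nonneg_exponents V}"
    using M \<open>finite M\<close> by (intro image_eqI[of _ _ "\<Sum>n\<in>M. monomial n"]) (auto simp: keys_sum_monomial)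
qed

text \<open>Algebraic laws pass to the image of a homomorphism. Used for the polytopes through
  \<open>newt\<close>, which spares direct reasoning about hulls and Minkowski sums, and for the
  quotient through the class map.\<close>

lemma balgebra_image:
  assumes A: "balgebra A" and im: "carrier B = h ` carrier A"
    and add: "\<And>x y. x \<in> carrier A \<Longrightarrow> y \<in> carrier A \<Longrightarrow> h (x \<oplus>\<^bsub>A\<^esub> y) = h x \<oplus>\<^bsub>B\<^esub> h y"
    and mult: "\<And>x y. x \<in> carrier A \<Longrightarrow> y \<in> carrier A \<Longrightarrow> h (x \<otimes>\<^bsub>A\<^esub> y) = h x \<otimes>\<^bsub>B\<^esub> h y"
    and zero: "h \<zero>\<^bsub>A\<^esub> = \<zero>\<^bsub>B\<^esub>" and one: "h \<one>\<^bsub>A\<^esub> = \<one>\<^bsub>B\<^esub>" and ne: "\<one>\<^bsub>B\<^esub> \<noteq> \<zero>\<^bsub>B\<^esub>"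
  shows "balgebra B"
proof -
  interpret A: semiring A using A by (simp add: balgebra_def)
  interpret Am: comm_monoid A using A by (simp add: balgebra_def)
  have idem: "x \<oplus>\<^bsub>A\<^esub> x = x" if "x \<in> carrier A" for x using A that by (simp add: balgebra_def)
  note hom = add[symmetric] mult[symmetric] zero[symmetric] one[symmetric]
  have el: "\<exists>a\<in>carrier A. x = h a" if "x \<in> carrier B" for x using that im by auto
  have cl: "h a \<in> carrier B" if "a \<in> carrier A" for a using that im by auto
  have "abelian_monoid B"
  proof (rule abelian_monoidI)
    fix x y z assume "x \<in> carrier B" "y \<in> carrier B" "z \<in> carrier B"
    then obtain a b c where abc: "a \<in> carrier A" "b \<in> carrier A" "c \<in> carrier A" "x = h a" "y = h b" "z = h c"
      using el by metis
    show "x \<oplus>\<^bsub>B\<^esub> y \<oplus>\<^bsub>B\<^esub> z = x \<oplus>\<^bsub>B\<^esub> (y \<oplus>\<^bsub>B\<^esub> z)" using abc by (simp add: hom A.a_assoc)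
  next
    fix x y assume "x \<in> carrier B" "y \<in> carrier B"
    then obtain a b where ab: "a \<in> carrier A" "b \<in> carrier A" "x = h a" "y = h b"
      using el by metis
    show "x \<oplus>\<^bsub>B\<^esub> y \<in> carrier B" using ab by (simp add: hom cl)
    show "x \<oplus>\<^bsub>B\<^esub> y = y \<oplus>\<^bsub>B\<^esub> x" using ab by (simp add: hom A.a_comm)
  next
    fix x assume "x \<in> carrier B"
    then obtain a where a: "a \<in> carrier A" "x = h a" using el by metis
    show "\<zero>\<^bsub>B\<^esub> \<oplus>\<^bsub>B\<^esub> x = x" using a by (simp add: hom)
  qed (simp add: hom cl)
  moreover have "comm_monoid B"
  proof (rule comm_monoidI)
    fix x y z assume "x \<in> carrier B" "y \<in> carrier B" "z \<in> carrier B"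
    then obtain a b c where abc: "a \<in> carrier A" "b \<in> carrier A" "c \<in> carrier A" "x = h a" "y = h b" "z = h c"
      using el by metis
    show "x \<otimes>\<^bsub>B\<^esub> y \<otimes>\<^bsub>B\<^esub> z = x \<otimes>\<^bsub>B\<^esub> (y \<otimes>\<^bsub>B\<^esub> z)" using abc by (simp add: hom A.m_assoc)
  next
    fix x y assume "x \<in> carrier B" "y \<in> carrier B"
    then obtain a b where ab: "a \<in> carrier A" "b \<in> carrier A" "x = h a" "y = h b"
      using el by metis
    show "x \<otimes>\<^bsub>B\<^esub> y \<in> carrier B" using ab by (simp add: hom cl)
    show "x \<otimes>\<^bsub>B\<^esub> y = y \<otimes>\<^bsub>B\<^esub> x" using ab by (simp add: hom Am.m_comm)
  next
    fix x assume "x \<in> carrier B"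
    then obtain a where a: "a \<in> carrier A" "x = h a" using el by metis
    show "\<one>\<^bsub>B\<^esub> \<otimes>\<^bsub>B\<^esub> x = x" using a by (simp add: hom)
  qed (simp add: hom cl)
  moreover have "semiring_axioms B"
  proof
    fix x y z assume "x \<in> carrier B" "y \<in> carrier B" "z \<in> carrier B"
    then obtain a b c where abc: "a \<in> carrier A" "b \<in> carrier A" "c \<in> carrier A" "x = h a" "y = h b" "z = h c"
      using el by metis
    show "(x \<oplus>\<^bsub>B\<^esub> y) \<otimes>\<^bsub>B\<^esub> z = x \<otimes>\<^bsub>B\<^esub> z \<oplus>\<^bsub>B\<^esub> y \<otimes>\<^bsub>B\<^esub> z"
      "z \<otimes>\<^bsub>B\<^esub> (x \<oplus>\<^bsub>B\<^esub> y) = z \<otimes>\<^bsub>B\<^esub> x \<oplus>\<^bsub>B\<^esub> z \<otimes>\<^bsub>B\<^esub> y"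
      using abc by (simp_all add: hom A.l_distr A.r_distr)
  next
    fix x assume "x \<in> carrier B"
    then obtain a where a: "a \<in> carrier A" "x = h a" using el by metis
    show "\<zero>\<^bsub>B\<^esub> \<otimes>\<^bsub>B\<^esub> x = \<zero>\<^bsub>B\<^esub>" "x \<otimes>\<^bsub>B\<^esub> \<zero>\<^bsub>B\<^esub> = \<zero>\<^bsub>B\<^esub>" using a by (simp_all add: hom)
  qed
  moreover have "x \<oplus>\<^bsub>B\<^esub> x = x" if x: "x \<in> carrier B" for x
  proof -
    obtain a where "a \<in> carrier A" "x = h a" using el[OF x] by blast
    then show ?thesis by (simp add: hom idem)
  qed
  ultimately show ?thesis
    using ne by (simp add: balgebra_def semiring_def comm_monoid_def)
qed

lemma balgebra_monoid_algebra:
  assumes S: "add_closed S"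
  shows "balgebra (monoid_algebra S)"
proof -
  have S0: "0 \<in> S" using S by (rule add_closedD)
  have "abelian_monoid (monoid_algebra S)"
    by (rule abelian_monoidI) (auto simp: keys_add_two ac_simps)
  moreover have "comm_monoid (monoid_algebra S)"
    by (rule comm_monoidI) (use keys_mult_closed[OF S] S0 in \<open>auto simp: ac_simps\<close>)
  moreover have "semiring_axioms (monoid_algebra S)"
    by unfold_locales (auto simp: distrib_left distrib_right)
  ultimately show ?thesis
    by (simp add: balgebra_def semiring_def comm_monoid_def two_poly_add_idem)
qed

lemma poly_semiring_simps:
  "carrier (poly_semiring V) = {f. Poly_Mapping.keys f \<subseteq> nonneg_exponents V}"
  "monoid.mult (poly_semiring V) = (*)" "one (poly_semiring V) = 1"
  "zero (poly_semiring V) = 0" "add (poly_semiring V) = (+)"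
  by (simp_all add: poly_semiring_eq)

text \<open>The homomorphism theorem for \<open>newt\<close>: it maps onto the polytopes of the
  quadrant, and the radical relates exactly the polynomials with equal image.\<close>

lemma quotient_Rad_trivial_iso:
  assumes V: "finite V"
  shows "balgebra_iso (quotient_semiring (poly_semiring V) (Rad_trivial V)) (polytope_semiring V)"
proof -
  let ?A = "poly_semiring V" and ?R = "Rad_trivial V"
  let ?Q = "quotient_semiring ?A ?R" and ?B = "polytope_semiring V"
  note q = quotient_semiring_simps[OF congruence_Rad_trivial[of V]]
  have eq: "equiv (carrier ?A) ?R" using congruence_Rad_trivial by (simp add: congruence_def)
  have S: "add_closed (nonneg_exponents V)" by (rule add_closed_nonneg_exponents)
  have A: "balgebra ?A" unfolding poly_semiring_eq by (rule balgebra_monoid_algebra[OF S])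
  have newt: "(f, g) \<in> ?R \<longleftrightarrow> newt f = newt g" if "f \<in> carrier ?A" "g \<in> carrier ?A" for f g
    using mem_Rad_trivial_iff_newt[OF V] that by (simp add: poly_semiring_simps)
  have closed: "f + g \<in> carrier ?A" "f * g \<in> carrier ?A" "0 \<in> carrier ?A" "1 \<in> carrier ?A"
    if "f \<in> carrier ?A" "g \<in> carrier ?A" for f g
    using that keys_mult_closed[OF S] add_closedD(1)[OF S] by (auto simp: poly_semiring_simps keys_add_two)
  have newt_const: "newt 0 = {}" "newt 1 = {0}" by (simp_all add: newt_def)
  have B: "balgebra ?B"
    by (rule balgebra_image[OF A, of _ newt])
       (simp_all add: poly_semiring_simps newt_image newt_add newt_mult newt_const del: polytope_semiring_simps(1))
  \<comment> \<open>All members of a class have the same Newton polytope, so the image of a class is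
    a singleton.\<close>
  define h where "h X = the_elem (newt ` X)" for X :: "laurent set"
  have h: "h (?R `` {f}) = newt f" if f: "f \<in> carrier ?A" for f
  proof -
    have "newt g = newt f" if g: "g \<in> ?R `` {f}" for g
    proof -
      have "g \<in> carrier ?A" using g by (simp add: mem_Rad_iff poly_semiring_simps)
      then show ?thesis using g newt[OF f] by simp
    qed
    moreover have "f \<in> ?R `` {f}" using equiv_class_self[OF eq f] .
    ultimately have "newt ` (?R `` {f}) = {newt f}" by blast
    then show ?thesis by (simp add: h_def)
  qed
  have el: "\<exists>f\<in>carrier ?A. X = ?R `` {f}" if "X \<in> carrier ?Q" for X
    using that unfolding q(1) by (auto elim: quotientE)
  have Q: "balgebra ?Q"
  proof (rule balgebra_image[OF A])
    show "carrier ?Q = (\<lambda>f. ?R `` {f}) ` carrier ?A" unfolding q(1) by (auto simp: quotient_def)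
    have "(1, 0) \<notin> ?R" using newt[of 1 0] closed[of 0 0] newt_const by (auto simp: poly_semiring_simps add_closedD(1)[OF S])
    moreover have "0 \<in> carrier ?A" by (simp add: poly_semiring_simps)
    ultimately show "\<one>\<^bsub>?Q\<^esub> \<noteq> \<zero>\<^bsub>?Q\<^esub>"
      unfolding q(4,5) using eq_equiv_class[OF _ eq] by (fastforce simp: poly_semiring_simps)
  qed (simp_all add: q)
  have "h \<in> Ring.ring_hom ?Q ?B"
  proof (rule ring_hom_memI)
    fix X Y assume "X \<in> carrier ?Q" "Y \<in> carrier ?Q"
    then obtain f g where f: "f \<in> carrier ?A" "X = ?R `` {f}" and g: "g \<in> carrier ?A" "Y = ?R `` {g}"
      using el by meson
    show "h (X \<otimes>\<^bsub>?Q\<^esub> Y) = h X \<otimes>\<^bsub>?B\<^esub> h Y"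
      using f g closed(2)[OF f(1) g(1)] h by (simp add: q poly_semiring_simps newt_mult)
    show "h (X \<oplus>\<^bsub>?Q\<^esub> Y) = h X \<oplus>\<^bsub>?B\<^esub> h Y"
      using f g closed(1)[OF f(1) g(1)] h by (simp add: q poly_semiring_simps newt_add)
  next
    fix X assume "X \<in> carrier ?Q"
    then obtain f where f: "f \<in> carrier ?A" "X = ?R `` {f}" using el by meson
    show "h X \<in> carrier ?B"
      unfolding newt_image[symmetric] f(2) h[OF f(1)] using f(1) by (auto simp: poly_semiring_simps)
  next
    show "h \<one>\<^bsub>?Q\<^esub> = \<one>\<^bsub>?B\<^esub>"
      using h[of 1] closed(4) by (simp add: q newt_const poly_semiring_simps add_closedD(1)[OF S])
  qed
  moreover have "bij_betw h (carrier ?Q) (carrier ?B)"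
  proof -
    have "inj_on h (carrier ?Q)"
    proof (rule inj_onI)
      fix X Y assume "X \<in> carrier ?Q" "Y \<in> carrier ?Q" and hXY: "h X = h Y"
      then obtain f g where f: "f \<in> carrier ?A" "X = ?R `` {f}" and g: "g \<in> carrier ?A" "Y = ?R `` {g}"
        using el by meson
      then have "(f, g) \<in> ?R" using hXY h newt by simp
      then show "X = Y" unfolding f g by (rule equiv_class_eq[OF eq])
    qed
    moreover have "h ` carrier ?Q = newt ` carrier ?A"
    proof -
      have "carrier ?Q = (\<lambda>f. ?R `` {f}) ` carrier ?A" unfolding q(1) by (auto simp: quotient_def)
      then show ?thesis using h by (simp add: image_image)
    qed
    ultimately show ?thesis
      unfolding bij_betw_def newt_image[symmetric] by (simp add: poly_semiring_simps)
  qed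
  ultimately have "h \<in> ring_iso ?Q ?B" by (simp add: ring_iso_def)
  moreover have "h \<zero>\<^bsub>?Q\<^esub> = \<zero>\<^bsub>?B\<^esub>"
    using h[of 0] by (simp add: q newt_const poly_semiring_simps)
  ultimately show ?thesis using B Q by (auto simp: balgebra_iso_def)
qed

section \<open>Dimension\<close>

text \<open>\<open>B\<close> is linearly independent modulo the lattice of the Laurent monomials in the variables
  outside \<open>H\<close> that \<open>P\<close> identifies with \<open>1\<close>; such \<open>B\<close> take the place of transcendence bases.\<close>

definition independent_mod :: "nat set \<Rightarrow> (laurent \<times> laurent) set \<Rightarrow> (nat \<Rightarrow>\<^sub>0 int) set \<Rightarrow> bool" where
  "independent_mod V P B \<longleftrightarrow> (\<exists>H C. H \<subseteq> V \<and> total_cone (V - H) C \<and>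
     P = cone_congruence (nonneg_exponents V) (nonneg_exponents (V - H)) C \<and>
     finite B \<and> B \<subseteq> exponents (V - H) \<and>
     (\<forall>a. (\<Sum>b\<in>B. frag_cmul (a b) b) \<in> C \<and> - (\<Sum>b\<in>B. frag_cmul (a b) b) \<in> C \<longrightarrow> (\<forall>b\<in>B. a b = 0)))"

lemma exponents_mono: "W \<subseteq> V \<Longrightarrow> exponents W \<subseteq> exponents V"
  by (auto simp: exponents_def)

text \<open>Descending to a smaller prime frees a direction. Either some variable vanishes modulo
  \<open>Q\<close> but not modulo \<open>P\<close>, or the same variables vanish and some exponent
  is equivalent to 0 for \<open>Q\<close> but not for \<open>P\<close>. In both cases it can be
  adjoined to \<open>B\<close>.\<close>

lemma independent_mod_strict_subset:
  assumes PQ: "P \<subset> Q" and P: "prime_congruence (poly_semiring V) P" and B: "independent_mod V Q B"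
  shows "\<exists>B'. independent_mod V P B' \<and> card B' = Suc (card B)"
proof -
  obtain H C where H: "H \<subseteq> V" and C: "total_cone (V - H) C"
    and P_eq: "P = cone_congruence (nonneg_exponents V) (nonneg_exponents (V - H)) C"
    using prime_poly_semiring[OF P] by blast
  obtain H' C' where H': "H' \<subseteq> V" and C': "total_cone (V - H') C'"
    and Q_eq: "Q = cone_congruence (nonneg_exponents V) (nonneg_exponents (V - H')) C'"
    and fin: "finite B" and BW: "B \<subseteq> exponents (V - H')"
    and indep: "\<forall>a. (\<Sum>b\<in>B. frag_cmul (a b) b) \<in> C' \<and> - (\<Sum>b\<in>B. frag_cmul (a b) b) \<in> C' \<longrightarrow> (\<forall>b\<in>B. a b = 0)"
    using B unfolding independent_mod_def by (elim exE conjE) (rule that, assumption+)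
  have ind: "\<forall>b\<in>B. a b = 0"
    if "(\<Sum>b\<in>B. frag_cmul (a b) b) \<in> C'" "- (\<Sum>b\<in>B. frag_cmul (a b) b) \<in> C'" for a
    using that by (rule indep[THEN spec[where x = a], THEN mp, OF conjI])
  have mon: "(monomial n, monomial m) \<in> Q" if "(monomial n, monomial m) \<in> P" for n m using that PQ by blast
  have HH: "H \<subseteq> H'"
  proof
    fix i assume i: "i \<in> H"
    let ?x = "Poly_Mapping.single i 1 :: nat \<Rightarrow>\<^sub>0 int"
    have xV: "?x \<in> nonneg_exponents V" and xW: "?x \<notin> nonneg_exponents (V - H)"
      using i H by (auto simp: mem_nonneg_exponents mem_exponents lookup_single when_def)
    have "(monomial ?x, 0) \<in> P"
      using xV xW by (simp add: P_eq cone_congruence_def dominated_def)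
    then have "(monomial ?x, 0) \<in> Q" using PQ by blast
    then have "?x \<notin> nonneg_exponents (V - H')"
      by (auto simp: Q_eq cone_congruence_def dominated_def)
    then show "i \<in> H'"
      using i H by (auto simp: mem_nonneg_exponents mem_exponents lookup_single when_def split: if_splits)
  qed
  have WW: "exponents (V - H') \<subseteq> exponents (V - H)" using HH by (intro exponents_mono) blast
  have nW: "nonneg_exponents (V - H') \<subseteq> nonneg_exponents (V - H)" using HH by (intro nonneg_exponents_mono) blast
  have nV: "nonneg_exponents (V - H) \<subseteq> nonneg_exponents V" by (intro nonneg_exponents_mono) blast
  have CC: "v \<in> C'" if v: "v \<in> exponents (V - H')" "v \<in> C" for v
  proof -
    obtain n m where nm: "n \<in> nonneg_exponents (V - H')" "m \<in> nonneg_exponents (V - H')" "v = n - m"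
      using exponents_difference[OF v(1)] by blast
    have C0: "0 \<in> C" using total_coneD(1)[OF C] by (rule add_closedD)
    have "(monomial n + monomial m, monomial n) \<in> P"
      using nm nW nV v(2) C0 by (auto simp: P_eq cone_congruence_def keys_add_two dominated_def)
    then have "(monomial n + monomial m, monomial n) \<in> Q" using PQ by blast
    then show ?thesis using nm by (auto simp: Q_eq cone_congruence_def keys_add_two dominated_def)
  qed
  have sumW: "(\<Sum>b\<in>B. frag_cmul (a b) b) \<in> exponents (V - H')" for a
    using fin BW by (intro exponents_closed) auto
  have plus: "u + v \<in> C" if "u \<in> C" "v \<in> C" for u v
    using total_coneD(1)[OF C] that by (simp add: add_closed_def)
  have plus': "u + v \<in> C'" if "u \<in> C'" "v \<in> C'" for u v
    using total_coneD(1)[OF C'] that by (simp add: add_closed_def)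
  have mul: "frag_cmul c v \<in> C" if "c \<ge> 0" "v \<in> C" for c v
    using frag_cmul_closed[OF total_coneD(1)[OF C] that(2), of "nat c"] that(1) by simp
  have mul': "frag_cmul c v \<in> C'" if "c \<ge> 0" "v \<in> C'" for c v
    using frag_cmul_closed[OF total_coneD(1)[OF C'] that(2), of "nat c"] that(1) by simp
  have "\<exists>b0. b0 \<notin> B \<and> b0 \<in> exponents (V - H) \<and> (\<forall>c a. frag_cmul c b0 + (\<Sum>b\<in>B. frag_cmul (a b) b) \<in> C \<longrightarrow>
      - (frag_cmul c b0 + (\<Sum>b\<in>B. frag_cmul (a b) b)) \<in> C \<longrightarrow> c = 0)"
  proof (cases "H = H'")
    case False
    then obtain j where j: "j \<in> H'" "j \<notin> H" using HH by blast
    let ?x = "Poly_Mapping.single j 1 :: nat \<Rightarrow>\<^sub>0 int"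
    have xW: "?x \<in> exponents (V - H)" using j H' by (auto simp: mem_exponents lookup_single when_def)
    have "?x \<notin> exponents (V - H')" using j by (auto simp: mem_exponents)
    then have "?x \<notin> B" using BW by blast
    \<comment> \<open>Such a relation would identify, modulo \<open>P\<close> and hence modulo
      \<open>Q\<close>, a monomial divisible by the variable \<open>j\<close>, which vanishes modulo
      \<open>Q\<close>, with one that does not.\<close>
    have not_pos: "\<not> c > 0"
      if s: "s \<in> exponents (V - H')" and cs: "frag_cmul c ?x + s \<in> C" "- (frag_cmul c ?x + s) \<in> C" for c s
    proof
      assume c: "c > 0"
      obtain n m where nm: "n \<in> nonneg_exponents (V - H')" "m \<in> nonneg_exponents (V - H')" "s = n - m"
        using exponents_difference[OF s] by blast
      let ?n = "frag_cmul c ?x + n"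
      have n': "?n \<in> nonneg_exponents (V - H)"
        unfolding mem_nonneg_exponents
      proof
        have "n \<in> exponents (V - H)" using nm(1) WW by (auto simp: nonneg_exponents_def)
        then show "?n \<in> exponents (V - H)" using xW by (intro exponents_closed(2,5))
        show "\<forall>i. 0 \<le> Poly_Mapping.lookup ?n i"
          using c nm(1) by (simp add: mem_nonneg_exponents lookup_add lookup_single when_def)
      qed
      have "Poly_Mapping.lookup ?n j > 0"
        using c nm by (auto simp: lookup_add mem_nonneg_exponents intro: add_pos_nonneg)
      then have n'': "?n \<notin> nonneg_exponents (V - H')"
        using j by (auto simp: mem_nonneg_exponents mem_exponents)
      have "?n - m \<in> C" "m - ?n \<in> C" using cs by (simp_all add: nm(3) algebra_simps)
      then have "(monomial ?n, monomial m) \<in> P"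
        using n' nm nW nV by (auto simp: P_eq cone_congruence_def dominated_def)
      then have "(monomial ?n, monomial m) \<in> Q" by (rule mon)
      then show False using n'' nm(2) by (auto simp: Q_eq cone_congruence_def dominated_def)
    qed
    have "c = 0" if cs: "frag_cmul c ?x + s \<in> C" "- (frag_cmul c ?x + s) \<in> C"
      and s: "s \<in> exponents (V - H')" for c s
    proof -
      have eq: "frag_cmul (- c) ?x + - s = - (frag_cmul c ?x + s)"
        by (rule poly_mapping_eqI) (simp add: lookup_add)
      have "\<not> - c > 0"
      proof (rule not_pos[OF exponents_closed(3)[OF s]])
        show "frag_cmul (- c) ?x + - s \<in> C" unfolding eq by (rule cs(2))
        show "- (frag_cmul (- c) ?x + - s) \<in> C" unfolding eq minus_minus by (rule cs(1))
      qed
      then show ?thesis using not_pos[OF s cs] by simp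
    qed
    then show ?thesis using \<open>?x \<notin> B\<close> xW sumW by blast
  next
    case True
    have "C \<subseteq> C'" using CC total_coneD(2)[OF C] True by blast
    moreover have "C \<noteq> C'" using PQ P_eq Q_eq True by blast
    \<comment> \<open>This \<open>v\<close> is strictly negative for \<open>P\<close>, since it is
      not in \<open>C\<close>, but equivalent to 0 for \<open>Q\<close>, since \<open>- v\<close>
      lies in \<open>C\<close> and so in \<open>C'\<close>.\<close>
    ultimately obtain v where v: "v \<in> C'" "v \<notin> C" by blast
    have vW: "v \<in> exponents (V - H)" using v(1) total_coneD(2)[OF C'] True by blast
    have mv: "- v \<in> C" using total_coneD(3)[OF C vW v(2)] .
    then have mv': "- v \<in> C'" using \<open>C \<subseteq> C'\<close> by blast
    have L': "frag_cmul c v \<in> C'" for c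
    proof (cases "c \<ge> 0")
      case False
      then have "frag_cmul (- c) (- v) \<in> C'" using mv' by (intro mul') auto
      moreover have "frag_cmul (- c) (- v) = frag_cmul c v" by (rule poly_mapping_eqI) simp
      ultimately show ?thesis by metis
    qed (use v mul' in auto)
    have "v \<notin> B"
    proof
      assume vB: "v \<in> B"
      have "(\<Sum>b\<in>B. frag_cmul (if b = v then 1 else 0) b) = (\<Sum>b\<in>B. if b = v then v else 0)"
        by (intro sum.cong) auto
      also have "\<dots> = v" using fin vB by simp
      finally have "(\<Sum>b\<in>B. frag_cmul (if b = v then 1 else 0) b) = v" .
      then have "\<forall>b\<in>B. (if b = v then 1 else 0 :: int) = 0"
        by (intro ind) (simp_all only: v(1) mv')
      then show False using vB by force
    qed
    moreover have "c = 0" if cs: "frag_cmul c v + (\<Sum>b\<in>B. frag_cmul (a b) b) \<in> C"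
      "- (frag_cmul c v + (\<Sum>b\<in>B. frag_cmul (a b) b)) \<in> C" for c a
    proof -
      \<comment> \<open>Multiples of \<open>v\<close> are trivial for \<open>Q\<close>, so removing
        them shows that \<open>?s\<close> is trivial for \<open>Q\<close>; independence of
        \<open>B\<close> then leaves a multiple of \<open>v\<close> alone.\<close>
      let ?s = "\<Sum>b\<in>B. frag_cmul (a b) b"
      have "(frag_cmul c v + ?s) + frag_cmul (- c) v = ?s" "- (frag_cmul c v + ?s) + frag_cmul c v = - ?s"
        by (rule poly_mapping_eqI; simp add: lookup_add lookup_minus)+
      moreover have "(frag_cmul c v + ?s) + frag_cmul (- c) v \<in> C'" "- (frag_cmul c v + ?s) + frag_cmul c v \<in> C'"
        using plus' L' subsetD[OF \<open>C \<subseteq> C'\<close> cs(1)] subsetD[OF \<open>C \<subseteq> C'\<close> cs(2)] by blast+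
      ultimately have "?s \<in> C'" "- ?s \<in> C'" by (simp_all only:)
      then have "\<forall>b\<in>B. a b = 0" by (rule ind)
      then have s0: "?s = 0" by simp
      show ?thesis
      proof (rule ccontr)
        assume c: "c \<noteq> 0"
        have "frag_cmul \<bar>c\<bar> v \<in> C" using cs s0 by (simp add: abs_if)
        moreover have "frag_cmul (\<bar>c\<bar> - 1) (- v) \<in> C" using c mv by (intro mul) auto
        ultimately have "frag_cmul \<bar>c\<bar> v + frag_cmul (\<bar>c\<bar> - 1) (- v) \<in> C" by (rule plus)
        moreover have "frag_cmul \<bar>c\<bar> v + frag_cmul (\<bar>c\<bar> - 1) (- v) = v"
          by (rule poly_mapping_eqI) (simp add: lookup_add algebra_simps)
        ultimately show False using v by simp
      qed
    qed
    ultimately show ?thesis using vW by blast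
  qed
  then obtain b0 where b0: "b0 \<notin> B" "b0 \<in> exponents (V - H)"
    "\<And>c a. frag_cmul c b0 + (\<Sum>b\<in>B. frag_cmul (a b) b) \<in> C \<Longrightarrow>
      - (frag_cmul c b0 + (\<Sum>b\<in>B. frag_cmul (a b) b)) \<in> C \<Longrightarrow> c = 0" by blast
  have "\<forall>b\<in>insert b0 B. a b = 0"
    if a: "(\<Sum>b\<in>insert b0 B. frag_cmul (a b) b) \<in> C" "- (\<Sum>b\<in>insert b0 B. frag_cmul (a b) b) \<in> C" for a
  proof -
    have eq: "(\<Sum>b\<in>insert b0 B. frag_cmul (a b) b) = frag_cmul (a b0) b0 + (\<Sum>b\<in>B. frag_cmul (a b) b)"
      using fin b0(1) by simp
    have a0: "a b0 = 0" using a b0(3) unfolding eq by blast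
    then have "(\<Sum>b\<in>B. frag_cmul (a b) b) \<in> C" "- (\<Sum>b\<in>B. frag_cmul (a b) b) \<in> C"
      using a unfolding eq by simp_all
    then have "\<forall>b\<in>B. a b = 0"
      by (intro ind CC sumW exponents_closed(3))
    then show ?thesis using a0 by simp
  qed
  note ind' = this
  have "independent_mod V P (insert b0 B)"
    unfolding independent_mod_def
  proof (intro exI[of _ H] exI[of _ C] conjI allI impI)
    show "insert b0 B \<subseteq> exponents (V - H)" using b0(2) BW WW by blast
  qed (use H C P_eq fin ind' in \<open>blast+\<close>)
  then show ?thesis using fin b0(1) by (intro exI[of _ "insert b0 B"]) simp
qed

text \<open>Begin with the empty set at the largest prime and gain one element at each inclusion on
  the way down. At the smallest prime an independent set of \<open>n\<close> exponents
  results.\<close>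

lemma prime_chain_length:
  assumes V: "finite V" and prime: "\<And>i. i \<le> n \<Longrightarrow> prime_congruence (poly_semiring V) (c i)"
    and chain: "\<And>i. i < n \<Longrightarrow> c i \<subset> c (Suc i)"
  shows "n \<le> card V"
proof -
  have "\<exists>B. independent_mod V (c (n - i)) B \<and> card B = i" if "i \<le> n" for i
    using that
  proof (induction i)
    case 0
    obtain H C where "H \<subseteq> V" "total_cone (V - H) C"
      "c n = cone_congruence (nonneg_exponents V) (nonneg_exponents (V - H)) C"
      using prime_poly_semiring[OF prime[of n]] by blast
    then show ?case by (intro exI[of _ "{}"]) (auto simp: independent_mod_def)
  next
    case (Suc i)
    then obtain B where B: "independent_mod V (c (n - i)) B" "card B = i" by auto
    have "c (n - Suc i) \<subset> c (n - i)"
      using chain[of "n - Suc i"] Suc.prems by (simp add: Suc_diff_Suc)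
    then show ?case
      using independent_mod_strict_subset[OF _ prime B(1), of "n - Suc i"] B(2) by auto
  qed
  from this[of n] obtain B where "independent_mod V (c 0) B" "card B = n" by auto
  then obtain H C where C: "total_cone (V - H) C" and B: "finite B" "B \<subseteq> exponents (V - H)"
    and indep: "\<forall>a. (\<Sum>b\<in>B. frag_cmul (a b) b) \<in> C \<and> - (\<Sum>b\<in>B. frag_cmul (a b) b) \<in> C \<longrightarrow> (\<forall>b\<in>B. a b = 0)"
    unfolding independent_mod_def by (elim exE conjE) (rule that, assumption+)
  have ind: "\<forall>b\<in>B. a b = 0"
    if "(\<Sum>b\<in>B. frag_cmul (a b) b) \<in> C" "- (\<Sum>b\<in>B. frag_cmul (a b) b) \<in> C" for a
    using that by (rule indep[THEN spec[where x = a], THEN mp, OF conjI])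
  \<comment> \<open>A vanishing combination lies in the cone with its negative, so independence
    modulo the cone implies plain integer independence.\<close>
  have "0 \<in> C" using total_coneD(1)[OF C] by (rule add_closedD)
  then have "card B \<le> card V"
    using B exponents_mono[of "V - H" V] ind by (intro card_independent_le[OF V]) auto
  then show ?thesis using \<open>card B = n\<close> by simp
qed

section \<open>A chain of truncated lexicographic orders\<close>

definition lex_cone :: "nat set \<Rightarrow> nat \<Rightarrow> (nat \<Rightarrow>\<^sub>0 int) set" where
  "lex_cone V j = {v \<in> exponents V. lex_ge0 j (\<lambda>i v. real_of_int (Poly_Mapping.lookup v i)) v}"

lemma total_cone_lex_cone: "total_cone V (lex_cone V j)"
  unfolding total_cone_def add_closed_def
proof (intro conjI ballI)
  let ?\<phi> = "\<lambda>i v. real_of_int (Poly_Mapping.lookup v i)"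
  show "0 \<in> lex_cone V j" "lex_cone V j \<subseteq> exponents V"
    by (auto simp: lex_cone_def lex_ge0_def exponents_closed)
  fix u v assume uv: "u \<in> lex_cone V j" "v \<in> lex_cone V j"
  consider "\<forall>i<j. ?\<phi> i u = 0" | "\<forall>i<j. ?\<phi> i v = 0" | "lex_pos j ?\<phi> u" "lex_pos j ?\<phi> v"
    using uv by (auto simp: lex_cone_def lex_ge0_def)
  then have "lex_ge0 j ?\<phi> (u + v)"
  proof cases
    case 3
    then have "lex_pos j ?\<phi> (u + v)" by (intro lex_pos_add) (simp_all add: lookup_add)
    then show ?thesis by (simp add: lex_ge0_def)
  qed (use uv in \<open>auto simp: lex_cone_def lex_ge0_def lex_pos_def lookup_add\<close>)
  then show "u + v \<in> lex_cone V j" using uv by (simp add: lex_cone_def exponents_closed)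
next
  fix v assume "v \<in> exponents V"
  then show "v \<in> lex_cone V j \<or> - v \<in> lex_cone V j"
    using lex_trichotomy[of j "\<lambda>i v. real_of_int (Poly_Mapping.lookup v i)" v]
    by (auto simp: lex_cone_def lex_ge0_def exponents_closed)
qed

text \<open>The variable \<open>j\<close> is equivalent to 1 while only the coordinates below
  \<open>j\<close> are compared, and strictly larger once coordinate \<open>j\<close> is compared
  too.\<close>

lemma order_congruence_lex_cone_strict:
  assumes j: "j \<in> V"
  shows "order_congruence V (lex_cone V (Suc j)) \<subset> order_congruence V (lex_cone V j)"
proof -
  have sub: "lex_cone V (Suc j) \<subseteq> lex_cone V j"
    by (auto simp: lex_cone_def lex_ge0_def lex_pos_def less_Suc_eq)
  have "order_congruence V (lex_cone V (Suc j)) \<subseteq> order_congruence V (lex_cone V j)"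
    using sub unfolding order_congruence_def cone_congruence_def dominated_def by blast
  moreover define x where "x = (Poly_Mapping.single j 1 :: nat \<Rightarrow>\<^sub>0 int)"
  have l: "Poly_Mapping.lookup x i = (if i = j then 1 else 0)" for i
    by (simp add: x_def lookup_single when_def)
  have x: "x \<in> nonneg_exponents V" "0 \<in> nonneg_exponents V"
    using j by (auto simp: mem_nonneg_exponents mem_exponents l)
  have "x \<in> lex_cone V j" "- x \<in> lex_cone V j" "- x \<notin> lex_cone V (Suc j)"
    using x by (auto simp: lex_cone_def lex_ge0_def lex_pos_def l mem_nonneg_exponents exponents_closed)
  then have "(monomial 0, monomial x) \<in> order_congruence V (lex_cone V j)"
    "(monomial 0, monomial x) \<notin> order_congruence V (lex_cone V (Suc j))"
    using x by (auto simp: mem_order_congruence dominated_def)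
  ultimately show ?thesis by blast
qed

lemma congruence_dim_poly_semiring: "congruence_dim (poly_semiring {..<k}) = enat k"
  unfolding congruence_dim_def
proof (rule Sup_eqI)
  fix y assume "y \<in> {enat n | n. \<exists>c :: nat \<Rightarrow> (laurent \<times> laurent) set.
    (\<forall>i\<le>n. prime_congruence (poly_semiring {..<k}) (c i)) \<and> (\<forall>i<n. c i \<subset> c (Suc i))}"
  then obtain n and c :: "nat \<Rightarrow> (laurent \<times> laurent) set" where y: "y = enat n"
    and c: "\<forall>i\<le>n. prime_congruence (poly_semiring {..<k}) (c i)" "\<forall>i<n. c i \<subset> c (Suc i)" by blast
  have "n \<le> card {..<k}" using c by (intro prime_chain_length[of _ n c]) auto
  then show "y \<le> enat k" by (simp add: y)
next
  fix y assume ub: "\<And>z. z \<in> {enat n | n. \<exists>c :: nat \<Rightarrow> (laurent \<times> laurent) set.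
    (\<forall>i\<le>n. prime_congruence (poly_semiring {..<k}) (c i)) \<and> (\<forall>i<n. c i \<subset> c (Suc i))} \<Longrightarrow> z \<le> y"
  \<comment> \<open>Comparing fewer coordinates gives a larger congruence, hence the reversed index;
    the chain ends with the order that compares no coordinate and identifies all non-zero
    polynomials.\<close>
  define c where "c i = order_congruence {..<k} (lex_cone {..<k} (k - i))" for i
  have "prime_congruence (poly_semiring {..<k}) (c i)" for i
    by (simp add: c_def prime_order_congruence total_cone_lex_cone)
  moreover have "c i \<subset> c (Suc i)" if "i < k" for i
    using order_congruence_lex_cone_strict[of "k - Suc i" "{..<k}"] that by (simp add: c_def Suc_diff_Suc)
  ultimately show "enat k \<le> y" by (intro ub) blast
qed

theorem theorem4p9:
  fixes k :: nat
  shows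
    "(\<forall>P. prime_congruence (poly_semiring {..<k}) P \<longrightarrow>
        (\<exists>H U. H \<subseteq> {..<k} \<and>
           admissible U \<and> dim_col U = card ({..<k} - H) \<and>
           prime_congruence (poly_semiring ({..<k} - H)) (poly_prime ({..<k} - H) U) \<and>
           P = generated_congruence (poly_semiring {..<k})
                 ({(variable i, 0) | i. i \<in> H} \<union> poly_prime ({..<k} - H) U)))
     \<and>
     (\<forall>P. minimal_prime_congruence (poly_semiring {..<k}) P \<longrightarrow>
        congruence_kernel (poly_semiring {..<k}) P = {0} \<and>
        (\<exists>U. admissible U \<and> dim_col U = k \<and>
           mat_kernel U \<inter> {map_vec real_of_int n | n. n \<in> carrier_vec k} = {0\<^sub>v k} \<and>
           P = poly_prime {..<k} U))
     \<and>
     congruence_dim (poly_semiring {..<k}) = enat k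
     \<and>
     (\<forall>f \<in> carrier (poly_semiring {..<k}). \<forall>g \<in> carrier (poly_semiring {..<k}).
        (f, g) \<in> congruence_Rad (poly_semiring {..<k})
                   (trivial_congruence (poly_semiring {..<k})) \<longleftrightarrow>
        newt f = newt g)
     \<and>
     balgebra_iso
       (quotient_semiring (poly_semiring {..<k})
          (congruence_Rad (poly_semiring {..<k}) (trivial_congruence (poly_semiring {..<k}))))
       (polytope_semiring {..<k})
     \<and>
     QC_congruence (poly_semiring {..<k})
       (congruence_Rad (poly_semiring {..<k}) (trivial_congruence (poly_semiring {..<k})))"
proof (intro conjI allI impI ballI)
  show "\<exists>H U. H \<subseteq> {..<k} \<and> admissible U \<and> dim_col U = card ({..<k} - H) \<and>
      prime_congruence (poly_semiring ({..<k} - H)) (poly_prime ({..<k} - H) U) \<and>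
      P = generated_congruence (poly_semiring {..<k})
        ({(variable i, 0) | i. i \<in> H} \<union> poly_prime ({..<k} - H) U)"
    if "prime_congruence (poly_semiring {..<k}) P" for P
    using that by (intro prime_is_generated) simp_all
  show "congruence_kernel (poly_semiring {..<k}) P = {0}"
    "\<exists>U. admissible U \<and> dim_col U = k \<and>
      mat_kernel U \<inter> {map_vec real_of_int n | n. n \<in> carrier_vec k} = {0\<^sub>v k} \<and>
      P = poly_prime {..<k} U"
    if "minimal_prime_congruence (poly_semiring {..<k}) P" for P
    using minimal_prime_poly_semiring[OF that] by blast+
  show "congruence_dim (poly_semiring {..<k}) = enat k" by (rule congruence_dim_poly_semiring)
  show "(f, g) \<in> Rad_trivial {..<k} \<longleftrightarrow> newt f = newt g"
    if "f \<in> carrier (poly_semiring {..<k})" "g \<in> carrier (poly_semiring {..<k})" for f g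
    using that by (intro mem_Rad_trivial_iff_newt) (simp_all add: poly_semiring_simps)
  show "balgebra_iso (quotient_semiring (poly_semiring {..<k}) (Rad_trivial {..<k})) (polytope_semiring {..<k})"
    by (intro quotient_Rad_trivial_iso) simp
  show "QC_congruence (poly_semiring {..<k}) (Rad_trivial {..<k})" by (rule QC_Rad_trivial)
qed

end
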